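(* $\pi_1(\mathbb{S}^1)\simeq\mathbb{Z}$, and $\pi_k(\mathbb{S}^1)\simeq 0$ for $k\ge 2$.
   Context: The setting is homotopy type theory (HoTT): intensional Martin-Löf dependent type theory with the univalence axiom (hence function extensionality) and higher inductive types. For types $A,B$, $A\simeq B$ denotes the type of equivalences $\sum_{f:A\to B}\mathtt{isequiv}(f)$, where $\mathtt{isequiv}(f)$ says that $f$ has a left inverse and a right inverse up to homotopy (equivalently, that $f$ has a quasi-inverse); the symbol $\simeq$ denotes equivalence of (underlying) types. The circle $\mathbb{S}^1$ is the higher inductive type generated by a point $\mathtt{base}:\mathbb{S}^1$ and a path $\mathtt{loop}:\mathtt{base}=_{\mathbb{S}^1}\mathtt{base}$, pointed by $\mathtt{base}$. For a pointed type $(A,\star_A)$, the loop space is $\Omega(A):\equiv(\star_A=_A\star_A)$, pointed by $\mathtt{refl}_{\star_A}$; $\Omega^0A:\equiv A$ and $\Omega^{n+1}A:\equiv\Omega(\Omega^nA)$. For $n\ge1$, the $n$-th homotopy group is $\pi_n(A):\equiv\|\Omega^n(A)\|_0$, where $\|-\|_0$ is set truncation (the universal map to a set, i.e. to a type any two parallel paths of which are equal); it is a group under path concatenation. $0$ denotes the unit type $\mathbb{1}$ regarded as the trivial group, and $\mathbb{Z}$ is the type of integers. *)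

theory Defs
  imports Main
begin

text \<open>
  A deep embedding of the formal type theory of the HoTT Book (Appendix A.2): raw terms with
  de Bruijn indices and the three judgments "well-formed context", "typing" and "judgmental
  equality".  The theory has a cumulative hierarchy of universes (a la Russell), the types
  \<Pi>, \<Sigma>, +, 0, 1, N and Id, the univalence axiom, and the higher inductive types S1
  and set truncation.  Function extensionality is not postulated, as it follows from univalence.
  A theorem of homotopy type theory is the assertion that some closed type is inhabited in
  the empty context.

  The object theory cannot be replaced by a HOL locale in which open terms are HOL functions:
  classical functions on terms would give choice operators inside the theory, contradicting
  univalence.
\<close>


section \<open>Raw terms\<close>

text \<open>
  The comments give the named form; variables to the left of a dot are bound in what follows
  it, the rightmost of them having index 0.
\<close>

datatype tm =
    Var nat
  | Univ nat
  | Pi tm tm                  (* Pi A (x. B) *)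
  | Lam tm tm                 (* Lam A (x. b) *)
  | App tm tm
  | Sig tm tm                 (* Sig A (x. B) *)
  | Pair tm tm
  | SigInd tm tm tm           (* SigInd (z. C) (x y. g) p *)
  | Sum tm tm
  | Inl tm
  | Inr tm
  | SumInd tm tm tm tm        (* SumInd (z. C) (x. c) (y. d) e *)
  | Empty
  | EmptyInd tm tm            (* EmptyInd (z. C) e *)
  | Unit
  | Star
  | UnitInd tm tm tm          (* UnitInd (z. C) c e *)
  | NatT
  | ZeroN
  | SucN tm
  | NatInd tm tm tm tm        (* NatInd (z. C) c0 (x y. cs) n *)
  | Id tm tm tm               (* Id A a b *)
  | Refl tm
  | IdInd tm tm tm tm tm      (* IdInd (x y p. C) (z. c) a b p *)
  | Univalence nat tm tm
  | S1
  | Base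
  | Loop
  | S1Ind tm tm tm tm         (* S1Ind (z. C) b l x *)
  | S1Comp tm tm tm           (* S1Comp (z. C) b l *)
  | Trunc tm
  | TrIn tm
  | TrPath tm tm tm tm        (* TrPath x y p q *)
  | TrInd tm tm tm tm         (* TrInd (z. C) (z. s) (x. g) t *)

definition upren :: "(nat \<Rightarrow> nat) \<Rightarrow> nat \<Rightarrow> nat" where
  "upren \<rho> = case_nat 0 (\<lambda>i. Suc (\<rho> i))"

primrec rename :: "(nat \<Rightarrow> nat) \<Rightarrow> tm \<Rightarrow> tm" where
  "rename \<rho> (Var i) = Var (\<rho> i)"
| "rename \<rho> (Univ i) = Univ i"
| "rename \<rho> (Pi a b) = Pi (rename \<rho> a) (rename (upren \<rho>) b)"
| "rename \<rho> (Lam a b) = Lam (rename \<rho> a) (rename (upren \<rho>) b)"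
| "rename \<rho> (App a b) = App (rename \<rho> a) (rename \<rho> b)"
| "rename \<rho> (Sig a b) = Sig (rename \<rho> a) (rename (upren \<rho>) b)"
| "rename \<rho> (Pair a b) = Pair (rename \<rho> a) (rename \<rho> b)"
| "rename \<rho> (SigInd a b c) = SigInd (rename (upren \<rho>) a) (rename (upren (upren \<rho>)) b) (rename \<rho> c)"
| "rename \<rho> (Sum a b) = Sum (rename \<rho> a) (rename \<rho> b)"
| "rename \<rho> (Inl a) = Inl (rename \<rho> a)"
| "rename \<rho> (Inr a) = Inr (rename \<rho> a)"
| "rename \<rho> (SumInd a b c d) = SumInd (rename (upren \<rho>) a) (rename (upren \<rho>) b) (rename (upren \<rho>) c) (rename \<rho> d)"
| "rename \<rho> Empty = Empty"
| "rename \<rho> (EmptyInd a b) = EmptyInd (rename (upren \<rho>) a) (rename \<rho> b)"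
| "rename \<rho> Unit = Unit"
| "rename \<rho> Star = Star"
| "rename \<rho> (UnitInd a b c) = UnitInd (rename (upren \<rho>) a) (rename \<rho> b) (rename \<rho> c)"
| "rename \<rho> NatT = NatT"
| "rename \<rho> ZeroN = ZeroN"
| "rename \<rho> (SucN a) = SucN (rename \<rho> a)"
| "rename \<rho> (NatInd a b c d) = NatInd (rename (upren \<rho>) a) (rename \<rho> b) (rename (upren (upren \<rho>)) c) (rename \<rho> d)"
| "rename \<rho> (Id a b c) = Id (rename \<rho> a) (rename \<rho> b) (rename \<rho> c)"
| "rename \<rho> (Refl a) = Refl (rename \<rho> a)"
| "rename \<rho> (IdInd a b c d e) = IdInd (rename (upren (upren (upren \<rho>))) a) (rename (upren \<rho>) b) (rename \<rho> c) (rename \<rho> d) (rename \<rho> e)"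
| "rename \<rho> (Univalence i A B) = Univalence i (rename \<rho> A) (rename \<rho> B)"
| "rename \<rho> S1 = S1"
| "rename \<rho> Base = Base"
| "rename \<rho> Loop = Loop"
| "rename \<rho> (S1Ind a b c d) = S1Ind (rename (upren \<rho>) a) (rename \<rho> b) (rename \<rho> c) (rename \<rho> d)"
| "rename \<rho> (S1Comp a b c) = S1Comp (rename (upren \<rho>) a) (rename \<rho> b) (rename \<rho> c)"
| "rename \<rho> (Trunc a) = Trunc (rename \<rho> a)"
| "rename \<rho> (TrIn a) = TrIn (rename \<rho> a)"
| "rename \<rho> (TrPath a b c d) = TrPath (rename \<rho> a) (rename \<rho> b) (rename \<rho> c) (rename \<rho> d)"
| "rename \<rho> (TrInd a b c d) = TrInd (rename (upren \<rho>) a) (rename (upren \<rho>) b) (rename (upren \<rho>) c) (rename \<rho> d)"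

definition up :: "(nat \<Rightarrow> tm) \<Rightarrow> nat \<Rightarrow> tm" where
  "up \<sigma> = case_nat (Var 0) (\<lambda>i. rename Suc (\<sigma> i))"

primrec subst :: "(nat \<Rightarrow> tm) \<Rightarrow> tm \<Rightarrow> tm" where
  "subst \<sigma> (Var i) = \<sigma> i"
| "subst \<sigma> (Univ i) = Univ i"
| "subst \<sigma> (Pi a b) = Pi (subst \<sigma> a) (subst (up \<sigma>) b)"
| "subst \<sigma> (Lam a b) = Lam (subst \<sigma> a) (subst (up \<sigma>) b)"
| "subst \<sigma> (App a b) = App (subst \<sigma> a) (subst \<sigma> b)"
| "subst \<sigma> (Sig a b) = Sig (subst \<sigma> a) (subst (up \<sigma>) b)"
| "subst \<sigma> (Pair a b) = Pair (subst \<sigma> a) (subst \<sigma> b)"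
| "subst \<sigma> (SigInd a b c) = SigInd (subst (up \<sigma>) a) (subst (up (up \<sigma>)) b) (subst \<sigma> c)"
| "subst \<sigma> (Sum a b) = Sum (subst \<sigma> a) (subst \<sigma> b)"
| "subst \<sigma> (Inl a) = Inl (subst \<sigma> a)"
| "subst \<sigma> (Inr a) = Inr (subst \<sigma> a)"
| "subst \<sigma> (SumInd a b c d) = SumInd (subst (up \<sigma>) a) (subst (up \<sigma>) b) (subst (up \<sigma>) c) (subst \<sigma> d)"
| "subst \<sigma> Empty = Empty"
| "subst \<sigma> (EmptyInd a b) = EmptyInd (subst (up \<sigma>) a) (subst \<sigma> b)"
| "subst \<sigma> Unit = Unit"
| "subst \<sigma> Star = Star"
| "subst \<sigma> (UnitInd a b c) = UnitInd (subst (up \<sigma>) a) (subst \<sigma> b) (subst \<sigma> c)"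
| "subst \<sigma> NatT = NatT"
| "subst \<sigma> ZeroN = ZeroN"
| "subst \<sigma> (SucN a) = SucN (subst \<sigma> a)"
| "subst \<sigma> (NatInd a b c d) = NatInd (subst (up \<sigma>) a) (subst \<sigma> b) (subst (up (up \<sigma>)) c) (subst \<sigma> d)"
| "subst \<sigma> (Id a b c) = Id (subst \<sigma> a) (subst \<sigma> b) (subst \<sigma> c)"
| "subst \<sigma> (Refl a) = Refl (subst \<sigma> a)"
| "subst \<sigma> (IdInd a b c d e) = IdInd (subst (up (up (up \<sigma>))) a) (subst (up \<sigma>) b) (subst \<sigma> c) (subst \<sigma> d) (subst \<sigma> e)"
| "subst \<sigma> (Univalence i A B) = Univalence i (subst \<sigma> A) (subst \<sigma> B)"
| "subst \<sigma> S1 = S1"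
| "subst \<sigma> Base = Base"
| "subst \<sigma> Loop = Loop"
| "subst \<sigma> (S1Ind a b c d) = S1Ind (subst (up \<sigma>) a) (subst \<sigma> b) (subst \<sigma> c) (subst \<sigma> d)"
| "subst \<sigma> (S1Comp a b c) = S1Comp (subst (up \<sigma>) a) (subst \<sigma> b) (subst \<sigma> c)"
| "subst \<sigma> (Trunc a) = Trunc (subst \<sigma> a)"
| "subst \<sigma> (TrIn a) = TrIn (subst \<sigma> a)"
| "subst \<sigma> (TrPath a b c d) = TrPath (subst \<sigma> a) (subst \<sigma> b) (subst \<sigma> c) (subst \<sigma> d)"
| "subst \<sigma> (TrInd a b c d) = TrInd (subst (up \<sigma>) a) (subst (up \<sigma>) b) (subst (up \<sigma>) c) (subst \<sigma> d)"

text \<open>Weakening by \<open>n\<close> variables, and the same below one binder.\<close>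

definition wk :: "nat \<Rightarrow> tm \<Rightarrow> tm" where
  "wk n t = rename (\<lambda>i. i + n) t"

definition wk1 :: "nat \<Rightarrow> tm \<Rightarrow> tm" where
  "wk1 n t = rename (upren (\<lambda>i. i + n)) t"

text \<open>
  \<open>inst k [a\<^sub>0, \<dots>, a\<^sub>m] t\<close> replaces the innermost variables \<open>0, \<dots>, m\<close> of \<open>t\<close> by the given terms,
  which live in the remaining context extended by \<open>k\<close> new variables.
\<close>

definition inst :: "nat \<Rightarrow> tm list \<Rightarrow> tm \<Rightarrow> tm" where
  "inst k as t = subst (\<lambda>i. if i < length as then as ! i else Var (i - length as + k)) t"


section \<open>Derived notions used in the rules\<close>

definition arrow :: "tm \<Rightarrow> tm \<Rightarrow> tm" where
  "arrow A B = Pi A (wk 1 B)"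

definition times :: "tm \<Rightarrow> tm \<Rightarrow> tm" where
  "times A B = Sig A (wk 1 B)"

text \<open>
  \<open>isequiv A B f\<close> is
  \<open>(\<Sigma>(g : B \<rightarrow> A). \<Pi>(y : B). f (g y) = y) \<times> (\<Sigma>(h : B \<rightarrow> A). \<Pi>(x : A). h (f x) = x)\<close>.
\<close>

definition isequiv :: "tm \<Rightarrow> tm \<Rightarrow> tm \<Rightarrow> tm" where
  "isequiv A B f = times
     (Sig (arrow B A)
       (Pi (wk 1 B) (Id (wk 2 B) (App (wk 2 f) (App (Var 1) (Var 0))) (Var 0))))
     (Sig (arrow B A)
       (Pi (wk 1 A) (Id (wk 2 A) (App (Var 1) (App (wk 2 f) (Var 0))) (Var 0))))"

definition equiv :: "tm \<Rightarrow> tm \<Rightarrow> tm" where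
  "equiv A B = Sig (arrow A B) (isequiv (wk 1 A) (wk 1 B) (Var 0))"

definition idequiv :: "tm \<Rightarrow> tm" where
  "idequiv A =
     Pair (Lam A (Var 0))
       (Pair (Pair (Lam A (Var 0)) (Lam A (Refl (Var 0))))
             (Pair (Lam A (Var 0)) (Lam A (Refl (Var 0)))))"

text \<open>The map \<open>(A =\<^bsub>U\<^sub>i\<^esub> B) \<rightarrow> (A \<simeq> B)\<close> sending \<open>refl\<close> to the identity equivalence.\<close>

definition idtoeqv :: "nat \<Rightarrow> tm \<Rightarrow> tm \<Rightarrow> tm" where
  "idtoeqv i A B = Lam (Id (Univ i) A B)
     (IdInd (equiv (Var 2) (Var 1)) (idequiv (Var 0)) (wk 1 A) (wk 1 B) (Var 0))"

text \<open>
  \<open>transport (x. C) a b p u : C[b]\<close> for \<open>p : a = b\<close> and \<open>u : C[a]\<close>, and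
  \<open>apd (x. C) f a b p : transport (x. C) a b p (f a) = f b\<close> for \<open>f : \<Pi>x. C\<close>.
\<close>

definition transport :: "tm \<Rightarrow> tm \<Rightarrow> tm \<Rightarrow> tm \<Rightarrow> tm \<Rightarrow> tm" where
  "transport C a b p u =
     App (IdInd (arrow (inst 3 [Var 2] C) (inst 3 [Var 1] C)) (Lam C (Var 0)) a b p) u"

definition apd :: "tm \<Rightarrow> tm \<Rightarrow> tm \<Rightarrow> tm \<Rightarrow> tm \<Rightarrow> tm" where
  "apd C f a b p =
     IdInd (Id (inst 3 [Var 1] C)
               (transport (wk1 3 C) (Var 2) (Var 1) (Var 0) (App (wk 3 f) (Var 2)))
               (App (wk 3 f) (Var 1)))
           (Refl (App (wk 1 f) (Var 0))) a b p"

text \<open>\<open>\<Pi>(x y : A). \<Pi>(p q : x = y). p = q\<close>\<close>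

definition isset :: "tm \<Rightarrow> tm" where
  "isset A =
     Pi A (Pi (wk 1 A)
       (Pi (Id (wk 2 A) (Var 1) (Var 0)) (Pi (Id (wk 3 A) (Var 2) (Var 1))
         (Id (Id (wk 4 A) (Var 3) (Var 2)) (Var 1) (Var 0)))))"


section \<open>Judgments\<close>

text \<open>
  A context lists the types of its variables, innermost first; the type of variable \<open>i\<close> lives in
  \<open>drop (Suc i) \<Gamma>\<close>.  Typing rules are followed by their congruence rules, which the
  Book leaves implicit.  The substitution rules (which
  comprise weakening) are admissible; they are included for convenience.
\<close>

type_synonym ctx = "tm list"

inductive
  ctxt :: "ctx \<Rightarrow> bool" (\<open>\<turnstile> _ ctx\<close> [51] 50) and
  typing :: "ctx \<Rightarrow> tm \<Rightarrow> tm \<Rightarrow> bool" (\<open>_ \<turnstile> _ : _\<close> [51, 51, 51] 50) and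
  jeq :: "ctx \<Rightarrow> tm \<Rightarrow> tm \<Rightarrow> tm \<Rightarrow> bool" (\<open>_ \<turnstile> _ \<equiv> _ : _\<close> [51, 51, 51, 51] 50)
where
  (* Contexts, variables, substitution *)
  ctx_empty: "\<turnstile> [] ctx"
| ctx_extend: "\<Gamma> \<turnstile> A : Univ i \<Longrightarrow> \<turnstile> A # \<Gamma> ctx"
| var: "\<lbrakk>\<turnstile> \<Gamma> ctx; i < length \<Gamma>\<rbrakk> \<Longrightarrow> \<Gamma> \<turnstile> Var i : wk (Suc i) (\<Gamma> ! i)"
| subst_typing:
    "\<lbrakk>\<Gamma> \<turnstile> a : A;
      \<turnstile> \<Delta> ctx;
      \<forall>i<length \<Gamma>. \<Delta> \<turnstile> \<sigma> i : subst \<sigma> (wk (Suc i) (\<Gamma> ! i))\<rbrakk>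
    \<Longrightarrow> \<Delta> \<turnstile> subst \<sigma> a : subst \<sigma> A"
| subst_eq:
    "\<lbrakk>\<Gamma> \<turnstile> a \<equiv> b : A;
      \<turnstile> \<Delta> ctx;
      \<forall>i<length \<Gamma>. \<Delta> \<turnstile> \<sigma> i : subst \<sigma> (wk (Suc i) (\<Gamma> ! i))\<rbrakk>
    \<Longrightarrow> \<Delta> \<turnstile> subst \<sigma> a \<equiv> subst \<sigma> b : subst \<sigma> A"

  (* Judgmental equality and conversion *)
| eq_refl: "\<Gamma> \<turnstile> a : A \<Longrightarrow> \<Gamma> \<turnstile> a \<equiv> a : A"
| eq_sym: "\<Gamma> \<turnstile> a \<equiv> b : A \<Longrightarrow> \<Gamma> \<turnstile> b \<equiv> a : A"
| eq_trans: "\<lbrakk>\<Gamma> \<turnstile> a \<equiv> b : A; \<Gamma> \<turnstile> b \<equiv> c : A\<rbrakk> \<Longrightarrow> \<Gamma> \<turnstile> a \<equiv> c : A"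
| conv: "\<lbrakk>\<Gamma> \<turnstile> a : A; \<Gamma> \<turnstile> A \<equiv> B : Univ i\<rbrakk> \<Longrightarrow> \<Gamma> \<turnstile> a : B"
| conv_eq: "\<lbrakk>\<Gamma> \<turnstile> a \<equiv> b : A; \<Gamma> \<turnstile> A \<equiv> B : Univ i\<rbrakk> \<Longrightarrow> \<Gamma> \<turnstile> a \<equiv> b : B"

  (* Universes *)
| univ: "\<turnstile> \<Gamma> ctx \<Longrightarrow> \<Gamma> \<turnstile> Univ i : Univ (Suc i)"
| cumul: "\<Gamma> \<turnstile> A : Univ i \<Longrightarrow> \<Gamma> \<turnstile> A : Univ (Suc i)"
| cumul_eq: "\<Gamma> \<turnstile> A \<equiv> B : Univ i \<Longrightarrow> \<Gamma> \<turnstile> A \<equiv> B : Univ (Suc i)"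

  (* Dependent functions *)
| Pi_form: "\<lbrakk>\<Gamma> \<turnstile> A : Univ i; A # \<Gamma> \<turnstile> B : Univ i\<rbrakk> \<Longrightarrow> \<Gamma> \<turnstile> Pi A B : Univ i"
| Pi_form_cong:
    "\<lbrakk>\<Gamma> \<turnstile> A \<equiv> A' : Univ i;
      A # \<Gamma> \<turnstile> B \<equiv> B' : Univ i\<rbrakk>
    \<Longrightarrow> \<Gamma> \<turnstile> Pi A B \<equiv> Pi A' B' : Univ i"
| Pi_intro: "\<lbrakk>\<Gamma> \<turnstile> A : Univ i; A # \<Gamma> \<turnstile> b : B\<rbrakk> \<Longrightarrow> \<Gamma> \<turnstile> Lam A b : Pi A B"
| Pi_intro_cong: "\<lbrakk>\<Gamma> \<turnstile> A \<equiv> A' : Univ i; A # \<Gamma> \<turnstile> b \<equiv> b' : B\<rbrakk> \<Longrightarrow> \<Gamma> \<turnstile> Lam A b \<equiv> Lam A' b' : Pi A B"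
| Pi_elim: "\<lbrakk>\<Gamma> \<turnstile> f : Pi A B; \<Gamma> \<turnstile> a : A\<rbrakk> \<Longrightarrow> \<Gamma> \<turnstile> App f a : inst 0 [a] B"
| Pi_elim_cong: "\<lbrakk>\<Gamma> \<turnstile> f \<equiv> f' : Pi A B; \<Gamma> \<turnstile> a \<equiv> a' : A\<rbrakk> \<Longrightarrow> \<Gamma> \<turnstile> App f a \<equiv> App f' a' : inst 0 [a] B"
| Pi_comp: "\<lbrakk>A # \<Gamma> \<turnstile> b : B; \<Gamma> \<turnstile> a : A\<rbrakk> \<Longrightarrow> \<Gamma> \<turnstile> App (Lam A b) a \<equiv> inst 0 [a] b : inst 0 [a] B"
| Pi_uniq: "\<Gamma> \<turnstile> f : Pi A B \<Longrightarrow> \<Gamma> \<turnstile> f \<equiv> Lam A (App (wk 1 f) (Var 0)) : Pi A B"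

  (* Dependent pairs *)
| Sig_form: "\<lbrakk>\<Gamma> \<turnstile> A : Univ i; A # \<Gamma> \<turnstile> B : Univ i\<rbrakk> \<Longrightarrow> \<Gamma> \<turnstile> Sig A B : Univ i"
| Sig_form_cong:
    "\<lbrakk>\<Gamma> \<turnstile> A \<equiv> A' : Univ i;
      A # \<Gamma> \<turnstile> B \<equiv> B' : Univ i\<rbrakk>
    \<Longrightarrow> \<Gamma> \<turnstile> Sig A B \<equiv> Sig A' B' : Univ i"
| Sig_intro: "\<lbrakk>A # \<Gamma> \<turnstile> B : Univ i; \<Gamma> \<turnstile> a : A; \<Gamma> \<turnstile> b : inst 0 [a] B\<rbrakk> \<Longrightarrow> \<Gamma> \<turnstile> Pair a b : Sig A B"
| Sig_intro_cong:
    "\<lbrakk>A # \<Gamma> \<turnstile> B : Univ i;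
      \<Gamma> \<turnstile> a \<equiv> a' : A;
      \<Gamma> \<turnstile> b \<equiv> b' : inst 0 [a] B\<rbrakk>
    \<Longrightarrow> \<Gamma> \<turnstile> Pair a b \<equiv> Pair a' b' : Sig A B"
| Sig_elim:
    "\<lbrakk>Sig A B # \<Gamma> \<turnstile> C : Univ i;
      B # A # \<Gamma> \<turnstile> g : inst 2 [Pair (Var 1) (Var 0)] C;
      \<Gamma> \<turnstile> p : Sig A B\<rbrakk>
    \<Longrightarrow> \<Gamma> \<turnstile> SigInd C g p : inst 0 [p] C"
| Sig_elim_cong:
    "\<lbrakk>Sig A B # \<Gamma> \<turnstile> C \<equiv> C' : Univ i;
      B # A # \<Gamma> \<turnstile> g \<equiv> g' : inst 2 [Pair (Var 1) (Var 0)] C;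
      \<Gamma> \<turnstile> p \<equiv> p' : Sig A B\<rbrakk>
    \<Longrightarrow> \<Gamma> \<turnstile> SigInd C g p \<equiv> SigInd C' g' p' : inst 0 [p] C"
| Sig_comp:
    "\<lbrakk>Sig A B # \<Gamma> \<turnstile> C : Univ i;
      B # A # \<Gamma> \<turnstile> g : inst 2 [Pair (Var 1) (Var 0)] C;
      \<Gamma> \<turnstile> a : A;
      \<Gamma> \<turnstile> b : inst 0 [a] B\<rbrakk>
    \<Longrightarrow> \<Gamma> \<turnstile> SigInd C g (Pair a b) \<equiv> inst 0 [b, a] g : inst 0 [Pair a b] C"

  (* Coproducts *)
| Sum_form: "\<lbrakk>\<Gamma> \<turnstile> A : Univ i; \<Gamma> \<turnstile> B : Univ i\<rbrakk> \<Longrightarrow> \<Gamma> \<turnstile> Sum A B : Univ i"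
| Sum_form_cong: "\<lbrakk>\<Gamma> \<turnstile> A \<equiv> A' : Univ i; \<Gamma> \<turnstile> B \<equiv> B' : Univ i\<rbrakk> \<Longrightarrow> \<Gamma> \<turnstile> Sum A B \<equiv> Sum A' B' : Univ i"
| Sum_intro_l: "\<lbrakk>\<Gamma> \<turnstile> A : Univ i; \<Gamma> \<turnstile> B : Univ i; \<Gamma> \<turnstile> a : A\<rbrakk> \<Longrightarrow> \<Gamma> \<turnstile> Inl a : Sum A B"
| Sum_intro_l_cong:
    "\<lbrakk>\<Gamma> \<turnstile> A : Univ i;
      \<Gamma> \<turnstile> B : Univ i;
      \<Gamma> \<turnstile> a \<equiv> a' : A\<rbrakk>
    \<Longrightarrow> \<Gamma> \<turnstile> Inl a \<equiv> Inl a' : Sum A B"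
| Sum_intro_r: "\<lbrakk>\<Gamma> \<turnstile> A : Univ i; \<Gamma> \<turnstile> B : Univ i; \<Gamma> \<turnstile> b : B\<rbrakk> \<Longrightarrow> \<Gamma> \<turnstile> Inr b : Sum A B"
| Sum_intro_r_cong:
    "\<lbrakk>\<Gamma> \<turnstile> A : Univ i;
      \<Gamma> \<turnstile> B : Univ i;
      \<Gamma> \<turnstile> b \<equiv> b' : B\<rbrakk>
    \<Longrightarrow> \<Gamma> \<turnstile> Inr b \<equiv> Inr b' : Sum A B"
| Sum_elim:
    "\<lbrakk>Sum A B # \<Gamma> \<turnstile> C : Univ i;
      A # \<Gamma> \<turnstile> c : inst 1 [Inl (Var 0)] C;
      B # \<Gamma> \<turnstile> d : inst 1 [Inr (Var 0)] C;
      \<Gamma> \<turnstile> e : Sum A B\<rbrakk>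
    \<Longrightarrow> \<Gamma> \<turnstile> SumInd C c d e : inst 0 [e] C"
| Sum_elim_cong:
    "\<lbrakk>Sum A B # \<Gamma> \<turnstile> C \<equiv> C' : Univ i;
      A # \<Gamma> \<turnstile> c \<equiv> c' : inst 1 [Inl (Var 0)] C;
      B # \<Gamma> \<turnstile> d \<equiv> d' : inst 1 [Inr (Var 0)] C;
      \<Gamma> \<turnstile> e \<equiv> e' : Sum A B\<rbrakk>
    \<Longrightarrow> \<Gamma> \<turnstile> SumInd C c d e \<equiv> SumInd C' c' d' e' : inst 0 [e] C"
| Sum_comp_l:
    "\<lbrakk>Sum A B # \<Gamma> \<turnstile> C : Univ i;
      A # \<Gamma> \<turnstile> c : inst 1 [Inl (Var 0)] C;
      B # \<Gamma> \<turnstile> d : inst 1 [Inr (Var 0)] C;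
      \<Gamma> \<turnstile> a : A\<rbrakk>
    \<Longrightarrow> \<Gamma> \<turnstile> SumInd C c d (Inl a) \<equiv> inst 0 [a] c : inst 0 [Inl a] C"
| Sum_comp_r:
    "\<lbrakk>Sum A B # \<Gamma> \<turnstile> C : Univ i;
      A # \<Gamma> \<turnstile> c : inst 1 [Inl (Var 0)] C;
      B # \<Gamma> \<turnstile> d : inst 1 [Inr (Var 0)] C;
      \<Gamma> \<turnstile> b : B\<rbrakk>
    \<Longrightarrow> \<Gamma> \<turnstile> SumInd C c d (Inr b) \<equiv> inst 0 [b] d : inst 0 [Inr b] C"

  (* Empty type and unit type *)
| Empty_form: "\<turnstile> \<Gamma> ctx \<Longrightarrow> \<Gamma> \<turnstile> Empty : Univ i"
| Empty_elim: "\<lbrakk>Empty # \<Gamma> \<turnstile> C : Univ i; \<Gamma> \<turnstile> e : Empty\<rbrakk> \<Longrightarrow> \<Gamma> \<turnstile> EmptyInd C e : inst 0 [e] C"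
| Empty_elim_cong:
    "\<lbrakk>Empty # \<Gamma> \<turnstile> C \<equiv> C' : Univ i;
      \<Gamma> \<turnstile> e \<equiv> e' : Empty\<rbrakk>
    \<Longrightarrow> \<Gamma> \<turnstile> EmptyInd C e \<equiv> EmptyInd C' e' : inst 0 [e] C"
| Unit_form: "\<turnstile> \<Gamma> ctx \<Longrightarrow> \<Gamma> \<turnstile> Unit : Univ i"
| Unit_intro: "\<turnstile> \<Gamma> ctx \<Longrightarrow> \<Gamma> \<turnstile> Star : Unit"
| Unit_elim:
    "\<lbrakk>Unit # \<Gamma> \<turnstile> C : Univ i;
      \<Gamma> \<turnstile> c : inst 0 [Star] C;
      \<Gamma> \<turnstile> e : Unit\<rbrakk>
    \<Longrightarrow> \<Gamma> \<turnstile> UnitInd C c e : inst 0 [e] C"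
| Unit_elim_cong:
    "\<lbrakk>Unit # \<Gamma> \<turnstile> C \<equiv> C' : Univ i;
      \<Gamma> \<turnstile> c \<equiv> c' : inst 0 [Star] C;
      \<Gamma> \<turnstile> e \<equiv> e' : Unit\<rbrakk>
    \<Longrightarrow> \<Gamma> \<turnstile> UnitInd C c e \<equiv> UnitInd C' c' e' : inst 0 [e] C"
| Unit_comp:
    "\<lbrakk>Unit # \<Gamma> \<turnstile> C : Univ i;
      \<Gamma> \<turnstile> c : inst 0 [Star] C\<rbrakk>
    \<Longrightarrow> \<Gamma> \<turnstile> UnitInd C c Star \<equiv> c : inst 0 [Star] C"

  (* Natural numbers *)
| Nat_form: "\<turnstile> \<Gamma> ctx \<Longrightarrow> \<Gamma> \<turnstile> NatT : Univ i"
| Nat_intro_zero: "\<turnstile> \<Gamma> ctx \<Longrightarrow> \<Gamma> \<turnstile> ZeroN : NatT"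
| Nat_intro_suc: "\<Gamma> \<turnstile> n : NatT \<Longrightarrow> \<Gamma> \<turnstile> SucN n : NatT"
| Nat_intro_suc_cong: "\<Gamma> \<turnstile> n \<equiv> n' : NatT \<Longrightarrow> \<Gamma> \<turnstile> SucN n \<equiv> SucN n' : NatT"
| Nat_elim:
    "\<lbrakk>NatT # \<Gamma> \<turnstile> C : Univ i;
      \<Gamma> \<turnstile> z : inst 0 [ZeroN] C;
      C # NatT # \<Gamma> \<turnstile> s : inst 2 [SucN (Var 1)] C;
      \<Gamma> \<turnstile> n : NatT\<rbrakk>
    \<Longrightarrow> \<Gamma> \<turnstile> NatInd C z s n : inst 0 [n] C"
| Nat_elim_cong:
    "\<lbrakk>NatT # \<Gamma> \<turnstile> C \<equiv> C' : Univ i;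
      \<Gamma> \<turnstile> z \<equiv> z' : inst 0 [ZeroN] C;
      C # NatT # \<Gamma> \<turnstile> s \<equiv> s' : inst 2 [SucN (Var 1)] C;
      \<Gamma> \<turnstile> n \<equiv> n' : NatT\<rbrakk>
    \<Longrightarrow> \<Gamma> \<turnstile> NatInd C z s n \<equiv> NatInd C' z' s' n' : inst 0 [n] C"
| Nat_comp_zero:
    "\<lbrakk>NatT # \<Gamma> \<turnstile> C : Univ i;
      \<Gamma> \<turnstile> z : inst 0 [ZeroN] C;
      C # NatT # \<Gamma> \<turnstile> s : inst 2 [SucN (Var 1)] C\<rbrakk>
    \<Longrightarrow> \<Gamma> \<turnstile> NatInd C z s ZeroN \<equiv> z : inst 0 [ZeroN] C"
| Nat_comp_suc:
    "\<lbrakk>NatT # \<Gamma> \<turnstile> C : Univ i;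
      \<Gamma> \<turnstile> z : inst 0 [ZeroN] C;
      C # NatT # \<Gamma> \<turnstile> s : inst 2 [SucN (Var 1)] C;
      \<Gamma> \<turnstile> n : NatT\<rbrakk>
    \<Longrightarrow> \<Gamma> \<turnstile> NatInd C z s (SucN n) \<equiv> inst 0 [NatInd C z s n, n] s : inst 0 [SucN n] C"

  (* Identity types *)
| Id_form: "\<lbrakk>\<Gamma> \<turnstile> A : Univ i; \<Gamma> \<turnstile> a : A; \<Gamma> \<turnstile> b : A\<rbrakk> \<Longrightarrow> \<Gamma> \<turnstile> Id A a b : Univ i"
| Id_form_cong:
    "\<lbrakk>\<Gamma> \<turnstile> A \<equiv> A' : Univ i;
      \<Gamma> \<turnstile> a \<equiv> a' : A;
      \<Gamma> \<turnstile> b \<equiv> b' : A\<rbrakk>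
    \<Longrightarrow> \<Gamma> \<turnstile> Id A a b \<equiv> Id A' a' b' : Univ i"
| Id_intro: "\<lbrakk>\<Gamma> \<turnstile> A : Univ i; \<Gamma> \<turnstile> a : A\<rbrakk> \<Longrightarrow> \<Gamma> \<turnstile> Refl a : Id A a a"
| Id_intro_cong: "\<lbrakk>\<Gamma> \<turnstile> A : Univ i; \<Gamma> \<turnstile> a \<equiv> a' : A\<rbrakk> \<Longrightarrow> \<Gamma> \<turnstile> Refl a \<equiv> Refl a' : Id A a a"
| Id_elim:
    "\<lbrakk>Id (wk 2 A) (Var 1) (Var 0) # wk 1 A # A # \<Gamma> \<turnstile> C : Univ i;
      A # \<Gamma> \<turnstile> c : inst 1 [Refl (Var 0), Var 0, Var 0] C;
      \<Gamma> \<turnstile> a : A;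
      \<Gamma> \<turnstile> b : A;
      \<Gamma> \<turnstile> p : Id A a b\<rbrakk>
    \<Longrightarrow> \<Gamma> \<turnstile> IdInd C c a b p : inst 0 [p, b, a] C"
| Id_elim_cong:
    "\<lbrakk>Id (wk 2 A) (Var 1) (Var 0) # wk 1 A # A # \<Gamma> \<turnstile> C \<equiv> C' : Univ i;
      A # \<Gamma> \<turnstile> c \<equiv> c' : inst 1 [Refl (Var 0), Var 0, Var 0] C;
      \<Gamma> \<turnstile> a \<equiv> a' : A;
      \<Gamma> \<turnstile> b \<equiv> b' : A;
      \<Gamma> \<turnstile> p \<equiv> p' : Id A a b\<rbrakk>
    \<Longrightarrow> \<Gamma> \<turnstile> IdInd C c a b p \<equiv> IdInd C' c' a' b' p' : inst 0 [p, b, a] C"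
| Id_comp:
    "\<lbrakk>Id (wk 2 A) (Var 1) (Var 0) # wk 1 A # A # \<Gamma> \<turnstile> C : Univ i;
      A # \<Gamma> \<turnstile> c : inst 1 [Refl (Var 0), Var 0, Var 0] C;
      \<Gamma> \<turnstile> a : A\<rbrakk>
    \<Longrightarrow> \<Gamma> \<turnstile> IdInd C c a a (Refl a) \<equiv> inst 0 [a] c : inst 0 [Refl a, a, a] C"

  (* Univalence *)
| univalence:
    "\<lbrakk>\<Gamma> \<turnstile> A : Univ i;
      \<Gamma> \<turnstile> B : Univ i\<rbrakk>
    \<Longrightarrow> \<Gamma> \<turnstile> Univalence i A B : isequiv (Id (Univ i) A B) (equiv A B) (idtoeqv i A B)"
| univalence_cong:
    "\<lbrakk>\<Gamma> \<turnstile> A \<equiv> A' : Univ i;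
      \<Gamma> \<turnstile> B \<equiv> B' : Univ i\<rbrakk>
    \<Longrightarrow> \<Gamma> \<turnstile> Univalence i A B \<equiv> Univalence i A' B' : isequiv (Id (Univ i) A B) (equiv A B) (idtoeqv i A B)"

  (* The circle: the computation rule for Base is judgmental, the one for Loop is a path *)
| S1_form: "\<turnstile> \<Gamma> ctx \<Longrightarrow> \<Gamma> \<turnstile> S1 : Univ i"
| S1_intro_base: "\<turnstile> \<Gamma> ctx \<Longrightarrow> \<Gamma> \<turnstile> Base : S1"
| S1_intro_loop: "\<turnstile> \<Gamma> ctx \<Longrightarrow> \<Gamma> \<turnstile> Loop : Id S1 Base Base"
| S1_elim:
    "\<lbrakk>S1 # \<Gamma> \<turnstile> C : Univ i;
      \<Gamma> \<turnstile> b : inst 0 [Base] C;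
      \<Gamma> \<turnstile> l : Id (inst 0 [Base] C) (transport C Base Base Loop b) b;
      \<Gamma> \<turnstile> x : S1\<rbrakk>
    \<Longrightarrow> \<Gamma> \<turnstile> S1Ind C b l x : inst 0 [x] C"
| S1_elim_cong:
    "\<lbrakk>S1 # \<Gamma> \<turnstile> C \<equiv> C' : Univ i;
      \<Gamma> \<turnstile> b \<equiv> b' : inst 0 [Base] C;
      \<Gamma> \<turnstile> l \<equiv> l' : Id (inst 0 [Base] C) (transport C Base Base Loop b) b;
      \<Gamma> \<turnstile> x \<equiv> x' : S1\<rbrakk>
    \<Longrightarrow> \<Gamma> \<turnstile> S1Ind C b l x \<equiv> S1Ind C' b' l' x' : inst 0 [x] C"
| S1_comp_base:
    "\<lbrakk>S1 # \<Gamma> \<turnstile> C : Univ i;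
      \<Gamma> \<turnstile> b : inst 0 [Base] C;
      \<Gamma> \<turnstile> l : Id (inst 0 [Base] C) (transport C Base Base Loop b) b\<rbrakk>
    \<Longrightarrow> \<Gamma> \<turnstile> S1Ind C b l Base \<equiv> b : inst 0 [Base] C"
| S1_comp_loop:
    "\<lbrakk>S1 # \<Gamma> \<turnstile> C : Univ i;
      \<Gamma> \<turnstile> b : inst 0 [Base] C;
      \<Gamma> \<turnstile> l : Id (inst 0 [Base] C) (transport C Base Base Loop b) b\<rbrakk>
    \<Longrightarrow> \<Gamma> \<turnstile> S1Comp C b l : Id (Id (inst 0 [Base] C) (transport C Base Base Loop b) b) (apd C (Lam S1 (S1Ind (wk1 1 C) (wk 1 b) (wk 1 l) (Var 0))) Base Base Loop) l"
| S1_comp_loop_cong: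
    "\<lbrakk>S1 # \<Gamma> \<turnstile> C \<equiv> C' : Univ i;
      \<Gamma> \<turnstile> b \<equiv> b' : inst 0 [Base] C;
      \<Gamma> \<turnstile> l \<equiv> l' : Id (inst 0 [Base] C) (transport C Base Base Loop b) b\<rbrakk>
    \<Longrightarrow> \<Gamma> \<turnstile> S1Comp C b l \<equiv> S1Comp C' b' l' : Id (Id (inst 0 [Base] C) (transport C Base Base Loop b) b) (apd C (Lam S1 (S1Ind (wk1 1 C) (wk 1 b) (wk 1 l) (Var 0))) Base Base Loop) l"

  (* Set truncation: the universal map to a set, i.e. elimination is into families of sets *)
| Trunc_form: "\<Gamma> \<turnstile> A : Univ i \<Longrightarrow> \<Gamma> \<turnstile> Trunc A : Univ i"
| Trunc_form_cong: "\<Gamma> \<turnstile> A \<equiv> A' : Univ i \<Longrightarrow> \<Gamma> \<turnstile> Trunc A \<equiv> Trunc A' : Univ i"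
| Trunc_intro: "\<lbrakk>\<Gamma> \<turnstile> A : Univ i; \<Gamma> \<turnstile> a : A\<rbrakk> \<Longrightarrow> \<Gamma> \<turnstile> TrIn a : Trunc A"
| Trunc_intro_cong: "\<lbrakk>\<Gamma> \<turnstile> A : Univ i; \<Gamma> \<turnstile> a \<equiv> a' : A\<rbrakk> \<Longrightarrow> \<Gamma> \<turnstile> TrIn a \<equiv> TrIn a' : Trunc A"
| Trunc_path:
    "\<lbrakk>\<Gamma> \<turnstile> A : Univ i;
      \<Gamma> \<turnstile> x : Trunc A;
      \<Gamma> \<turnstile> y : Trunc A;
      \<Gamma> \<turnstile> p : Id (Trunc A) x y;
      \<Gamma> \<turnstile> q : Id (Trunc A) x y\<rbrakk>
    \<Longrightarrow> \<Gamma> \<turnstile> TrPath x y p q : Id (Id (Trunc A) x y) p q"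
| Trunc_path_cong:
    "\<lbrakk>\<Gamma> \<turnstile> A : Univ i;
      \<Gamma> \<turnstile> x \<equiv> x' : Trunc A;
      \<Gamma> \<turnstile> y \<equiv> y' : Trunc A;
      \<Gamma> \<turnstile> p \<equiv> p' : Id (Trunc A) x y;
      \<Gamma> \<turnstile> q \<equiv> q' : Id (Trunc A) x y\<rbrakk>
    \<Longrightarrow> \<Gamma> \<turnstile> TrPath x y p q \<equiv> TrPath x' y' p' q' : Id (Id (Trunc A) x y) p q"
| Trunc_elim:
    "\<lbrakk>Trunc A # \<Gamma> \<turnstile> C : Univ i;
      Trunc A # \<Gamma> \<turnstile> s : isset C;
      A # \<Gamma> \<turnstile> g : inst 1 [TrIn (Var 0)] C;
      \<Gamma> \<turnstile> t : Trunc A\<rbrakk>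
    \<Longrightarrow> \<Gamma> \<turnstile> TrInd C s g t : inst 0 [t] C"
| Trunc_elim_cong:
    "\<lbrakk>Trunc A # \<Gamma> \<turnstile> C \<equiv> C' : Univ i;
      Trunc A # \<Gamma> \<turnstile> s \<equiv> s' : isset C;
      A # \<Gamma> \<turnstile> g \<equiv> g' : inst 1 [TrIn (Var 0)] C;
      \<Gamma> \<turnstile> t \<equiv> t' : Trunc A\<rbrakk>
    \<Longrightarrow> \<Gamma> \<turnstile> TrInd C s g t \<equiv> TrInd C' s' g' t' : inst 0 [t] C"
| Trunc_comp:
    "\<lbrakk>Trunc A # \<Gamma> \<turnstile> C : Univ i;
      Trunc A # \<Gamma> \<turnstile> s : isset C;
      A # \<Gamma> \<turnstile> g : inst 1 [TrIn (Var 0)] C;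
      \<Gamma> \<turnstile> a : A\<rbrakk>
    \<Longrightarrow> \<Gamma> \<turnstile> TrInd C s g (TrIn a) \<equiv> inst 0 [a] g : inst 0 [TrIn a] C"


section \<open>Integers, the order on N, loop spaces and homotopy groups\<close>

text \<open>\<open>Inl n\<close> stands for the integer \<open>n\<close>, and \<open>Inr n\<close> for \<open>-(n + 1)\<close>.\<close>

definition IntT :: tm where
  "IntT = Sum NatT NatT"

primrec num :: "nat \<Rightarrow> tm" where
  "num 0 = ZeroN"
| "num (Suc n) = SucN (num n)"

definition addN :: "tm \<Rightarrow> tm \<Rightarrow> tm" where
  "addN m n = NatInd NatT n (SucN (Var 0)) m"

text \<open>\<open>m \<le> n\<close> is \<open>\<Sigma>(k : N). m + k = n\<close>.\<close>

definition leN :: "tm \<Rightarrow> tm \<Rightarrow> tm" where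
  "leN m n = Sig NatT (Id NatT (addN (wk 1 m) (Var 0)) (wk 1 n))"

text \<open>
  The type \<open>\<Sigma>(A : U\<^sub>i). A\<close> of pointed types in \<open>U\<^sub>i\<close>, and the two projections of a pointed type.
\<close>

definition PtType :: "nat \<Rightarrow> tm" where
  "PtType i = Sig (Univ i) (Var 0)"

definition carrier :: "nat \<Rightarrow> tm \<Rightarrow> tm" where
  "carrier i X = SigInd (Univ i) (Var 1) X"

definition point :: "nat \<Rightarrow> tm \<Rightarrow> tm" where
  "point i X = SigInd (carrier i (Var 0)) (Var 0) X"

definition Omega :: "nat \<Rightarrow> tm \<Rightarrow> tm" where
  "Omega i X = Pair (Id (carrier i X) (point i X) (point i X)) (Refl (point i X))"

text \<open>The exponent \<open>n\<close> is a term of type N: the iteration is internal to the type theory.\<close>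

definition OmegaN :: "nat \<Rightarrow> tm \<Rightarrow> tm \<Rightarrow> tm" where
  "OmegaN i n X = NatInd (PtType i) X (Omega i (Var 0)) n"

definition homotopy_group :: "nat \<Rightarrow> tm \<Rightarrow> tm \<Rightarrow> tm" where
  "homotopy_group i n X = Trunc (carrier i (OmegaN i n X))"

definition S1pt :: tm where
  "S1pt = Pair S1 Base"

definition inhabited :: "tm \<Rightarrow> bool" where
  "inhabited A \<longleftrightarrow> (\<exists>t. [] \<turnstile> t : A)"

end

theory Submission
  imports Defs
begin

text \<open>
  Everything rests on the equivalence between the loop space of the circle and the integers
  (\<open>loop_equiv\<close>), proved by the encode-decode method.  By univalence the successor, being an
  equivalence, is a path from the type of integers to itself, and recursion on the circle turns it
  into a family of types over the circle whose fibre over \<open>Base\<close> is the integers and in which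
  transport along \<open>Loop\<close> is the successor (\<open>universal_cover\<close>).  Transporting \<open>0\<close> along a loop gives its
  winding number, and \<open>z \<mapsto> loop\<^sup>z\<close> (\<open>loop_powers\<close>) is the inverse.  That a loop is recovered from its winding
  number cannot be shown for loops alone, as path induction needs a free end; so \<open>z \<mapsto> loop\<^sup>z\<close> is
  extended over the whole circle, which requires comparing functions along \<open>Loop\<close>
  (\<open>arrow_transport\<close>) and thus function extensionality, itself a consequence of
  univalence (\<open>funext\<close>).

  The integers are a set (\<open>isset_Int\<close>), so the loop space is a set.  Hence its set truncation does not
  change it (\<open>Trunc_loops_equiv\<close>), which is the first claim.  All higher loop spaces are iterated path spaces of
  a set; from the second one on they are inhabited propositions, and their truncations are trivial
  (\<open>homotopy_group_trivial\<close>).  In the internal statement of the second claim the exponent is a variable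
  of type \<open>NatT\<close>; a proof of \<open>2 \<le> n\<close> is a number \<open>k\<close> with a path \<open>2 + k = n\<close>, along which the case
  \<open>n = k + 2\<close> is transported.

  All arguments take place inside the formal theory, for arbitrary contexts and with open terms as
  parameters.  Most of them concern only the inhabitation of a type, and are conducted in a logic
  of inhabited types whose rules are the eliminators; typing is left to a set of
  syntax-directed rules, and equality up to substitution to the simplifier.
\<close>

section \<open>The calculus of substitutions\<close>

text \<open>
  The calculus of explicit substitutions of Abadi, Cardelli, Curien and Levy: a substitution is
  built from shifts, extension \<open>a \<cdot> \<sigma>\<close> and composition, and the notions \<open>rename\<close>, \<open>wk\<close>, \<open>inst\<close> and
  \<open>up\<close> are all rewritten to this form.  The equations bring substitutions to a normal form, so that
  the simplifier can check whether two types agree after substitution, even when they contain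
  arbitrary terms as parameters.  Numerals are kept in unary form, because the cancellation of a
  shift against an extension matches \<open>Suc\<close>.
\<close>

definition scons :: "tm \<Rightarrow> (nat \<Rightarrow> tm) \<Rightarrow> nat \<Rightarrow> tm" (infixr \<open>\<cdot>\<close> 65) where
  "a \<cdot> \<sigma> = case_nat a \<sigma>"

definition shift :: "nat \<Rightarrow> nat \<Rightarrow> tm" where
  "shift n = (\<lambda>i. Var (i + n))"

definition scomp :: "(nat \<Rightarrow> tm) \<Rightarrow> (nat \<Rightarrow> tm) \<Rightarrow> nat \<Rightarrow> tm" where
  "scomp \<sigma> \<tau> = (\<lambda>i. subst \<tau> (\<sigma> i))"

abbreviation sub_app :: "tm \<Rightarrow> (nat \<Rightarrow> tm) \<Rightarrow> tm" (\<open>_\<lbrakk>_\<rbrakk>\<close> [1000, 0] 1000) where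
  "t\<lbrakk>\<sigma>\<rbrakk> \<equiv> subst \<sigma> t"

abbreviation "sh0 \<equiv> shift 0"
abbreviation "sh1 \<equiv> shift (Suc 0)"
abbreviation "sh2 \<equiv> shift (Suc (Suc 0))"
abbreviation "sh3 \<equiv> shift (Suc (Suc (Suc 0)))"
abbreviation "sh4 \<equiv> shift (Suc (Suc (Suc (Suc 0))))"
abbreviation "sh5 \<equiv> shift (Suc (Suc (Suc (Suc (Suc 0)))))"
abbreviation "sh6 \<equiv> shift (Suc (Suc (Suc (Suc (Suc (Suc 0))))))"
abbreviation wk_1 (\<open>_\<up>1\<close> [1000] 1000) where "t\<up>1 \<equiv> t\<lbrakk>sh1\<rbrakk>"
abbreviation wk_2 (\<open>_\<up>2\<close> [1000] 1000) where "t\<up>2 \<equiv> t\<lbrakk>sh2\<rbrakk>"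
abbreviation wk_3 (\<open>_\<up>3\<close> [1000] 1000) where "t\<up>3 \<equiv> t\<lbrakk>sh3\<rbrakk>"
abbreviation wk_4 (\<open>_\<up>4\<close> [1000] 1000) where "t\<up>4 \<equiv> t\<lbrakk>sh4\<rbrakk>"
abbreviation wk_5 (\<open>_\<up>5\<close> [1000] 1000) where "t\<up>5 \<equiv> t\<lbrakk>sh5\<rbrakk>"
abbreviation inst1 (\<open>_\<langle>_\<rangle>\<close> [1000, 0] 1000) where "t\<langle>a\<rangle> \<equiv> t\<lbrakk>a \<cdot> sh0\<rbrakk>"
abbreviation inst2 (\<open>_\<langle>_,/ _\<rangle>\<close> [1000, 0, 0] 1000) where "t\<langle>b, a\<rangle> \<equiv> t\<lbrakk>b \<cdot> a \<cdot> sh0\<rbrakk>"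
abbreviation "x0 \<equiv> Var 0"
abbreviation "x1 \<equiv> Var (Suc 0)"
abbreviation "x2 \<equiv> Var (Suc (Suc 0))"
abbreviation "x3 \<equiv> Var (Suc (Suc (Suc 0)))"
abbreviation "x4 \<equiv> Var (Suc (Suc (Suc (Suc 0))))"
abbreviation "x5 \<equiv> Var (Suc (Suc (Suc (Suc (Suc 0)))))"

lemma up_rename_var: "up (\<lambda>i. Var (\<rho> i)) = (\<lambda>i. Var (upren \<rho> i))"
  by (rule ext) (simp add: up_def upren_def split: nat.split)

lemma rename_as_subst: "rename \<rho> t = subst (\<lambda>i. Var (\<rho> i)) t"
  by (induction t arbitrary: \<rho>) (simp_all add: up_rename_var)

lemma up_as_subst_shift: "up \<sigma> = Var 0 \<cdot> (\<lambda>i. subst (shift 1) (\<sigma> i))"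
  by (simp add: up_def scons_def rename_as_subst shift_def)

lemma up_upren: "up \<sigma> (upren \<rho> i) = up (\<lambda>i. \<sigma> (\<rho> i)) i"
  by (simp add: up_def upren_def split: nat.split)

lemma subst_rename: "subst \<sigma> (rename \<rho> t) = subst (\<lambda>i. \<sigma> (\<rho> i)) t"
  by (induction t arbitrary: \<rho> \<sigma>) (simp_all add: up_upren)

lemma rename_rename: "rename \<rho>' (rename \<rho> t) = rename (\<lambda>i. \<rho>' (\<rho> i)) t"
  unfolding rename_as_subst[of \<rho>'] subst_rename by (simp add: rename_as_subst)

lemma up_rename: "rename (upren \<rho>) (up \<sigma> i) = up (\<lambda>i. rename \<rho> (\<sigma> i)) i"
  by (simp add: up_def upren_def rename_rename split: nat.split)

lemma rename_subst: "rename \<rho> (subst \<sigma> t) = subst (\<lambda>i. rename \<rho> (\<sigma> i)) t"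
  by (induction t arbitrary: \<rho> \<sigma>) (simp_all add: up_rename)

lemma up_up: "subst (up \<tau>) (up \<sigma> i) = up (\<lambda>i. subst \<tau> (\<sigma> i)) i"
  by (simp add: up_def subst_rename rename_subst split: nat.split)

lemma subst_subst: "subst \<tau> (subst \<sigma> t) = subst (scomp \<sigma> \<tau>) t"
  unfolding scomp_def by (induction t arbitrary: \<tau> \<sigma>) (simp_all add: up_up)

lemma up_ids: "up Var = Var"
  by (rule ext) (simp add: up_def split: nat.split)

lemma subst_Var: "subst Var t = t"
  by (induction t) (simp_all add: up_ids)

lemma shift_0: "shift 0 = Var"
  by (simp add: shift_def)

lemma subst_ids: "subst (shift 0) t = t"
  by (simp add: shift_0 subst_Var)

lemma up_sig: "up \<sigma> = Var 0 \<cdot> scomp \<sigma> (shift (Suc 0))"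
  by (simp add: up_as_subst_shift scomp_def)

lemma wk_sig: "wk n t = subst (shift n) t"
  by (simp add: wk_def shift_def rename_as_subst)

lemma wk1_sig: "wk1 n t = subst (Var 0 \<cdot> shift (Suc n)) t"
proof -
  have "(\<lambda>i. Var (upren (\<lambda>i. i + n) i)) = Var 0 \<cdot> shift (Suc n)"
    by (rule ext) (simp add: upren_def scons_def shift_def split: nat.split)
  then show ?thesis by (simp add: wk1_def rename_as_subst)
qed

fun slist :: "nat \<Rightarrow> tm list \<Rightarrow> nat \<Rightarrow> tm" where
  "slist k [] = shift k"
| "slist k (a # as) = a \<cdot> slist k as"

lemma slist_nth: "slist k as i = (if i < length as then as ! i else Var (i - length as + k))"
  by (induction as arbitrary: i) (auto simp: shift_def scons_def split: nat.split)

lemma inst_sig: "inst k as t = subst (slist k as) t"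
  by (simp add: inst_def slist_nth[abs_def])

lemma scons_0: "(a \<cdot> \<sigma>) 0 = a" and scons_Suc: "(a \<cdot> \<sigma>) (Suc n) = \<sigma> n"
  by (simp_all add: scons_def)

lemma shift_app: "shift (Suc m) n = shift m (Suc n)" "shift 0 n = Var n"
  by (simp_all add: shift_def)

lemma scomp_app: "scomp \<sigma> \<tau> n = subst \<tau> (\<sigma> n)"
  by (simp add: scomp_def)

lemma scomp_scons: "scomp (a \<cdot> \<sigma>) \<tau> = subst \<tau> a \<cdot> scomp \<sigma> \<tau>"
  by (rule ext) (simp add: scomp_def scons_def split: nat.split)

lemma scomp_shift_scons: "scomp (shift (Suc n)) (a \<cdot> \<sigma>) = scomp (shift n) \<sigma>"
  by (rule ext) (simp add: scomp_def scons_def shift_def)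

lemma scomp_id_left: "scomp (shift 0) \<sigma> = \<sigma>"
  by (simp add: scomp_def shift_def)

lemma scomp_id_right: "scomp \<sigma> (shift 0) = \<sigma>"
  by (simp add: scomp_def subst_ids)

lemma scomp_assoc: "scomp (scomp \<rho> \<sigma>) \<tau> = scomp \<rho> (scomp \<sigma> \<tau>)"
  by (simp add: scomp_def subst_subst)

lemma scomp_shift_shift: "scomp (shift m) (shift n) = shift (m + n)"
  by (simp add: scomp_def shift_def ac_simps)

lemma scomp_shift_assoc: "scomp (shift m) (scomp (shift n) \<sigma>) = scomp (shift (m + n)) \<sigma>"
  by (simp add: scomp_assoc[symmetric] scomp_shift_shift)

lemma scons_eta: "Var n \<cdot> shift (Suc n) = shift n"
  by (rule ext) (simp add: scons_def shift_def split: nat.split)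

lemma scons_eta_comp: "\<sigma> 0 \<cdot> scomp (shift (Suc 0)) \<sigma> = \<sigma>"
  by (rule ext) (simp add: scons_def scomp_def shift_def split: nat.split)

lemmas sigma [simp] = subst_subst subst_ids up_sig wk_sig wk1_sig inst_sig
  scons_0 scons_Suc shift_app scomp_app scomp_scons scomp_shift_scons scomp_id_left scomp_id_right
  scomp_assoc scomp_shift_shift scomp_shift_assoc scons_eta scons_eta_comp numeral_2_eq_2 numeral_3_eq_3

lemma numeral_4_Suc [simp]: "(4::nat) = Suc (Suc (Suc (Suc 0)))" by simp

text \<open>
  In this form \<open>transport\<close> is typed by the rules for application and path elimination.
\<close>

lemma transport_sig: "transport C a b p u =
     App (IdInd (Pi (C\<lbrakk>x2 \<cdot> sh3\<rbrakk>) (C\<lbrakk>x2 \<cdot> sh4\<rbrakk>)) (Lam C (Var 0)) a b p) u"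
  by (simp add: transport_def arrow_def)
lemma subst_transport [simp]:
  "subst \<sigma> (transport C a b p u) =
     transport (subst (up \<sigma>) C) (subst \<sigma> a) (subst \<sigma> b) (subst \<sigma> p) (subst \<sigma> u)"
  by (simp add: transport_def arrow_def)
declare arrow_def [simp] times_def [simp]
lemma subst_isequiv [simp]: "subst \<sigma> (isequiv A B f) = isequiv (subst \<sigma> A) (subst \<sigma> B) (subst \<sigma> f)"
  by (simp add: isequiv_def)
lemma subst_equiv [simp]: "subst \<sigma> (equiv A B) = equiv (subst \<sigma> A) (subst \<sigma> B)"
  by (simp add: equiv_def)
lemma subst_isset [simp]: "subst \<sigma> (isset A) = isset (subst \<sigma> A)"
  by (simp add: isset_def)

section \<open>Judgments relative to a well-formed context\<close>

text \<open>
  The judgments are stated under the hypothesis that the context is well formed.  The derived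
  rules then have no premises about contexts: whenever a rule extends the context by a type, the
  formation premise for that type supplies the well-formedness of the extension.  Universe levels
  are hidden in \<open>A type\<close>, and two levels are reconciled by cumulativity.

  \<open>G |= A\<close> forgets the inhabiting term.  Arguments about paths mostly need no more than this;
  terms are named only where later types mention them.
\<close>

definition is_type :: "tm list \<Rightarrow> tm \<Rightarrow> bool" (\<open>_ |- _ type\<close> [51, 51] 50) where
  "G |- A type \<longleftrightarrow> (\<turnstile> G ctx \<longrightarrow> (\<exists>i. G \<turnstile> A : Univ i))"

definition has_type :: "tm list \<Rightarrow> tm \<Rightarrow> tm \<Rightarrow> bool" (\<open>_ |- _ : _\<close> [51, 51, 51] 50) where
  "G |- t : A \<longleftrightarrow> (\<turnstile> G ctx \<longrightarrow> G \<turnstile> t : A)"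

definition eq_term :: "tm list \<Rightarrow> tm \<Rightarrow> tm \<Rightarrow> tm \<Rightarrow> bool" (\<open>_ |- _ \<doteq> _ : _\<close> [51, 51, 51, 51] 50) where
  "G |- a \<doteq> b : A \<longleftrightarrow> (\<turnstile> G ctx \<longrightarrow> G \<turnstile> a \<equiv> b : A)"

definition eq_type :: "tm list \<Rightarrow> tm \<Rightarrow> tm \<Rightarrow> bool" (\<open>_ |- _ \<doteq> _ type\<close> [51, 51, 51] 50) where
  "G |- A \<doteq> B type \<longleftrightarrow> (\<turnstile> G ctx \<longrightarrow> (\<exists>i. G \<turnstile> A \<equiv> B : Univ i))"

definition inh :: "tm list \<Rightarrow> tm \<Rightarrow> bool" (infix \<open>|=\<close> 50) where
  "G |= A \<longleftrightarrow> (\<turnstile> G ctx \<longrightarrow> (\<exists>t. G \<turnstile> t : A))"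

definition is_subst :: "tm list \<Rightarrow> (nat \<Rightarrow> tm) \<Rightarrow> tm list \<Rightarrow> bool" (\<open>_ |- _ \<Rightarrow>\<^sub>s _\<close> [51, 51, 51] 50) where
  "\<Delta> |- \<sigma> \<Rightarrow>\<^sub>s G \<longleftrightarrow> (\<turnstile> \<Delta> ctx \<longrightarrow>
     \<turnstile> G ctx \<and> (\<forall>i<length G. \<Delta> \<turnstile> \<sigma> i : subst \<sigma> (wk (Suc i) (G ! i))))"

lemmas guarded_defs = is_type_def has_type_def eq_term_def eq_type_def inh_def

lemma univ_mono: "G \<turnstile> A : Univ i \<Longrightarrow> G \<turnstile> A : Univ (i + k)"
  by (induction k) (auto intro: cumul)

lemma univ_common:
  "G \<turnstile> A : Univ i \<Longrightarrow> \<Delta> \<turnstile> B : Univ j \<Longrightarrow> \<exists>k. G \<turnstile> A : Univ k \<and> \<Delta> \<turnstile> B : Univ k"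
  using univ_mono[of G A i j] univ_mono[of \<Delta> B j i] by (auto simp: add.commute)

lemma ctx_tail: "\<turnstile> A # G ctx \<Longrightarrow> \<exists>i. G \<turnstile> A : Univ i"
  by (erule ctxt.cases) auto

lemma typing_ctx:
  "\<turnstile> G ctx \<Longrightarrow> True"
  "G \<turnstile> t : A \<Longrightarrow> \<turnstile> G ctx"
  "G \<turnstile> t \<equiv> s : A \<Longrightarrow> \<turnstile> G ctx"
  by (induction rule: ctxt_typing_jeq.inducts) auto

lemma ctx_tl: "\<turnstile> A # G ctx \<Longrightarrow> \<turnstile> G ctx"
  using ctx_tail typing_ctx by blast

lemma ctx_drop: "\<turnstile> G ctx \<Longrightarrow> \<turnstile> drop n G ctx"
proof (induction n arbitrary: G)
  case (Suc n)
  then show ?case by (cases G) (auto dest: ctx_tl)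
qed simp

lemma ctx_Cons: "\<turnstile> A # G ctx \<longleftrightarrow> \<turnstile> G ctx \<and> (\<exists>i. G \<turnstile> A : Univ i)"
  using ctx_tail ctx_tl ctx_extend by blast

text \<open>
  The rules collected here are syntax directed, so that \<open>(rule ty | simp)+\<close> is a type checker.
  Inference has to proceed without backtracking: a premise that determines the type of a subterm
  precedes the premises that use this type, and the type in the conclusion is a variable \<open>T\<close> with an
  equation that the simplifier normalizes.  Inside a proof a hypothesis about a term or type is
  added twice, as it stands and closed under substitution.

  For a constant \<open>X\<close>, the rules \<open>X_type\<close> and \<open>X_univ\<close> form types, \<open>X_typing\<close> types terms, and \<open>X_eq\<close> computes.
\<close>

named_theorems ty

lemma sub_shift [ty]: "drop n \<Delta> = G \<Longrightarrow> n \<le> length \<Delta> \<Longrightarrow> \<Delta> |- shift n \<Rightarrow>\<^sub>s G"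
  unfolding is_subst_def
proof (intro impI conjI allI)
  assume a: "drop n \<Delta> = G" "n \<le> length \<Delta>" "\<turnstile> \<Delta> ctx"
  then show "\<turnstile> G ctx" using ctx_drop by auto
  fix i assume i: "i < length G"
  with a have "n + i < length \<Delta>" by auto
  from var[OF a(3) this] show "\<Delta> \<turnstile> shift n i : (wk (Suc i) (G ! i))\<lbrakk>shift n\<rbrakk>"
    using a i by (auto simp: shift_def[of n] scomp_shift_shift[of _ n, unfolded shift_def[of n]] add.commute)
qed

lemma sub_scons [ty]:
  assumes "\<Delta> |- \<sigma> \<Rightarrow>\<^sub>s G" "G |- A type" "\<Delta> |- a : A\<lbrakk>\<sigma>\<rbrakk>"
  shows "\<Delta> |- a \<cdot> \<sigma> \<Rightarrow>\<^sub>s A # G"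
  unfolding is_subst_def
proof (intro impI conjI allI)
  assume c: "\<turnstile> \<Delta> ctx"
  then have g: "\<turnstile> G ctx" using assms(1) by (auto simp: is_subst_def)
  then show "\<turnstile> A # G ctx" using assms(2) by (auto simp: is_type_def ctx_Cons)
  fix i assume i: "i < length (A # G)"
  show "\<Delta> \<turnstile> (a \<cdot> \<sigma>) i : (wk (Suc i) ((A # G) ! i))\<lbrakk>a \<cdot> \<sigma>\<rbrakk>"
  proof (cases i)
    case 0
    then show ?thesis using assms(3) c by (auto simp: has_type_def)
  next
    case (Suc j)
    then show ?thesis using assms(1) c i by (auto simp: is_subst_def)
  qed
qed

lemma subst_has_type: "G |- t : A \<Longrightarrow> \<Delta> |- \<sigma> \<Rightarrow>\<^sub>s G \<Longrightarrow> T = A\<lbrakk>\<sigma>\<rbrakk> \<Longrightarrow> \<Delta> |- t\<lbrakk>\<sigma>\<rbrakk> : T"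
  by (auto simp: has_type_def is_subst_def intro: subst_typing)

lemma subst_is_type: "G |- A type \<Longrightarrow> \<Delta> |- \<sigma> \<Rightarrow>\<^sub>s G \<Longrightarrow> \<Delta> |- A\<lbrakk>\<sigma>\<rbrakk> type"
  unfolding is_type_def is_subst_def by (metis subst_typing subst.simps(2))

lemma subst_eq_term: "G |- s \<doteq> t : A \<Longrightarrow> \<Delta> |- \<sigma> \<Rightarrow>\<^sub>s G \<Longrightarrow> T = A\<lbrakk>\<sigma>\<rbrakk> \<Longrightarrow> \<Delta> |- s\<lbrakk>\<sigma>\<rbrakk> \<doteq> t\<lbrakk>\<sigma>\<rbrakk> : T"
  by (auto simp: eq_term_def is_subst_def intro: subst_eq)

lemma subst_eq_type: "G |- A \<doteq> B type \<Longrightarrow> \<Delta> |- \<sigma> \<Rightarrow>\<^sub>s G \<Longrightarrow> \<Delta> |- A\<lbrakk>\<sigma>\<rbrakk> \<doteq> B\<lbrakk>\<sigma>\<rbrakk> type"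
  unfolding eq_type_def is_subst_def by (metis subst_eq subst.simps(2))

lemma subst_inh: "G |= A \<Longrightarrow> \<Delta> |- \<sigma> \<Rightarrow>\<^sub>s G \<Longrightarrow> \<Delta> |= A\<lbrakk>\<sigma>\<rbrakk>"
  unfolding inh_def is_subst_def by (metis subst_typing)

lemma is_type_ctx: "\<turnstile> G ctx \<Longrightarrow> G |- A type \<Longrightarrow> \<turnstile> A # G ctx"
  by (auto simp: ctx_Cons is_type_def)

section \<open>Formation and typing rules\<close>

lemma El: "G |- A : Univ i \<Longrightarrow> G |- A type"
  by (auto simp: has_type_def is_type_def)

text \<open>
  The rule \<open>El\<close> itself would also apply to canonical types and make the type checker loop; it is
  used only for terms whose head is not a type former.
\<close>

lemmas El_App [ty] = El[of _ "App f a" for f a]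
lemmas El_Var [ty] = El[of _ "Var n" for n]

lemma Univ_type [ty]: "G |- Univ i type"
  by (auto simp: is_type_def intro: univ)
lemma Pi_type [ty]: "G |- A type \<Longrightarrow> A # G |- B type \<Longrightarrow> G |- Pi A B type"
  unfolding is_type_def using univ_common Pi_form ctx_Cons by meson
lemma Sig_type [ty]: "G |- A type \<Longrightarrow> A # G |- B type \<Longrightarrow> G |- Sig A B type"
  unfolding is_type_def using univ_common Sig_form ctx_Cons by meson
lemma Sum_type [ty]: "G |- A type \<Longrightarrow> G |- B type \<Longrightarrow> G |- Sum A B type"
  unfolding is_type_def using univ_common Sum_form by meson
lemma Id_type [ty]: "G |- A type \<Longrightarrow> G |- a : A \<Longrightarrow> G |- b : A \<Longrightarrow> G |- Id A a b type"
  unfolding is_type_def has_type_def by (meson Id_form)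
lemma Trunc_type [ty]: "G |- A type \<Longrightarrow> G |- Trunc A type"
  unfolding is_type_def by (meson Trunc_form)
lemma base_types [ty]: "G |- Empty type" "G |- Unit type" "G |- NatT type" "G |- S1 type"
  unfolding is_type_def by (auto intro: Empty_form Unit_form Nat_form S1_form)

lemma base_univ [ty]: "G |- Empty : Univ i" "G |- Unit : Univ i" "G |- NatT : Univ i" "G |- S1 : Univ i"
  "G |- Univ i : Univ (Suc i)"
  unfolding has_type_def by (auto intro: Empty_form Unit_form Nat_form S1_form univ)
lemma Sum_univ [ty]: "G |- A : Univ i \<Longrightarrow> G |- B : Univ i \<Longrightarrow> G |- Sum A B : Univ i"
  unfolding has_type_def by (meson Sum_form)
lemma Id_univ [ty]: "G |- A : Univ i \<Longrightarrow> G |- a : A \<Longrightarrow> G |- b : A \<Longrightarrow> G |- Id A a b : Univ i"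
  unfolding has_type_def by (meson Id_form)
lemma Sig_univ [ty]: "G |- A : Univ i \<Longrightarrow> A # G |- B : Univ i \<Longrightarrow> G |- Sig A B : Univ i"
  unfolding has_type_def by (meson Sig_form ctx_extend)

lemma Var_typing [ty]: "i < length G \<Longrightarrow> T = (G ! i)\<lbrakk>shift (Suc i)\<rbrakk> \<Longrightarrow> G |- Var i : T"
  unfolding has_type_def using var by auto
lemma Lam_typing [ty]: "G |- A type \<Longrightarrow> A # G |- b : B \<Longrightarrow> G |- Lam A b : Pi A B"
  unfolding is_type_def has_type_def by (meson Pi_intro ctx_extend)
lemma App_typing [ty]: "G |- f : Pi A B \<Longrightarrow> G |- a : A \<Longrightarrow> T = B\<langle>a\<rangle> \<Longrightarrow> G |- App f a : T"
  unfolding has_type_def using Pi_elim by fastforce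
lemma Pair_typing [ty]: "A # G |- B type \<Longrightarrow> G |- A type \<Longrightarrow> G |- a : A \<Longrightarrow> G |- b : B\<langle>a\<rangle> \<Longrightarrow> G |- Pair a b : Sig A B"
  unfolding has_type_def is_type_def using Sig_intro[of A G B _ a b] ctx_extend by fastforce
lemma Inl_typing [ty]: "G |- A type \<Longrightarrow> G |- B type \<Longrightarrow> G |- a : A \<Longrightarrow> G |- Inl a : Sum A B"
  unfolding has_type_def is_type_def by (meson univ_common Sum_intro_l)
lemma Inr_typing [ty]: "G |- A type \<Longrightarrow> G |- B type \<Longrightarrow> G |- a : B \<Longrightarrow> G |- Inr a : Sum A B"
  unfolding has_type_def is_type_def by (meson univ_common Sum_intro_r)
lemma Refl_typing [ty]: "G |- a : A \<Longrightarrow> G |- A type \<Longrightarrow> G |- Refl a : Id A a a"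
  unfolding has_type_def is_type_def by (meson Id_intro)
lemma const_typing [ty]: "G |- Star : Unit" "G |- ZeroN : NatT" "G |- Base : S1" "G |- Loop : Id S1 Base Base"
  unfolding has_type_def by (auto intro: Unit_intro Nat_intro_zero S1_intro_base S1_intro_loop)
lemma SucN_typing [ty]: "G |- n : NatT \<Longrightarrow> G |- SucN n : NatT"
  unfolding has_type_def by (auto intro: Nat_intro_suc)
lemma TrIn_typing [ty]: "G |- a : A \<Longrightarrow> G |- A type \<Longrightarrow> G |- TrIn a : Trunc A"
  unfolding has_type_def is_type_def by (meson Trunc_intro)

lemma SigInd_typing [ty]:
  "G |- p : Sig A B \<Longrightarrow> G |- A type \<Longrightarrow> A # G |- B type \<Longrightarrow> Sig A B # G |- C type \<Longrightarrow>
   B # A # G |- g : C\<lbrakk>Pair x1 x0 \<cdot> sh2\<rbrakk> \<Longrightarrow> T = C\<langle>p\<rangle> \<Longrightarrow>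
   G |- SigInd C g p : T"
  unfolding has_type_def using Sig_elim[of A B G C _ g p] Sig_type[of G A B]
  by (auto simp: is_type_def ctx_Cons)
lemma SumInd_typing [ty]:
  "G |- p : Sum A B \<Longrightarrow> G |- A type \<Longrightarrow> G |- B type \<Longrightarrow> Sum A B # G |- C type \<Longrightarrow>
   A # G |- c : C\<lbrakk>Inl x0 \<cdot> sh1\<rbrakk> \<Longrightarrow> B # G |- d : C\<lbrakk>Inr x0 \<cdot> sh1\<rbrakk> \<Longrightarrow> T = C\<langle>p\<rangle> \<Longrightarrow>
   G |- SumInd C c d p : T"
  unfolding has_type_def using Sum_elim[of A B G C _ c d p] Sum_type[of G A B]
  by (auto simp: is_type_def ctx_Cons)
lemma EmptyInd_typing [ty]:
  "G |- e : Empty \<Longrightarrow> Empty # G |- C type \<Longrightarrow> T = C\<langle>e\<rangle> \<Longrightarrow> G |- EmptyInd C e : T"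
  unfolding has_type_def using Empty_elim[of G C _ e] base_types(1)[of G] by (auto simp: is_type_def ctx_Cons)
lemma UnitInd_typing [ty]:
  "G |- e : Unit \<Longrightarrow> Unit # G |- C type \<Longrightarrow> G |- c : C\<langle>Star\<rangle> \<Longrightarrow> T = C\<langle>e\<rangle> \<Longrightarrow> G |- UnitInd C c e : T"
  unfolding has_type_def using Unit_elim[of G C _ c e] base_types(2)[of G] by (auto simp: is_type_def ctx_Cons)
lemma NatInd_typing [ty]:
  "G |- n : NatT \<Longrightarrow> NatT # G |- C type \<Longrightarrow> G |- z : C\<langle>ZeroN\<rangle> \<Longrightarrow>
   C # NatT # G |- s : C\<lbrakk>SucN x1 \<cdot> sh2\<rbrakk> \<Longrightarrow> T = C\<langle>n\<rangle> \<Longrightarrow> G |- NatInd C z s n : T"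
  unfolding has_type_def using Nat_elim[of G C _ z s n] base_types(3)[of G] by (auto simp: is_type_def ctx_Cons)
lemma path_induction_ctx:
  assumes "\<turnstile> G ctx" "G |- A type" shows "\<turnstile> Id A\<up>2 x1 x0 # A\<up>1 # A # G ctx"
proof -
  have 1: "\<turnstile> A # G ctx" by (rule is_type_ctx[OF assms])
  have 2: "A # G |- A\<up>1 type" by (rule subst_is_type[OF assms(2)] ty | simp)+
  have 3: "\<turnstile> A\<up>1 # A # G ctx" by (rule is_type_ctx[OF 1 2])
  have 4: "A\<up>1 # A # G |- Id A\<up>2 x1 x0 type" by (rule subst_is_type[OF assms(2)] ty | simp)+
  show ?thesis by (rule is_type_ctx[OF 3 4])
qed

lemma IdInd_typing [ty]:
  assumes "G |- p : Id A a b" "G |- A type" "G |- a : A" "G |- b : A"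
   "Id A\<up>2 x1 x0 # A\<up>1 # A # G |- C type"
   "A # G |- c : C\<lbrakk>Refl x0 \<cdot> x0 \<cdot> x0 \<cdot> sh1\<rbrakk>" "T = C\<lbrakk>p \<cdot> b \<cdot> a \<cdot> sh0\<rbrakk>"
  shows "G |- IdInd C c a b p : T"
  unfolding has_type_def
proof
  assume g: "\<turnstile> G ctx"
  show "G \<turnstile> IdInd C c a b p : T"
    using Id_elim[of A G C _ c a b p] assms g path_induction_ctx[OF g assms(2)]
    by (auto simp: has_type_def is_type_def ctx_Cons)
qed

lemma inh_iff: "G |= A \<longleftrightarrow> (\<exists>t. G |- t : A)"
  by (auto simp: inh_def has_type_def)
lemma inhI: "G |- t : A \<Longrightarrow> G |= A"
  by (auto simp: inh_iff)
lemma inhE: "G |= A \<Longrightarrow> (\<And>t. G |- t : A \<Longrightarrow> P) \<Longrightarrow> P"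
  by (auto simp: inh_iff)
lemma typing_eqI: "G |- t : A \<Longrightarrow> T = A \<Longrightarrow> G |- t : T"
  by simp

lemma transport_typing [ty]:
  assumes "G |- p : Id A a b" "G |- A type" "G |- a : A" "G |- b : A"
    "A # G |- C type" "G |- u : C\<langle>a\<rangle>" "T = C\<langle>b\<rangle>"
  shows "G |- transport C a b p u : T"
proof -
  note [ty] = assms(2,5) assms(2,5)[THEN subst_is_type] assms(1,3,4)
  show ?thesis
    unfolding transport_sig
    apply (rule App_typing)
      apply (rule IdInd_typing)
            apply (rule ty | simp)+
     apply (simp add: assms(6,7))+
    done
qed

section \<open>Judgmental equality\<close>

lemma eq_term_sym: "G |- a \<doteq> b : A \<Longrightarrow> G |- b \<doteq> a : A"
  by (auto simp: guarded_defs intro: eq_sym)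
lemma eq_term_trans [trans]: "G |- a \<doteq> b : A \<Longrightarrow> G |- b \<doteq> c : A \<Longrightarrow> G |- a \<doteq> c : A"
  by (auto simp: guarded_defs intro: eq_trans)
lemma eq_type_refl: "G |- A type \<Longrightarrow> G |- A \<doteq> A type"
  by (auto simp: guarded_defs intro: eq_refl)
lemma eq_type_sym: "G |- A \<doteq> B type \<Longrightarrow> G |- B \<doteq> A type"
  by (auto simp: guarded_defs intro: eq_sym)
lemma eq_type_El: "G |- A \<doteq> B : Univ i \<Longrightarrow> G |- A \<doteq> B type"
  by (auto simp: guarded_defs)
lemma conv_typing: "G |- a : A \<Longrightarrow> G |- A \<doteq> B type \<Longrightarrow> G |- a : B"
  by (auto simp: guarded_defs intro: conv)
lemma eq_term_conv: "G |- a \<doteq> b : A \<Longrightarrow> G |- A \<doteq> B type \<Longrightarrow> G |- a \<doteq> b : B"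
  by (auto simp: guarded_defs intro: conv_eq)
lemma inh_conv: "G |= A \<Longrightarrow> G |- A \<doteq> B type \<Longrightarrow> G |= B"
  by (auto simp: inh_iff intro: conv_typing)

lemma beta:
  "G |- A type \<Longrightarrow> A # G |- b : B \<Longrightarrow> G |- a : A \<Longrightarrow> r = b\<langle>a\<rangle> \<Longrightarrow> T = B\<langle>a\<rangle> \<Longrightarrow>
   G |- App (Lam A b) a \<doteq> r : T"
  unfolding has_type_def eq_term_def using Pi_comp[of A G b B a] is_type_ctx by auto

text \<open>
  Substituting equal terms into an open term is not among the congruence rules: there
  congruence is available only for each term former.  Both sides are \<open>\<beta>\<close>-equal to
  applications of one abstraction, where the congruence rule for application suffices.
\<close>

lemma eq_subst_term:
  assumes "G |- A type" "A # G |- t : B" "G |- a : A" "G |- a' : A" "G |- a \<doteq> a' : A"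
    "A # G |- B \<doteq> B'\<up>1 type"
  shows "G |- t\<langle>a\<rangle> \<doteq> t\<langle>a'\<rangle> : B'"
proof -
  have t: "A # G |- t : B'\<up>1" by (rule conv_typing[OF assms(2,6)])
  have l: "G |- Lam A t : Pi A B'\<up>1" by (rule ty assms t)+
  have "G |- App (Lam A t) a \<doteq> App (Lam A t) a' : B'"
    using l assms(5) Pi_elim_cong[OF eq_refl, of G "Lam A t" A "B'\<up>1" a a'] by (simp add: guarded_defs)
  moreover have "G |- App (Lam A t) a \<doteq> t\<langle>a\<rangle> : B'" "G |- App (Lam A t) a' \<doteq> t\<langle>a'\<rangle> : B'"
    by (rule beta assms t refl | simp)+
  ultimately show ?thesis using eq_term_trans eq_term_sym by meson
qed

lemma eq_subst_type:
  assumes "G |- A type" "A # G |- B type" "G |- a : A" "G |- a' : A" "G |- a \<doteq> a' : A"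
  shows "G |- B\<langle>a\<rangle> \<doteq> B\<langle>a'\<rangle> type"
proof (cases "\<turnstile> G ctx")
  case True
  then obtain i where "A # G |- B : Univ i"
    using assms(1,2) is_type_ctx by (auto simp: guarded_defs)
  then have "G |- B\<langle>a\<rangle> \<doteq> B\<langle>a'\<rangle> : Univ i"
    by (rule eq_subst_term[OF assms(1) _ assms(3-5)]) (rule eq_type_refl ty | simp)+
  then show ?thesis by (rule eq_type_El)
qed (simp add: guarded_defs)

lemma inst_conv_typing:
  assumes "G |- a \<doteq> a' : A" "G |- t : B\<langle>a\<rangle>" "G |- A type" "A # G |- B type" "G |- a : A" "G |- a' : A" "T = B\<langle>a'\<rangle>"
  shows "G |- t : T"
  using conv_typing[OF assms(2) eq_subst_type[OF assms(3-6,1)]] assms(7) by simp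

lemma eq_inh_Id: 
  assumes "G |- a \<doteq> b : A" "G |- A type" "G |- a : A" 
  shows "G |= Id A a b"
proof (rule inhI)
  show "G |- Refl a : Id A a b"
  using assms unfolding guarded_defs
    by (meson Id_form_cong Id_intro conv eq_refl)
qed

lemma SigInd_Pair_eq:
  "G |- A type \<Longrightarrow> A # G |- B type \<Longrightarrow> Sig A B # G |- C type \<Longrightarrow> 
   B # A # G |- g : C\<lbrakk>Pair x1 x0 \<cdot> sh2\<rbrakk> \<Longrightarrow> G |- a : A \<Longrightarrow> G |- b : B\<langle>a\<rangle> \<Longrightarrow> r = g\<langle>b, a\<rangle> \<Longrightarrow> T = C\<langle>Pair a b\<rangle> \<Longrightarrow>
   G |- SigInd C g (Pair a b) \<doteq> r : T"
  unfolding has_type_def eq_term_def using Sig_comp[of A B G C _ g a b] Sig_type[of G A B]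
  by (auto simp: is_type_def ctx_Cons)
lemma SumInd_Inl_eq:
  "G |- A type \<Longrightarrow> G |- B type \<Longrightarrow> Sum A B # G |- C type \<Longrightarrow>
   A # G |- c : C\<lbrakk>Inl x0 \<cdot> sh1\<rbrakk> \<Longrightarrow> B # G |- d : C\<lbrakk>Inr x0 \<cdot> sh1\<rbrakk> \<Longrightarrow> G |- a : A \<Longrightarrow> r = c\<langle>a\<rangle> \<Longrightarrow> T = C\<langle>Inl a\<rangle> \<Longrightarrow>
   G |- SumInd C c d (Inl a) \<doteq> r : T"
  unfolding has_type_def eq_term_def using Sum_comp_l[of A B G C _ c d a] Sum_type[of G A B]
  by (auto simp: is_type_def ctx_Cons)
lemma SumInd_Inr_eq:
  "G |- A type \<Longrightarrow> G |- B type \<Longrightarrow> Sum A B # G |- C type \<Longrightarrow>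
   A # G |- c : C\<lbrakk>Inl x0 \<cdot> sh1\<rbrakk> \<Longrightarrow> B # G |- d : C\<lbrakk>Inr x0 \<cdot> sh1\<rbrakk> \<Longrightarrow> G |- a : B \<Longrightarrow> r = d\<langle>a\<rangle> \<Longrightarrow> T = C\<langle>Inr a\<rangle> \<Longrightarrow>
   G |- SumInd C c d (Inr a) \<doteq> r : T"
  unfolding has_type_def eq_term_def using Sum_comp_r[of A B G C _ c d a] Sum_type[of G A B]
  by (auto simp: is_type_def ctx_Cons)
lemma NatInd_zero_eq:
  "NatT # G |- C type \<Longrightarrow> G |- z : C\<langle>ZeroN\<rangle> \<Longrightarrow>
   C # NatT # G |- s : C\<lbrakk>SucN x1 \<cdot> sh2\<rbrakk> \<Longrightarrow> T = C\<langle>ZeroN\<rangle> \<Longrightarrow> G |- NatInd C z s ZeroN \<doteq> z : T"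
  unfolding has_type_def eq_term_def using Nat_comp_zero[of G C _ z s] base_types(3)[of G] by (auto simp: is_type_def ctx_Cons)
lemma NatInd_suc_eq:
  "NatT # G |- C type \<Longrightarrow> G |- z : C\<langle>ZeroN\<rangle> \<Longrightarrow>
   C # NatT # G |- s : C\<lbrakk>SucN x1 \<cdot> sh2\<rbrakk> \<Longrightarrow> G |- n : NatT \<Longrightarrow> r = s\<langle>NatInd C z s n, n\<rangle> \<Longrightarrow> T = C\<langle>SucN n\<rangle> \<Longrightarrow> 
   G |- NatInd C z s (SucN n) \<doteq> r : T"
  unfolding has_type_def eq_term_def using Nat_comp_suc[of G C _ z s n] base_types(3)[of G] by (auto simp: is_type_def ctx_Cons)
lemma IdInd_Refl_eq:
  assumes "G |- A type" "G |- a : A"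
   "Id A\<up>2 x1 x0 # A\<up>1 # A # G |- C type"
   "A # G |- c : C\<lbrakk>Refl x0 \<cdot> x0 \<cdot> x0 \<cdot> sh1\<rbrakk>" "r = c\<langle>a\<rangle>" "T = C\<lbrakk>Refl a \<cdot> a \<cdot> a \<cdot> sh0\<rbrakk>"
  shows "G |- IdInd C c a a (Refl a) \<doteq> r : T"
  using assms path_induction_ctx[of G A] Id_comp[of A G C _ c a] by (auto simp: guarded_defs ctx_Cons)

lemma transport_Refl_eq:
  assumes "G |- A type" "G |- a : A" "A # G |- C type" "G |- u : C\<langle>a\<rangle>" "T = C\<langle>a\<rangle>"
  shows "G |- transport C a a (Refl a) u \<doteq> u : T"
proof -
  note [ty] = assms(1,3) assms(1,3)[THEN subst_is_type] assms(2)
  let ?F = "IdInd (Pi (C\<lbrakk>x2 \<cdot> sh3\<rbrakk>) (C\<lbrakk>x2 \<cdot> sh4\<rbrakk>)) (Lam C (Var 0)) a a (Refl a)"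
  have "G |- ?F \<doteq> Lam C\<langle>a\<rangle> x0 : Pi C\<langle>a\<rangle> C\<lbrakk>a\<up>1 \<cdot> sh1\<rbrakk>"
    by (rule IdInd_Refl_eq[where A=A]) (rule ty | simp)+
  then have "G |- App ?F u \<doteq> App (Lam C\<langle>a\<rangle> x0) u : C\<langle>a\<rangle>"
    using assms(4) Pi_elim_cong[OF _ eq_refl, of G ?F "Lam C\<langle>a\<rangle> x0" "C\<langle>a\<rangle>" "C\<lbrakk>a\<up>1 \<cdot> sh1\<rbrakk>" u] by (simp add: guarded_defs)
  moreover have "G |- App (Lam C\<langle>a\<rangle> x0) u \<doteq> u : C\<langle>a\<rangle>"
    by (rule beta[where B="C\<lbrakk>a\<up>1 \<cdot> sh1\<rbrakk>"]) (rule ty assms | simp)+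
  ultimately show ?thesis unfolding transport_sig assms(5) by (rule eq_term_trans)
qed

lemma App_cong_left: "G |- f \<doteq> f' : Pi A B \<Longrightarrow> G |- a : A \<Longrightarrow> T = B\<langle>a\<rangle> \<Longrightarrow> G |- App f a \<doteq> App f' a : T"
  using Pi_elim_cong[OF _ eq_refl, of G f f' A B a] by (simp add: guarded_defs)

section \<open>Path induction and chains of paths\<close>

lemma beta2:
  assumes [ty]: "G |- A type" "A # G |- B type" and t: "B # A # G |- t : C" and a: "G |- a : A" "G |- b : B\<langle>a\<rangle>"
    "r = t\<langle>b, a\<rangle>" "T = C\<langle>b, a\<rangle>"
  shows "G |- App (App (Lam A (Lam B t)) a) b \<doteq> r : T"
proof -
  note [ty] = assms(1,2)[THEN subst_is_type] t t[THEN subst_has_type] a(1,2) a(1,2)[THEN subst_has_type]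
  have "G |- App (Lam A (Lam B t)) a \<doteq> Lam B\<langle>a\<rangle> t\<lbrakk>x0 \<cdot> a\<up>1 \<cdot> sh1\<rbrakk> : Pi B\<langle>a\<rangle> C\<lbrakk>x0 \<cdot> a\<up>1 \<cdot> sh1\<rbrakk>"
    by (rule beta[where B="Pi B C"]) (rule ty | simp)+
  then have "G |- App (App (Lam A (Lam B t)) a) b \<doteq> App (Lam B\<langle>a\<rangle> t\<lbrakk>x0 \<cdot> a\<up>1 \<cdot> sh1\<rbrakk>) b : T"
    by (rule App_cong_left) (rule a | simp add: assms)+
  also have "G |- App (Lam B\<langle>a\<rangle> t\<lbrakk>x0 \<cdot> a\<up>1 \<cdot> sh1\<rbrakk>) b \<doteq> r : T"
    by (rule beta[where B="C\<lbrakk>x0 \<cdot> a\<up>1 \<cdot> sh1\<rbrakk>"]) (rule ty a | simp add: assms)+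
  finally show ?thesis .
qed

text \<open>
  Path elimination with one endpoint fixed, derived from elimination with both endpoints free.
  The free form proves that for all \<open>x\<close>, \<open>y\<close> and \<open>p : x = y\<close>, every family \<open>K\<close> of types over
  \<open>\<Sigma>z. x = z\<close> has a map \<open>K x refl \<rightarrow> K y p\<close>: for \<open>refl\<close> it is the identity.  Quantifying over \<open>K\<close> costs
  one universe level, and taking \<open>K\<close> to be \<open>P\<close> gives the claim.
\<close>

lemma path_induction_at:
  assumes A: "G |- A type" and a: "G |- a : A" and P: "Id A\<up>1 a\<up>1 x0 # A # G |- P type"
    and c: "G |= P\<langle>Refl a, a\<rangle>" and b: "G |- b : A" and p: "G |- p : Id A a b"
  shows "G |= P\<langle>p, b\<rangle>"
proof (cases "\<turnstile> G ctx")
  case True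
  note [ty] = A A[THEN subst_is_type] a a[THEN subst_has_type]
  have I: "A # G |- Id A\<up>1 a\<up>1 x0 type" by (rule ty | simp)+
  have "\<turnstile> Id A\<up>1 a\<up>1 x0 # A # G ctx"
    by (rule is_type_ctx[OF is_type_ctx[OF True A] I])
  then obtain i where P': "Id A\<up>1 a\<up>1 x0 # A # G |- P : Univ i"
    using P by (auto simp: guarded_defs)
  obtain c0 where c0: "G |- c0 : P\<langle>Refl a, a\<rangle>" using c by (rule inhE)
  let ?K = "Lam A (Lam (Id A\<up>1 a\<up>1 x0) P)"
  note [ty] = P' P'[THEN subst_has_type] b p
  have beta: "G |- App (App ?K y) q \<doteq> P\<langle>q, y\<rangle> type" if "G |- y : A" "G |- q : Id A a y" for y q
    by (rule eq_type_El[where i=i], rule beta2[where C="Univ i"]) (rule I P that ty refl | simp)+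
  have c1: "G |- c0 : App (App ?K a) (Refl a)"
    by (rule conv_typing[OF c0], rule eq_type_sym, rule beta) (rule ty)+
  \<comment> \<open>the variables in scope are the path, its target and its source, from the innermost outwards\<close>
  let ?C = "Pi (Pi A\<up>3 (Pi (Id A\<up>4 x3 x0) (Univ i)))
       (Pi (App (App x0 x3) (Refl x3)) (App (App x1 x3) x2))"
  let ?c = "Lam (Pi A\<up>1 (Pi (Id A\<up>2 x1 x0) (Univ i))) (Lam (App (App x0 x1) (Refl x1)) x0)"
  have "G |- App (App (IdInd ?C ?c a b p) ?K) c0 : App (App ?K b) p"
    by (rule c1 ty | simp)+
  then show ?thesis
    by (intro inhI) (rule conv_typing, assumption, rule beta[OF b p])
qed (simp add: guarded_defs)

lemma inh_subst: "G |= A \<Longrightarrow> \<Delta> |- \<sigma> \<Rightarrow>\<^sub>s G \<Longrightarrow> T = A\<lbrakk>\<sigma>\<rbrakk> \<Longrightarrow> \<Delta> |= T"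
  using subst_inh by blast

lemma path_induction:
  assumes A: "G |- A type" and a: "G |- a : A" and P: "Id A\<up>1 a\<up>1 x0 # A # G |- P type"
    and c: "G |= P\<langle>Refl a, a\<rangle>"
  shows "Id A\<up>1 a\<up>1 x0 # A # G |= P"
proof -
  let ?\<Delta> = "Id A\<up>1 a\<up>1 x0 # A # G"
  note [ty] = A A[THEN subst_is_type] a a[THEN subst_has_type] P P[THEN subst_is_type]
  have "?\<Delta> |= P\<lbrakk>x0 \<cdot> x1 \<cdot> sh4\<rbrakk>\<langle>x0, x1\<rangle>"
    by (rule path_induction_at[where A="A\<up>2" and a="a\<up>2"]) (rule inh_subst[OF c, of _ sh2] ty | simp)+
  then show ?thesis by simp
qed

lemma id_refl: "G |- A type \<Longrightarrow> G |- a : A \<Longrightarrow> G |= Id A a a"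
  by (rule inhI, rule Refl_typing)

lemma leibniz:
  assumes "A # G |- P type" "G |- A type" "G |- a : A" "G |- b : A" "G |= Id A a b" "G |= P\<langle>a\<rangle>"
  shows "G |= P\<langle>b\<rangle>"
proof -
  obtain p where p: "G |- p : Id A a b" using assms(5) by (rule inhE)
  obtain u where u: "G |- u : P\<langle>a\<rangle>" using assms(6) by (rule inhE)
  show ?thesis by (rule inhI, rule transport_typing[OF p assms(2-4,1) u refl])
qed

lemma id_sym:
  assumes [ty]: "G |- A type" "G |- a : A" "G |- b : A" and e: "G |= Id A a b" shows "G |= Id A b a"
proof -
  note [ty] = assms(1)[THEN subst_is_type] assms(2,3)[THEN subst_has_type]
  have "G |= (Id A\<up>1 x0 a\<up>1)\<langle>b\<rangle>"
    by (rule leibniz[OF _ _ _ _ e]) (rule ty id_refl | simp)+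
  then show ?thesis by simp
qed

lemma id_trans:
  assumes [ty]: "G |- A type" "G |- a : A" "G |- b : A" "G |- c : A" and e: "G |= Id A a b" "G |= Id A b c" shows "G |= Id A a c"
proof -
  note [ty] = assms(1)[THEN subst_is_type] assms(2,3,4)[THEN subst_has_type]
  have "G |= (Id A\<up>1 a\<up>1 x0)\<langle>c\<rangle>"
    by (rule leibniz[OF _ _ _ _ e(2)]) (rule ty | simp add: e)+
  then show ?thesis by simp
qed

lemma id_ap:
  assumes "G |= Id A a b" "A # G |- t : B\<up>1" "G |- A type" "G |- B type" "G |- a : A" "G |- b : A"
   "s = t\<langle>a\<rangle>" "s' = t\<langle>b\<rangle>"
  shows "G |= Id B s s'"
proof -
  note [ty] = assms(3-6) assms(3,4)[THEN subst_is_type] assms(5,6,2)[THEN subst_has_type]  assms(2)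
  have "G |= (Id B\<up>1 t\<lbrakk>a\<up>1 \<cdot> sh1\<rbrakk> t)\<langle>b\<rangle>"
    by (rule leibniz[OF _ _ _ _ assms(1)]) (rule ty id_refl | simp)+
  then show ?thesis by (simp add: assms)
qed

text \<open>
  A path together with the typing of its ends.  Chains of paths then compose without side
  conditions.
\<close>

definition path :: "tm list \<Rightarrow> tm \<Rightarrow> tm \<Rightarrow> tm \<Rightarrow> bool" (\<open>_ |- _ \<sim> _ : _\<close> [51, 51, 51, 51] 50) where
  "G |- a \<sim> b : A \<longleftrightarrow> G |= Id A a b \<and> G |- A type \<and> G |- a : A \<and> G |- b : A"

lemma path_trans [trans]: "G |- a \<sim> b : A \<Longrightarrow> G |- b \<sim> c : A \<Longrightarrow> G |- a \<sim> c : A"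
  unfolding path_def using id_trans by blast
lemma path_sym: "G |- a \<sim> b : A \<Longrightarrow> G |- b \<sim> a : A"
  unfolding path_def using id_sym by blast
lemma path_ap: "G |- a \<sim> b : A \<Longrightarrow> A # G |- t : B\<up>1 \<Longrightarrow> G |- B type \<Longrightarrow> s = t\<langle>a\<rangle> \<Longrightarrow> s' = t\<langle>b\<rangle> \<Longrightarrow> G |- s \<sim> s' : B"
  unfolding path_def
  using id_ap[of G A a b t B] subst_has_type[of "A # G" t "B\<up>1" G "a \<cdot> sh0" B] subst_has_type[of "A # G" t "B\<up>1" G "b \<cdot> sh0" B]
   sub_scons[OF sub_shift, of 0 G G A a] sub_scons[OF sub_shift, of 0 G G A b] by simp
lemma path_eq: "G |- a \<doteq> b : A \<Longrightarrow> G |- A type \<Longrightarrow> G |- a : A \<Longrightarrow> G |- b : A \<Longrightarrow> G |- a \<sim> b : A"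
  unfolding path_def using eq_inh_Id by blast
lemma pathI: "G |= Id A a b \<Longrightarrow> G |- A type \<Longrightarrow> G |- a : A \<Longrightarrow> G |- b : A \<Longrightarrow> G |- a \<sim> b : A"
  unfolding path_def by blast
lemma pathD: "G |- a \<sim> b : A \<Longrightarrow> G |= Id A a b"
  unfolding path_def by blast

section \<open>Inhabited types as a logic\<close>

lemma inh_Lam: "G |- A type \<Longrightarrow> A # G |= B \<Longrightarrow> G |= Pi A B"
  by (elim inhE) (rule inhI, rule Lam_typing)

lemma inh_App: "G |= Pi A B \<Longrightarrow> G |- a : A \<Longrightarrow> T = B\<langle>a\<rangle> \<Longrightarrow> G |= T"
  by (elim inhE) (rule inhI, rule App_typing)

lemma inh_unLam: assumes "G |= Pi A B" shows "A # G |= B"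
proof -
  obtain f where f: "G |- f : Pi A B" using assms by (rule inhE)
  note [ty] = f[THEN subst_has_type]
  have "A # G |- App f\<up>1 x0 : B"
    by (rule App_typing[where A="A\<up>1" and B="B\<lbrakk>x0 \<cdot> sh2\<rbrakk>"]) (rule ty | simp)+
  then show ?thesis by (rule inhI)
qed

text \<open>
  Replacement of a judgmentally equal subterm in a type, read backwards.
\<close>

lemma inh_subst_eq:
  assumes "G |- a \<doteq> b : A" "G |= P\<langle>b\<rangle>" "G |- A type" "G |- a : A" "G |- b : A" "A # G |- P type" "T = P\<langle>a\<rangle>"
  shows "G |= T"
  using inh_conv[OF assms(2) eq_type_sym[OF eq_subst_type[OF assms(3,6,4,5,1)]]] assms(7) by simp

lemma inh_Unit:
  assumes "Unit # G |- C type" "G |= C\<langle>Star\<rangle>"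
  shows "Unit # G |= C"
proof -
  obtain c where c: "G |- c : C\<langle>Star\<rangle>" using assms(2) by (rule inhE)
  note [ty] = assms(1)[THEN subst_is_type] c[THEN subst_has_type]
  have "Unit # G |- UnitInd C\<lbrakk>x0 \<cdot> sh2\<rbrakk> c\<up>1 x0 : C"
    by (rule ty | simp)+
  then show ?thesis by (rule inhI)
qed

lemma inh_Empty:
  assumes "G |- e : Empty" "G |- T type"
  shows "G |= T"
proof -
  note [ty] = assms(2)[THEN subst_is_type]
  show ?thesis by (rule inhI, rule EmptyInd_typing[where C="T\<up>1", OF assms(1)]) (rule ty | simp)+
qed

lemma inh_Nat:
  assumes "NatT # G |- C type" "G |= C\<langle>ZeroN\<rangle>" "C # NatT # G |= C\<lbrakk>SucN x1 \<cdot> sh2\<rbrakk>"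
  shows "NatT # G |= C"
proof -
  obtain z where z: "G |- z : C\<langle>ZeroN\<rangle>" using assms(2) by (rule inhE)
  obtain s where s: "C # NatT # G |- s : C\<lbrakk>SucN x1 \<cdot> sh2\<rbrakk>" using assms(3) by (rule inhE)
  note [ty] = assms(1) assms(1)[THEN subst_is_type] z[THEN subst_has_type] s[THEN subst_has_type]
  have "NatT # G |- NatInd C\<lbrakk>x0 \<cdot> sh2\<rbrakk> z\<up>1 s\<lbrakk>x0 \<cdot> x1 \<cdot> sh3\<rbrakk> x0 : C"
    by (rule ty | simp)+
  then show ?thesis by (rule inhI)
qed

lemma inh_Nat_cases:
  assumes "NatT # G |- C type" "G |= C\<langle>ZeroN\<rangle>" "NatT # G |= C\<lbrakk>SucN x0 \<cdot> sh1\<rbrakk>"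
  shows "NatT # G |= C"
proof -
  note [ty] = assms(1) 
  show ?thesis 
   by (rule inh_Nat) (rule assms inh_subst[OF assms(3), of _ sh1] ty | simp)+
qed

lemma inh_Sum:
  assumes "Sum A B # G |- C type" "G |- A type" "G |- B type" "A # G |= C\<lbrakk>Inl x0 \<cdot> sh1\<rbrakk>" "B # G |= C\<lbrakk>Inr x0 \<cdot> sh1\<rbrakk>"
  shows "Sum A B # G |= C"
proof -
  obtain c where c: "A # G |- c : C\<lbrakk>Inl x0 \<cdot> sh1\<rbrakk>" using assms(4) by (rule inhE)
  obtain d where d: "B # G |- d : C\<lbrakk>Inr x0 \<cdot> sh1\<rbrakk>" using assms(5) by (rule inhE)
  note [ty] = assms(1-3) assms(1-3)[THEN subst_is_type] c[THEN subst_has_type] d[THEN subst_has_type]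
  have "Sum A B # G |- SumInd C\<lbrakk>x0 \<cdot> sh2\<rbrakk> c\<lbrakk>x0 \<cdot> sh2\<rbrakk> d\<lbrakk>x0 \<cdot> sh2\<rbrakk> x0 : C"
    by (rule SumInd_typing[where A="A\<up>1" and B="B\<up>1"]) (rule ty | simp)+
  then show ?thesis by (rule inhI)
qed

lemma inh_Sig:
  assumes "Sig A B # G |- C type" "G |- A type" "A # G |- B type" "B # A # G |= C\<lbrakk>Pair x1 x0 \<cdot> sh2\<rbrakk>"
  shows "Sig A B # G |= C"
proof -
  obtain c where c: "B # A # G |- c : C\<lbrakk>Pair x1 x0 \<cdot> sh2\<rbrakk>" using assms(4) by (rule inhE)
  note [ty] = assms(1-3) assms(1-3)[THEN subst_is_type] c[THEN subst_has_type]
  have "Sig A B # G |- SigInd C\<lbrakk>x0 \<cdot> sh2\<rbrakk> c\<lbrakk>x0 \<cdot> x1 \<cdot> sh3\<rbrakk> x0 : C"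
    by (rule SigInd_typing[where A="A\<up>1" and B="B\<lbrakk>x0 \<cdot> sh2\<rbrakk>"]) (rule ty | simp)+
  then show ?thesis by (rule inhI)
qed

lemma inh_Id_cases:
  assumes A: "G |- A type" and P: "Id A\<up>2 x1 x0 # A\<up>1 # A # G |- P type" and r: "A # G |= P\<lbrakk>Refl x0 \<cdot> x0 \<cdot> sh0\<rbrakk>"
  shows "Id A\<up>2 x1 x0 # A\<up>1 # A # G |= P"
proof -
  note [ty] = A A[THEN subst_is_type]
  have "Id A\<up>1\<up>1 x0\<up>1 x0 # A\<up>1 # A # G |= P"
    by (rule path_induction) (rule ty | simp add: r P)+
  then show ?thesis by simp
qed

section \<open>Propositions and sets\<close>

definition isprop :: "tm \<Rightarrow> tm" where
  "isprop A = Pi A (Pi A\<up>1 (Id A\<up>2 x1 x0))"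

lemma subst_isprop [simp]: "(isprop A)\<lbrakk>\<sigma>\<rbrakk> = isprop A\<lbrakk>\<sigma>\<rbrakk>"
  by (simp add: isprop_def)

text \<open>
  Transporting \<open>\<alpha>\<close> along itself in the family \<open>z. z = a\<close> composes the inverse of \<open>\<alpha>\<close> with \<open>\<alpha>\<close>.
\<close>

lemma transport_self:
  assumes [ty]: "G |- A type" "G |- a : A" "G |- \<alpha> : Id A a a"
  shows "G |= Id (Id A a a) (transport (Id A\<up>1 x0 a\<up>1) a a \<alpha> \<alpha>) (Refl a)"
proof -
  note [ty] = assms(1)[THEN subst_is_type] assms(2)[THEN subst_has_type]
  let ?P = "Id (Id A\<up>2 x1 x1) (transport (Id A\<up>3 x0 x2) a\<up>2 x1 x0 x0) (Refl x1)"
  have "G |= ?P\<langle>\<alpha>, a\<rangle>"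
  proof (rule path_induction_at[where A=A and a=a])
    show "G |= ?P\<langle>Refl a, a\<rangle>"
      apply simp
      apply (rule eq_inh_Id)
      apply (rule transport_Refl_eq[where A=A])
      by (rule ty | simp)+
  qed (rule ty | simp)+
  then show ?thesis by simp
qed

text \<open>
  If a family \<open>C\<close> over \<open>A\<close> has a point over \<open>a\<close> and every point of \<open>C y\<close> yields a path \<open>a = y\<close>,
  then \<open>a = y\<close> is a retract of \<open>C y\<close>.  In one direction \<open>p\<close> goes to the transport of \<open>c\<close> along \<open>p\<close>; in the
  other, \<open>d\<close> is first corrected by the inverse of the loop \<open>\<alpha>\<close> that it assigns to \<open>c\<close>, so that the composite fixes
  \<open>refl\<close> and hence, by path induction, every path.  A retract of a proposition is a proposition.
\<close>

lemma Id_isprop_by_retract: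
  assumes A: "G |- A type" and a: "G |- a : A" and C: "A # G |- C type" and c: "G |- c : C\<langle>a\<rangle>"
    and d: "C # A # G |- d : Id A\<up>2 a\<up>2 x1" and C_prop: "A # G |= isprop C"
  shows "A # G |= isprop (Id A\<up>1 a\<up>1 x0)"
proof -
  note [ty] = A A[THEN subst_is_type] a a[THEN subst_has_type] C C[THEN subst_is_type]
    c c[THEN subst_has_type] d[THEN subst_has_type] 
  define \<alpha> where "\<alpha> = d\<langle>c, a\<rangle>"
  have \<alpha>: "G |- \<alpha> : Id A a a"
    unfolding \<alpha>_def by (rule ty | simp)+
  note [ty] = \<alpha> \<alpha>[THEN subst_has_type]
  \<comment> \<open>the corrected map from \<open>C y\<close> to \<open>a = y\<close>: first the inverse of \<open>\<alpha>\<close>, then \<open>d\<close>\<close>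
  define \<theta> where "\<theta> = transport (Id A\<up>3 x0 x2) a\<up>2 a\<up>2 \<alpha>\<up>2 d"
  have \<theta>: "C # A # G |- \<theta> : Id A\<up>2 a\<up>2 x1"
    unfolding \<theta>_def by (rule ty d[THEN typing_eqI] | simp)+
  note [ty] = \<theta> \<theta>[THEN subst_has_type]
  let ?\<Delta> = "Id A\<up>1 a\<up>1 x0 # A # G"
  have inv: "?\<Delta> |= Id (Id A\<up>2 a\<up>2 x1) \<theta>\<lbrakk>transport C\<lbrakk>x0 \<cdot> sh3\<rbrakk> a\<up>2 x1 x0 c\<up>2 \<cdot> x1 \<cdot> sh2\<rbrakk> x0"
  proof (rule path_induction)
    have "G |- transport C a a (Refl a) c \<sim> c : C\<langle>a\<rangle>"
      by (rule path_eq, rule transport_Refl_eq[where A=A]) (rule ty | simp)+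
    then have "G |- \<theta>\<langle>transport C a a (Refl a) c, a\<rangle> \<sim> \<theta>\<langle>c, a\<rangle> : Id A a a"
      by (rule path_ap[where t="\<theta>\<lbrakk>x0 \<cdot> a\<up>1 \<cdot> sh1\<rbrakk>"]) (rule ty | simp)+
    also have "G |- \<theta>\<langle>c, a\<rangle> \<sim> Refl a : Id A a a"
      using transport_self[OF A a \<alpha>] by (intro pathI) (simp_all add: \<theta>_def \<alpha>_def, (rule ty \<alpha>[unfolded \<alpha>_def] | simp)+)
    finally show "G |= (Id (Id A\<up>2 a\<up>2 x1) \<theta>\<lbrakk>transport C\<lbrakk>x0 \<cdot> sh3\<rbrakk> a\<up>2 x1 x0 c\<up>2 \<cdot> x1 \<cdot> sh2\<rbrakk> x0)\<langle>Refl a, a\<rangle>"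
      by (simp add: pathD)
  qed (rule ty | simp)+
  let ?\<Delta>2 = "Id A\<up>2 a\<up>2 x1 # ?\<Delta>"
  let ?tr = "\<lambda>q. transport C\<lbrakk>x0 \<cdot> sh4\<rbrakk> a\<up>3 x2 q c\<up>3"
  have "?\<Delta>2 |= isprop C\<lbrakk>x2 \<cdot> sh3\<rbrakk>"
    by (rule inh_subst[OF C_prop, of _ sh2]) (rule ty | simp)+
  note C_eq = inh_App[OF inh_App[OF this[unfolded isprop_def], where a="?tr x1"], where a="?tr x0"]
  have "?\<Delta>2 |- x1 \<sim> \<theta>\<lbrakk>?tr x1 \<cdot> x2 \<cdot> sh3\<rbrakk> : Id A\<up>3 a\<up>3 x2"
    by (rule path_sym, rule pathI, rule inh_subst[OF inv, of _ sh1]) (rule ty | simp)+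
  also have "?\<Delta>2 |- ?tr x1 \<sim> ?tr x0 : C\<lbrakk>x2 \<cdot> sh3\<rbrakk>"
    by (rule pathI, rule C_eq) (rule ty refl | simp)+
  then have "?\<Delta>2 |- \<theta>\<lbrakk>?tr x1 \<cdot> x2 \<cdot> sh3\<rbrakk> \<sim> \<theta>\<lbrakk>?tr x0 \<cdot> x2 \<cdot> sh3\<rbrakk> : Id A\<up>3 a\<up>3 x2"
    by (rule path_ap[where t="\<theta>\<lbrakk>x0 \<cdot> x3 \<cdot> sh4\<rbrakk>"]) (rule ty | simp)+
  also have "?\<Delta>2 |- \<theta>\<lbrakk>?tr x0 \<cdot> x2 \<cdot> sh3\<rbrakk> \<sim> x0 : Id A\<up>3 a\<up>3 x2"
    by (rule pathI, rule inh_subst[OF inv, of _ "x0 \<cdot> sh2"]) (rule ty | simp)+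
  finally have "?\<Delta>2 |= Id (Id A\<up>3 a\<up>3 x2) x1 x0" by (rule pathD)
  then show ?thesis
    unfolding isprop_def
    by (intro inh_Lam) (rule ty | simp)+
qed

lemma isprop_type [ty]: assumes "G |- A type" shows "G |- isprop A type"
proof -
  note [ty] = assms assms[THEN subst_is_type]
  show ?thesis unfolding isprop_def by (rule ty | simp)+
qed

lemma isset_isprop: "isset A = Pi A (Pi A\<up>1 (isprop (Id A\<up>2 x1 x0)))"
  by (simp add: isset_def isprop_def)

lemma isset_type [ty]: assumes "G |- A type" shows "G |- isset A type"
proof -
  note [ty] = assms assms[THEN subst_is_type]
  show ?thesis unfolding isset_isprop by (rule ty | simp)+
qed

lemma isprop_Unit: "G |= isprop Unit"
proof -
  have "Unit # G |= Id Unit Star x0"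
    by (rule inh_Unit) (rule ty id_refl | simp)+
  then have "Unit # G |= Pi Unit (Id Unit x1 x0)"
    by (intro inh_Unit) (rule ty inh_Lam | simp)+
  then show ?thesis unfolding isprop_def by (auto intro!: inh_Lam[of G] ty)
qed

lemma isprop_Empty: "G |= isprop Empty"
  unfolding isprop_def by (intro inh_Lam inh_Empty[where e=x0]) (rule ty | simp)+

lemma issetI:
  assumes [ty]: "G |- A type" and r: "A\<up>1 # A # G |= isprop (Id A\<up>2 x1 x0)" 
  shows "G |= isset A"
proof -
  note [ty] = assms(1)[THEN subst_is_type]
  show ?thesis unfolding isset_isprop by (rule inh_Lam r ty | simp)+
qed

text \<open>
  The path spaces of a proposition are retracts of the constant family \<open>Unit\<close>.
\<close>

lemma isprop_imp_isset:
  assumes A: "G |- A type" and pr: "G |= isprop A"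
  shows "G |= isset A"
proof -
  note [ty] = A A[THEN subst_is_type]
  obtain f where f: "G |- f : Pi A (Pi A\<up>1 (Id A\<up>2 x1 x0))" using pr unfolding isprop_def by (rule inhE)
  note [ty] = f[THEN subst_has_type]
  have "A\<up>1 # A # G |= isprop (Id A\<up>1\<up>1 x0\<up>1 x0)"
    by (rule Id_isprop_by_retract[where C=Unit and c=Star and d="App (App f\<up>3 x2) x1"]) (rule isprop_Unit ty | simp)+
  then show ?thesis
    by (intro issetI A) simp
qed

lemma isset_Id:
  assumes s: "G |= isset A" and A: "G |- A type" and a: "G |- a : A" and b: "G |- b : A"
  shows "G |= isprop (Id A a b)"
  by (rule inh_App[OF inh_App[OF s[unfolded isset_isprop] a refl, simplified] b]) simp

lemma isset_Id_isset:
  assumes s: "G |= isset A" and A [ty]: "G |- A type" and a [ty]: "G |- a : A" and b [ty]: "G |- b : A"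
  shows "G |= isset (Id A a b)"
  by (rule isprop_imp_isset[OF _ isset_Id[OF assms]]) (rule ty)+

text \<open>
  The path space \<open>x = y\<close> is a retract of \<open>s x = s y\<close>.
\<close>

lemma isset_retract:
  assumes A: "G |- A type" and B: "G |- B type" and s: "A # G |- s : B\<up>1" and r: "B # G |- r : A\<up>1"
    and rs: "A # G |= Id A\<up>1 r\<lbrakk>s \<cdot> sh1\<rbrakk> x0" and Bset: "G |= isset B"
  shows "G |= isset A"
proof -
  note [ty] = A A[THEN subst_is_type] B B[THEN subst_is_type] s[THEN subst_has_type] r[THEN subst_has_type] s[THEN typing_eqI]
  let ?C = "Id B\<up>2 s\<lbrakk>x1 \<cdot> sh2\<rbrakk> s\<lbrakk>x0 \<cdot> sh2\<rbrakk>"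
  let ?\<Delta> = "?C # A\<up>1 # A # G"
  let ?r = "\<lambda>x. r\<lbrakk>s\<lbrakk>x \<cdot> sh3\<rbrakk> \<cdot> sh3\<rbrakk>"
  have "?\<Delta> |- x2 \<sim> ?r x2 : A\<up>3"
    by (rule path_sym, rule pathI, rule inh_subst[OF rs, of _ "x2 \<cdot> sh3"]) (rule ty | simp)+
  also have "?\<Delta> |- s\<lbrakk>x2 \<cdot> sh3\<rbrakk> \<sim> s\<lbrakk>x1 \<cdot> sh3\<rbrakk> : B\<up>3"
    by (rule pathI, rule inhI[of _ x0]) (rule ty | simp)+
  then have "?\<Delta> |- ?r x2 \<sim> ?r x1 : A\<up>3"
    by (rule path_ap[where t="r\<lbrakk>x0 \<cdot> sh4\<rbrakk>"]) (rule ty | simp)+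
  also have "?\<Delta> |- ?r x1 \<sim> x1 : A\<up>3"
    by (rule pathI, rule inh_subst[OF rs, of _ "x1 \<cdot> sh3"]) (rule ty | simp)+
  finally have "?\<Delta> |= Id A\<up>3 x2 x1" by (rule pathD)
  then obtain d where d: "?\<Delta> |- d : Id A\<up>3 x2 x1" by (rule inhE)
  have p: "A\<up>1 # A # G |= isset B\<up>2"
    by (rule inh_subst[OF Bset, of _ sh2]) (rule ty | simp)+
  have p2: "A\<up>1 # A # G |= isprop ?C"
    by (rule isset_Id[OF p]) (rule ty | simp)+
  have "A\<up>1 # A # G |= isprop (Id A\<up>1\<up>1 x0\<up>1 x0)"
    by (rule Id_isprop_by_retract[OF _ _ _ _ _ p2, where c="Refl s" and d=d]) (rule d[THEN typing_eqI] ty | simp)+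
  then show ?thesis
    by (intro issetI A) simp
qed

section \<open>The natural numbers and the integers are sets\<close>

lemma isprop_eq:
  assumes "G |- A \<doteq> B : Univ 0" "G |- A : Univ 0" "G |- B : Univ 0" "G |= isprop B"
  shows "G |= isprop A"
  by (rule inh_subst_eq[OF assms(1), where P="isprop x0"]) (rule ty assms(2,3) | simp add: assms(4))+

text \<open>
  The paths from \<open>0\<close> are a retract of the family \<open>K\<close> that is \<open>Unit\<close> at \<open>0\<close> and \<open>Empty\<close> at successors.
\<close>

lemma eq_zero_isprop: "NatT # G |= isprop (Id NatT ZeroN x0)"
proof -
  define K where "K = NatInd (Univ 0) Unit Empty"
  have K_sub [simp]: "(K n)\<lbrakk>\<sigma>\<rbrakk> = K n\<lbrakk>\<sigma>\<rbrakk>" for n \<sigma> by (simp add: K_def)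
  have K_U [ty]: "\<Delta> |- K n : Univ 0" if "\<Delta> |- n : NatT" for \<Delta> n
    unfolding K_def by (rule ty that | simp)+
  note [ty] = El[OF K_U]
  have K0: "\<Delta> |- K ZeroN \<doteq> Unit : Univ 0" for \<Delta>
    unfolding K_def by (rule NatInd_zero_eq) (rule ty | simp)+
  have KS: "\<Delta> |- K (SucN n) \<doteq> Empty : Univ 0" if "\<Delta> |- n : NatT" for \<Delta> n
    unfolding K_def by (rule NatInd_suc_eq) (rule ty that | simp)+
  have c: "G |- Star : K ZeroN"
    by (rule conv_typing[OF _ eq_type_sym[OF eq_type_El[OF K0]]]) (rule ty)
  have e: "K (SucN x0) # NatT # G |- x0 : Empty"
    by (rule conv_typing[OF _ eq_type_El[OF KS[of _ x1]]]) (rule ty | simp)+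
  have "NatT # G |= Pi (K x0) (Id NatT ZeroN x1)"
    by (rule inh_Nat_cases) (rule inh_Lam inh_Empty[OF e] id_refl ty | simp)+
  then obtain d where d: "K x0 # NatT # G |- d : Id NatT ZeroN x1"
    using inh_unLam inhE by meson
  have "NatT # G |= isprop (K x0)"
    by (rule inh_Nat_cases) (rule isprop_eq[OF K0] isprop_eq[OF KS] isprop_Unit isprop_Empty ty | simp)+
  from Id_isprop_by_retract[OF _ _ _ _ _ this, where c=Star and d=d and a=ZeroN]
  show ?thesis using c d by (simp add: ty)
qed

text \<open>
  Here the family \<open>K m\<close> is \<open>Empty\<close> at \<open>0\<close> and \<open>m = n\<close> at the successor of \<open>n\<close>.  As the
  induction is over \<open>m\<close>, the family is defined by cases on \<open>n\<close> alone.
\<close>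

lemma eq_suc_isprop:
  assumes m: "G |- m : NatT" and IH: "NatT # G |= isprop (Id NatT m\<up>1 x0)"
  shows "NatT # G |= isprop (Id NatT (SucN m\<up>1) x0)"
proof -
  define K where "K = (\<lambda>m. NatInd (Univ 0) Empty (Id NatT m\<up>2 x1))"
  have K_sub [simp]: "(K m n)\<lbrakk>\<sigma>\<rbrakk> = K m\<lbrakk>\<sigma>\<rbrakk> n\<lbrakk>\<sigma>\<rbrakk>" for m n \<sigma> by (simp add: K_def)
  have K_U [ty]: "\<Delta> |- K m n : Univ 0" if "\<Delta> |- m : NatT" "\<Delta> |- n : NatT" for \<Delta> m n
    unfolding K_def by (rule ty that that[THEN subst_has_type] | simp)+
  note [ty] = El[OF K_U] m m[THEN subst_has_type]
  have K0: "\<Delta> |- K m ZeroN \<doteq> Empty : Univ 0" if "\<Delta> |- m : NatT" for \<Delta> m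
    unfolding K_def by (rule NatInd_zero_eq) (rule ty that[THEN subst_has_type] | simp)+
  have KS: "\<Delta> |- K m (SucN n) \<doteq> Id NatT m n : Univ 0" if "\<Delta> |- m : NatT" "\<Delta> |- n : NatT" for \<Delta> m n
    unfolding K_def by (rule NatInd_suc_eq) (rule ty that that[THEN subst_has_type] | simp)+
  have c: "G |- Refl m : K m (SucN m)"
    by (rule conv_typing[OF _ eq_type_sym[OF eq_type_El[OF KS]]]) (rule ty)+
  have e: "K m ZeroN # G |- x0 : Empty"
    by (rule conv_typing[OF _ eq_type_El[OF K0[of _ "m\<up>1"]]]) (rule ty | simp)+
  have p: "K m\<up>1 (SucN x0) # NatT # G |- x0 : Id NatT m\<up>2 x1"
    by (rule conv_typing[OF _ eq_type_El[OF KS[of _ "m\<up>2"]]]) (rule ty | simp)+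
  have q: "K m\<up>1 (SucN x0) # NatT # G |= Id NatT (SucN m\<up>2) (SucN x1)"
    by (rule id_ap[OF inhI[OF p], where t="SucN x0"]) (rule ty | simp)+
  have "NatT # G |= Pi (K m\<up>1 x0) (Id NatT (SucN m\<up>2) x1)"
    by (rule inh_Nat_cases) (rule inh_Lam inh_Empty[OF e] q ty | simp)+
  then obtain d where d: "K m\<up>1 x0 # NatT # G |- d : Id NatT (SucN m\<up>2) x1"
    using inh_unLam inhE by meson
  have "NatT # G |= isprop (K m\<up>1 x0)"
    by (rule inh_Nat_cases) (rule isprop_eq[OF K0] isprop_eq[OF KS] IH isprop_Empty ty | simp)+
  from Id_isprop_by_retract[OF _ _ _ _ _ this, where c="Refl m" and d=d and a="SucN m"]
  show ?thesis using c d by (simp add: ty m)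
qed

lemma isset_Nat: "G |= isset NatT"
proof -
  let ?C = "Pi NatT (isprop (Id NatT x1 x0))"
  have "?C # NatT # G |= Pi NatT (isprop (Id NatT x2 x0))"
    by (rule inhI[of _ x0]) (rule ty | simp)+
  note IH = inh_unLam[OF this]
  have "NatT # G |= ?C"
    by (rule inh_Nat) (rule inh_Lam eq_zero_isprop eq_suc_isprop[where m=x1, simplified] IH ty | simp)+
  from inh_unLam[OF this] show ?thesis by (intro issetI ty) simp
qed

text \<open>
  The integers are enumerated as \<open>0, -1, 1, -2, 2, \<dots>\<close>: \<open>nat_of\<close> gives the position of an integer in this list, \<open>flip\<close>
  steps to the next entry, and \<open>int_of\<close> iterates it.  This makes the integers a retract of the natural
  numbers, so that being a set carries over without an analysis of paths in a coproduct.
\<close>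

definition dblN :: "tm \<Rightarrow> tm" where "dblN n = NatInd NatT ZeroN (SucN (SucN x0)) n"
definition flip :: "tm \<Rightarrow> tm" where "flip z = SumInd IntT (Inr x0) (Inl (SucN x0)) z"
definition nat_of :: "tm \<Rightarrow> tm" where "nat_of z = SumInd NatT (dblN x0) (SucN (dblN x0)) z"
definition int_of :: "tm \<Rightarrow> tm" where "int_of n = NatInd IntT (Inl ZeroN) (flip x0) n"

lemma subst_IntT [simp]: "IntT\<lbrakk>\<sigma>\<rbrakk> = IntT" by (simp add: IntT_def)
lemma IntT_typing [ty]: "G |- IntT type" "G |- IntT : Univ i"
  unfolding IntT_def by (rule ty)+
lemma Inl_Int_typing [ty]: "G |- a : NatT \<Longrightarrow> G |- Inl a : IntT" unfolding IntT_def by (rule ty | assumption)+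
lemma Inr_Int_typing [ty]: "G |- a : NatT \<Longrightarrow> G |- Inr a : IntT" unfolding IntT_def by (rule ty | assumption)+
lemma subst_enumeration [simp]: "(dblN n)\<lbrakk>\<sigma>\<rbrakk> = dblN n\<lbrakk>\<sigma>\<rbrakk>" "(flip n)\<lbrakk>\<sigma>\<rbrakk> = flip n\<lbrakk>\<sigma>\<rbrakk>" "(nat_of n)\<lbrakk>\<sigma>\<rbrakk> = nat_of n\<lbrakk>\<sigma>\<rbrakk>" "(int_of n)\<lbrakk>\<sigma>\<rbrakk> = int_of n\<lbrakk>\<sigma>\<rbrakk>"
  by (simp_all add: dblN_def flip_def nat_of_def int_of_def)
lemmas SumInd_Int_typing = SumInd_typing[where A=NatT and B=NatT, folded IntT_def]
lemmas SumInd_Int_eq = SumInd_Inl_eq[where A=NatT and B=NatT, folded IntT_def] SumInd_Inr_eq[where A=NatT and B=NatT, folded IntT_def]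
lemmas inh_Int = inh_Sum[where A=NatT and B=NatT, folded IntT_def]

lemma dblN_typing [ty]: "G |- n : NatT \<Longrightarrow> G |- dblN n : NatT"
  unfolding dblN_def by (rule ty | assumption | simp)+
lemma flip_typing [ty]: "G |- n : IntT \<Longrightarrow> G |- flip n : IntT"
  unfolding flip_def by (rule SumInd_Int_typing ty | assumption | simp)+
lemma nat_of_typing [ty]: "G |- n : IntT \<Longrightarrow> G |- nat_of n : NatT"
  unfolding nat_of_def by (rule SumInd_Int_typing ty | assumption | simp)+
lemma int_of_typing [ty]: "G |- n : NatT \<Longrightarrow> G |- int_of n : IntT"
  unfolding int_of_def by (rule ty | assumption | simp)+

lemma dblN_zero: "G |- dblN ZeroN \<sim> ZeroN : NatT"
  by (rule path_eq, unfold dblN_def, rule NatInd_zero_eq) (rule SumInd_Int_typing ty | simp)+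
lemma dblN_suc: assumes [ty]: "G |- n : NatT" shows "G |- dblN (SucN n) \<sim> SucN (SucN (dblN n)) : NatT"
  by (rule path_eq, unfold dblN_def, rule NatInd_suc_eq) (rule SumInd_Int_typing ty | simp)+
lemma flip_Inl: assumes [ty]: "G |- n : NatT" shows "G |- flip (Inl n) \<sim> Inr n : IntT"
  by (rule path_eq, unfold flip_def, rule SumInd_Int_eq) (rule SumInd_Int_typing ty | simp)+
lemma flip_Inr: assumes [ty]: "G |- n : NatT" shows "G |- flip (Inr n) \<sim> Inl (SucN n) : IntT"
  by (rule path_eq, unfold flip_def, rule SumInd_Int_eq) (rule SumInd_Int_typing ty | simp)+
lemma nat_of_Inl: assumes [ty]: "G |- n : NatT" shows "G |- nat_of (Inl n) \<sim> dblN n : NatT"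
  by (rule path_eq, unfold nat_of_def, rule SumInd_Int_eq) (rule SumInd_Int_typing ty | simp)+
lemma nat_of_Inr: assumes [ty]: "G |- n : NatT" shows "G |- nat_of (Inr n) \<sim> SucN (dblN n) : NatT"
  by (rule path_eq, unfold nat_of_def, rule SumInd_Int_eq) (rule SumInd_Int_typing ty | simp)+
lemma int_of_zero: "G |- int_of ZeroN \<sim> Inl ZeroN : IntT"
  by (rule path_eq, unfold int_of_def, rule NatInd_zero_eq) (rule SumInd_Int_typing ty | simp)+
lemma int_of_suc: assumes [ty]: "G |- n : NatT" shows "G |- int_of (SucN n) \<sim> flip (int_of n) : IntT"
  by (rule path_eq, unfold int_of_def, rule NatInd_suc_eq) (rule SumInd_Int_typing ty | simp)+

lemma int_of_dbl: "NatT # G |= Id IntT (int_of (dblN x0)) (Inl x0)"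
proof (rule inh_Nat)
  show "NatT # G |- Id IntT (int_of (dblN x0)) (Inl x0) type"
    by (rule ty | simp)+
  have "G |- int_of (dblN ZeroN) \<sim> int_of ZeroN : IntT"
    by (rule path_ap[OF dblN_zero, where t="int_of x0"]) (rule ty | simp)+
  also have "G |- int_of ZeroN \<sim> Inl ZeroN : IntT" by (rule int_of_zero)
  finally show "G |= (Id IntT (int_of (dblN x0)) (Inl x0))\<langle>ZeroN\<rangle>" by (simp add: pathD)
next
  let ?\<Delta> = "Id IntT (int_of (dblN x0)) (Inl x0) # NatT # G"
  have [ty]: "?\<Delta> |- x1 : NatT" by (rule ty | simp)+
  have IH: "?\<Delta> |- int_of (dblN x1) \<sim> Inl x1 : IntT"
    by (rule pathI, rule inhI[of _ x0]) (rule ty | simp)+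
  have "?\<Delta> |- int_of (dblN (SucN x1)) \<sim> int_of (SucN (SucN (dblN x1))) : IntT"
    by (rule path_ap[OF dblN_suc[where n=x1], where t="int_of x0"]) (rule ty | simp)+
  also have "?\<Delta> |- int_of (SucN (SucN (dblN x1))) \<sim> flip (int_of (SucN (dblN x1))) : IntT"
    by (rule int_of_suc flip_Inl flip_Inr ty)+
  also have "?\<Delta> |- flip (int_of (SucN (dblN x1))) \<sim> flip (flip (int_of (dblN x1))) : IntT"
    by (rule path_ap[OF int_of_suc[where n="dblN x1"], where t="flip x0"]) (rule ty | simp)+
  also have "?\<Delta> |- flip (flip (int_of (dblN x1))) \<sim> flip (flip (Inl x1)) : IntT"
    by (rule path_ap[OF IH, where t="flip (flip x0)"]) (rule ty | simp)+
  also have "?\<Delta> |- flip (flip (Inl x1)) \<sim> flip (Inr x1) : IntT"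
    by (rule path_ap[OF flip_Inl[where n=x1], where t="flip x0"]) (rule ty | simp)+
  also have "?\<Delta> |- flip (Inr x1) \<sim> Inl (SucN x1) : IntT"
    by (rule int_of_suc flip_Inl flip_Inr ty)+
  finally show "?\<Delta> |= (Id IntT (int_of (dblN x0)) (Inl x0))\<lbrakk>SucN x1 \<cdot> sh2\<rbrakk>" by (simp add: pathD)
qed

lemma isset_Int: "G |= isset IntT"
proof (rule isset_retract[OF _ _ _ _ _ isset_Nat, where s="nat_of x0" and r="int_of x0"])
  have [ty]: "NatT # G |- x0 : NatT" by (rule ty | simp)+
  have id: "NatT # G |- int_of (dblN x0) \<sim> Inl x0 : IntT"
    by (rule pathI int_of_dbl ty)+
  have "NatT # G |- int_of (nat_of (Inl x0)) \<sim> int_of (dblN x0) : IntT"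
    by (rule path_ap[OF nat_of_Inl[where n=x0], where t="int_of x0"]) (rule ty | simp)+
  also note id
  finally have l: "NatT # G |- int_of (nat_of (Inl x0)) \<sim> Inl x0 : IntT" .
  have "NatT # G |- int_of (nat_of (Inr x0)) \<sim> int_of (SucN (dblN x0)) : IntT"
    by (rule path_ap[OF nat_of_Inr[where n=x0], where t="int_of x0"]) (rule ty | simp)+
  also have "NatT # G |- int_of (SucN (dblN x0)) \<sim> flip (int_of (dblN x0)) : IntT"
    by (rule int_of_suc flip_Inl flip_Inr ty)+
  also have "NatT # G |- flip (int_of (dblN x0)) \<sim> flip (Inl x0) : IntT"
    by (rule path_ap[OF id, where t="flip x0"]) (rule ty | simp)+
  also have "NatT # G |- flip (Inl x0) \<sim> Inr x0 : IntT"
    by (rule int_of_suc flip_Inl flip_Inr ty)+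
  finally have r: "NatT # G |- int_of (nat_of (Inr x0)) \<sim> Inr x0 : IntT" .
  have "IntT # G |= Id IntT (int_of (nat_of x0)) x0"
    by (rule inh_Int) (rule ty | simp add: pathD[OF l] pathD[OF r])+
  then show "IntT # G |= Id IntT\<up>1 (int_of x0)\<lbrakk>nat_of x0 \<cdot> sh1\<rbrakk> x0" by simp
qed (rule ty | simp)+

section \<open>Equivalences\<close>

lemma App_cong_right: "G |- a \<doteq> a' : A \<Longrightarrow> G |- f : Pi A B \<Longrightarrow> T = B\<langle>a\<rangle> \<Longrightarrow> G |- App f a \<doteq> App f a' : T"
  using Pi_elim_cong[OF eq_refl, of G f A B a a'] by (simp add: guarded_defs)
lemma Lam_cong: "A # G |- b \<doteq> b' : B \<Longrightarrow> G |- A type \<Longrightarrow> G |- Lam A b \<doteq> Lam A b' : Pi A B"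
  unfolding guarded_defs by (meson Pi_intro_cong eq_refl ctx_extend)
lemma eta: "G |- f : Pi A B \<Longrightarrow> G |- Lam A (App f\<up>1 x0) \<doteq> f : Pi A B"
  unfolding guarded_defs using Pi_uniq[THEN eq_sym] by simp

lemma inh_Pair: "G |- a : A \<Longrightarrow> G |= B\<langle>a\<rangle> \<Longrightarrow> G |- A type \<Longrightarrow> A # G |- B type \<Longrightarrow> G |= Sig A B"
  by (elim inhE) (rule inhI, rule Pair_typing)

definition prj1 :: "tm \<Rightarrow> tm \<Rightarrow> tm" where "prj1 A p = SigInd A\<up>1 x1 p"

lemma subst_prj1 [simp]: "(prj1 A p)\<lbrakk>\<sigma>\<rbrakk> = prj1 A\<lbrakk>\<sigma>\<rbrakk> p\<lbrakk>\<sigma>\<rbrakk>"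
  by (simp add: prj1_def)

lemma prj1_typing [ty]: assumes p: "G |- p : Sig A B" and A: "G |- A type" and B: "A # G |- B type" and T: "T = A"
  shows "G |- prj1 A p : T"
proof -
  note [ty] = A A[THEN subst_is_type] B B[THEN subst_is_type]
  show ?thesis unfolding prj1_def by (rule SigInd_typing[OF p]) (rule ty | simp add: T)+
qed

lemma prj1_Pair_eq: assumes a: "G |- a : A" and b: "G |- b : B\<langle>a\<rangle>" and A: "G |- A type" and B: "A # G |- B type"
  shows "G |- prj1 A (Pair a b) \<doteq> a : A"
proof -
  note [ty] = A A[THEN subst_is_type] B B[THEN subst_is_type]
  show ?thesis unfolding prj1_def by (rule SigInd_Pair_eq[OF _ _ _ _ a b]) (rule ty | simp)+
qed

text \<open>
  The second component of a pair \<open>p\<close> has to be typed over the first projection of \<open>p\<close>.  For a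
  canonical pair this projection computes, which converts the type in the branch of the eliminator.
\<close>

lemma inh_SigE:
  assumes "G |= Sig A B" and A: "G |- A type" and B: "A # G |- B type"
  obtains a where "G |- a : A" "G |= B\<langle>a\<rangle>"
proof -
  obtain p where p: "G |- p : Sig A B" using assms(1) by (rule inhE)
  note [ty] = A A[THEN subst_is_type] B B[THEN subst_is_type] p
  let ?C = "B\<lbrakk>prj1 A\<up>1 x0 \<cdot> sh1\<rbrakk>"
  have 1: "B # A # G |- prj1 A\<up>2 (Pair x1 x0) \<doteq> x1 : A\<up>2"
    by (rule prj1_Pair_eq[where B="B\<lbrakk>x0 \<cdot> sh3\<rbrakk>"]) (rule ty | simp)+
  have br: "B # A # G |- x0 : B\<lbrakk>prj1 A\<up>2 (Pair x1 x0) \<cdot> sh2\<rbrakk>"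
    by (rule inst_conv_typing[OF eq_term_sym[OF 1], where B="B\<lbrakk>x0 \<cdot> sh3\<rbrakk>"]) (rule prj1_typing[where B="B\<lbrakk>x0 \<cdot> sh3\<rbrakk>"] ty | simp)+
  have "G |- SigInd ?C x0 p : B\<langle>prj1 A p\<rangle>"
    by (rule SigInd_typing[where A=A and B=B]) (rule br[THEN typing_eqI] prj1_typing[where B="B\<lbrakk>x0 \<cdot> sh2\<rbrakk>"] ty | simp)+
  moreover have "G |- prj1 A p : A" by (rule ty refl)+
  ultimately show thesis using that inhI by blast
qed

lemma isequiv_eq: "isequiv A B f = Sig
     (Sig (Pi B A\<up>1) (Pi B\<up>1 (Id B\<up>2 (App f\<up>2 (App x1 x0)) x0)))
     (Sig (Pi B A\<up>1) (Pi A\<up>1 (Id A\<up>2 (App x1 (App f\<up>2 x0)) x0)))\<up>1"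
  by (simp add: isequiv_def)

lemma isequiv_type [ty]:
  assumes A: "G |- A type" and B: "G |- B type" and f: "G |- f : Pi A B\<up>1"
  shows "G |- isequiv A B f type"
proof -
  note [ty] = A A[THEN subst_is_type] B B[THEN subst_is_type] f[THEN subst_has_type]
  show ?thesis unfolding isequiv_eq by (rule ty | simp)+
qed

lemma equiv_type [ty]:
  assumes A: "G |- A type" and B: "G |- B type" 
  shows "G |- equiv A B type"
proof -
  note [ty] = A A[THEN subst_is_type] B B[THEN subst_is_type] 
  show ?thesis unfolding equiv_def by (rule ty | simp)+
qed

text \<open>
  Both homotopies of an equivalence between abstractions have this form.
\<close>

lemma beta_comp:
  assumes A: "G |- A type" and B: "G |- B type" and f: "A # G |- f : B\<up>1" and g: "B # G |- g : A\<up>1"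
    and fg: "B # G |= Id B\<up>1 f\<lbrakk>g \<cdot> sh1\<rbrakk> x0"
  shows "B # G |= Id B\<up>1 (App (Lam A f)\<up>1 (App (Lam B g)\<up>1 x0)) x0"
proof -
  note [ty] = A A[THEN subst_is_type] B B[THEN subst_is_type] f[THEN subst_has_type] f[THEN typing_eqI] g[THEN subst_has_type] g[THEN typing_eqI]
  have "B # G |- App (Lam B g)\<up>1 x0 \<sim> g : A\<up>1"
    apply (rule path_eq)
       apply simp
       apply (rule beta[where B="A\<up>2"])
    by (rule ty | simp)+
  then have "B # G |- App (Lam A f)\<up>1 (App (Lam B g)\<up>1 x0) \<sim> App (Lam A f)\<up>1 g : B\<up>1"
    by (rule path_ap[where t="App (Lam A f)\<up>2 x0"]) (rule ty | simp)+
  also have "B # G |- App (Lam A f)\<up>1 g \<sim> f\<lbrakk>g \<cdot> sh1\<rbrakk> : B\<up>1"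
    apply (rule path_eq)
       apply simp
       apply (rule beta[where B="B\<up>2"])
    by (rule ty | simp)+
  also have "B # G |- f\<lbrakk>g \<cdot> sh1\<rbrakk> \<sim> x0 : B\<up>1"
    by (rule pathI[OF fg]) (rule ty | simp)+
  finally show ?thesis by (rule pathD)
qed

lemma isequivI:
  assumes A: "G |- A type" and B: "G |- B type" and f: "A # G |- f : B\<up>1" and g: "B # G |- g : A\<up>1"
    and fg: "B # G |= Id B\<up>1 f\<lbrakk>g \<cdot> sh1\<rbrakk> x0" and gf: "A # G |= Id A\<up>1 g\<lbrakk>f \<cdot> sh1\<rbrakk> x0"
  shows "G |= isequiv A B (Lam A f)"
proof -
  note [ty] = A A[THEN subst_is_type] B B[THEN subst_is_type] f[THEN subst_has_type] f[THEN typing_eqI] g[THEN subst_has_type] g[THEN typing_eqI]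
  note fg' = beta_comp[OF A B f g fg] and gf' = beta_comp[OF B A g f gf]
  have 2: "G |= Sig (Pi B A\<up>1) (Pi B\<up>1 (Id B\<up>2 (App (Lam A f)\<up>2 (App x1 x0)) x0))"
    apply (rule inh_Pair[where a="Lam B g"])
    apply (rule ty | simp)+
    apply (rule inh_Lam)
    apply (rule ty)
    using fg' apply simp
    by (rule ty | simp)+
  have 3: "G |= Sig (Pi B A\<up>1) (Pi A\<up>1 (Id A\<up>2 (App x1 (App (Lam A f)\<up>2 x0)) x0))"
    apply (rule inh_Pair[where a="Lam B g"])
    apply (rule ty | simp)+
    apply (rule inh_Lam)
    apply (rule ty)
    using gf' apply simp
    by (rule ty | simp)+
  obtain t where t: "G |- t : Sig (Pi B A\<up>1) (Pi B\<up>1 (Id B\<up>2 (App (Lam A f)\<up>2 (App x1 x0)) x0))"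
    using 2 by (rule inhE)
  show ?thesis unfolding isequiv_eq
    apply (rule inh_Pair[where a=t])
       apply (rule t)
    using 3 apply simp
    by (rule ty | simp)+
qed

lemma inh_equivI:
  assumes A: "G |- A type" and B: "G |- B type" and f: "A # G |- f : B\<up>1" and g: "B # G |- g : A\<up>1"
    and fg: "B # G |= Id B\<up>1 f\<lbrakk>g \<cdot> sh1\<rbrakk> x0" and gf: "A # G |= Id A\<up>1 g\<lbrakk>f \<cdot> sh1\<rbrakk> x0"
  shows "G |= equiv A B"
proof -
  note [ty] = A A[THEN subst_is_type] B B[THEN subst_is_type] f[THEN typing_eqI]
  show ?thesis unfolding equiv_def
    by (rule inh_Pair[where a="Lam A f"]) (rule ty | simp add: isequivI[OF assms])+
qed

section \<open>Univalence\<close>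

text \<open>
  The transport function in the identity family \<open>X. X\<close> over a universe, without its argument, so
  that equations between functions can be stated.
\<close>

definition coe :: "tm \<Rightarrow> tm \<Rightarrow> tm \<Rightarrow> tm" where
  "coe A B q = IdInd (Pi x2 x2) (Lam x0 x0) A B q"

lemma subst_coe [simp]: "(coe A B q)\<lbrakk>\<sigma>\<rbrakk> = coe A\<lbrakk>\<sigma>\<rbrakk> B\<lbrakk>\<sigma>\<rbrakk> q\<lbrakk>\<sigma>\<rbrakk>"
  by (simp add: coe_def)

lemma coe_typing [ty]:
  assumes [ty]: "G |- q : Id (Univ 0) A B" "G |- A : Univ 0" "G |- B : Univ 0" and T: "T = Pi A B\<up>1"
  shows "G |- coe A B q : T"
  unfolding coe_def T by (rule IdInd_typing[where A="Univ 0"]) (rule ty | simp)+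

lemma coe_Refl_eq:
  assumes [ty]: "G |- A : Univ 0" shows "G |- coe A A (Refl A) \<doteq> Lam A x0 : Pi A A\<up>1"
  unfolding coe_def by (rule IdInd_Refl_eq[where A="Univ 0"]) (rule ty | simp)+

abbreviation isequiv_id :: "tm \<Rightarrow> tm" where
  "isequiv_id A \<equiv> Pair (Pair (Lam A (Var 0)) (Lam A (Refl (Var 0)))) (Pair (Lam A (Var 0)) (Lam A (Refl (Var 0))))"

lemma isequiv_id_typing:
  assumes A: "G |- A type"
  shows "G |- isequiv_id A : isequiv A A (Lam A x0)"
proof -
  note [ty] = A A[THEN subst_is_type]
  have b: "A # G |- App (Lam A\<up>1 x0) x0 \<doteq> x0 : A\<up>1"
    by (rule beta[where B="A\<up>2"]) (rule ty | simp)+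
  have "A # G |- App (Lam A\<up>1 x0) (App (Lam A\<up>1 x0) x0) \<doteq> App (Lam A\<up>1 x0) x0 : A\<up>1"
    by (rule App_cong_right[OF b, where B="A\<up>2"]) (rule ty | simp)+
  from eq_term_sym[OF eq_term_trans[OF this b]]
  have r: "A # G |- Refl x0 : Id A\<up>1 (App (Lam A\<up>1 x0) (App (Lam A\<up>1 x0) x0)) x0"
    by (rule inst_conv_typing[where B="Id A\<up>2 x0 x1"]) (rule ty | simp)+
  show ?thesis unfolding isequiv_eq
    apply simp
    by (rule Pair_typing r ty | simp)+
qed

lemma idequiv_typing [ty]:
  assumes A: "G |- A type" and T: "T = equiv A A"
  shows "G |- idequiv A : T"
proof -
  note [ty] = A A[THEN subst_is_type]
  show ?thesis unfolding idequiv_def T equiv_def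
    by (rule ty | simp add: isequiv_id_typing[OF A])+
qed

lemma subst_idequiv [simp]: "(idequiv A)\<lbrakk>\<sigma>\<rbrakk> = idequiv A\<lbrakk>\<sigma>\<rbrakk>"
  by (simp add: idequiv_def)

lemma subst_idtoeqv [simp]: "(idtoeqv i A B)\<lbrakk>\<sigma>\<rbrakk> = idtoeqv i A\<lbrakk>\<sigma>\<rbrakk> B\<lbrakk>\<sigma>\<rbrakk>"
  by (simp add: idtoeqv_def)

lemma idtoeqv_typing [ty]:
  assumes A: "G |- A : Univ i" and B: "G |- B : Univ i" and T: "T = Pi (Id (Univ i) A B) (equiv A\<up>1 B\<up>1)"
  shows "G |- idtoeqv i A B : T"
proof -
  note [ty] = A A[THEN subst_has_type] B B[THEN subst_has_type]
  show ?thesis unfolding idtoeqv_def T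
    by (rule ty | simp)+
qed

lemma idtoeqv_Refl_eq:
  assumes A: "G |- A : Univ i"
  shows "G |- App (idtoeqv i A A) (Refl A) \<doteq> idequiv A : equiv A A"
proof -
  note [ty] = A A[THEN subst_has_type] El[OF A]
  have "G |- App (idtoeqv i A A) (Refl A) \<doteq> IdInd (equiv x2 x1) (idequiv x0) A A (Refl A) : equiv A A"
    unfolding idtoeqv_def
    by (rule beta[where B="equiv A\<up>1 A\<up>1"]) (rule ty | simp)+
  also have "G |- IdInd (equiv x2 x1) (idequiv x0) A A (Refl A) \<doteq> idequiv A : equiv A A"
    by (rule IdInd_Refl_eq[where A="Univ i"]) (rule ty | simp)+
  finally show ?thesis .
qed

lemma prj1_equiv_typing [ty]:
  assumes e: "G |- e : equiv A B" and A: "G |- A type" and B: "G |- B type" and T: "T = Pi A B\<up>1" and X: "X = Pi A B\<up>1"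
  shows "G |- prj1 X e : T"
proof -
  note [ty] = A A[THEN subst_is_type] B B[THEN subst_is_type] 
  show ?thesis unfolding T X
    by (rule prj1_typing[where B="isequiv A\<up>1 B\<up>1 x0"]) (rule e[unfolded equiv_def, simplified, THEN typing_eqI] ty | simp)+
qed

text \<open>
  By path induction: for \<open>refl\<close> both sides are judgmentally the identity function.
\<close>

lemma idtoeqv_coe:
  assumes A: "G |- A : Univ 0" and B: "G |- B : Univ 0" and q: "G |- q : Id (Univ 0) A B"
  shows "G |- coe A B q \<sim> prj1 (Pi A B\<up>1) (App (idtoeqv 0 A B) q) : Pi A B\<up>1"
proof -
  note [ty] = A A[THEN subst_has_type] El[OF A] El[OF subst_has_type[OF A]] B El[OF B] El[OF subst_has_type[OF B]] q
  let ?P = "Id (Pi A\<up>2 x2) (coe A\<up>2 x1 x0) (prj1 (Pi A\<up>2 x2) (App (idtoeqv 0 A\<up>2 x1) x0))"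
  let ?L = "\<lambda>e. prj1 (Pi A A\<up>1) e"
  have 1: "G |- coe A A (Refl A) \<sim> Lam A x0 : Pi A A\<up>1"
    by (rule path_eq[OF coe_Refl_eq]) (rule ty | simp)+
  have 2: "G |- App (idtoeqv 0 A A) (Refl A) \<sim> idequiv A : equiv A A"
    by (rule path_eq[OF idtoeqv_Refl_eq]) (rule ty | simp)+
  have 3: "G |- ?L (App (idtoeqv 0 A A) (Refl A)) \<sim> ?L (idequiv A) : Pi A A\<up>1"
    by (rule path_ap[OF 2, where t="prj1 (Pi A\<up>1 A\<up>2) x0"]) (rule ty | simp)+
  have 4: "G |- ?L (idequiv A) \<sim> Lam A x0 : Pi A A\<up>1"
    unfolding idequiv_def
    apply (rule path_eq[OF prj1_Pair_eq[where B="isequiv A\<up>1 A\<up>1 x0"]])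
    apply (fold idequiv_def)
    by (rule isequiv_id_typing ty | simp)+
  have r: "G |= Id (Pi A A\<up>1) (coe A A (Refl A)) (?L (App (idtoeqv 0 A A) (Refl A)))"
    by (rule pathD[OF path_trans[OF 1 path_sym[OF path_trans[OF 3 4]]]])
  have "G |= ?P\<langle>q, B\<rangle>"
    by (rule path_induction_at[where A="Univ 0" and a=A]) (rule ty | simp add: r)+
  then show ?thesis 
    by (intro pathI) (rule ty | simp)+
qed

text \<open>
  The univalence axiom gives a section of \<open>idtoeqv\<close>.  Its value \<open>q\<close> at the given equivalence satisfies
  \<open>idtoeqv q = (f, h)\<close>, and the first projection of the left-hand side is coercion along \<open>q\<close>.  The result is a
  path between functions, not merely a homotopy; function extensionality is derived from it.
\<close>

lemma ua:
  assumes A: "G |- A : Univ 0" and B: "G |- B : Univ 0" and f: "G |- f : Pi A B\<up>1" and e: "G |= isequiv A B f"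
  obtains q where "G |- q : Id (Univ 0) A B" "G |- coe A B q \<sim> f : Pi A B\<up>1"
proof -
  note [ty] = A A[THEN subst_has_type] El[OF A] El[OF subst_has_type[OF A]] B B[THEN subst_has_type] El[OF B] El[OF subst_has_type[OF B]] f
  obtain h where h: "G |- h : isequiv A B f" using e by (rule inhE)
  note [ty] = h
  let ?I = "Id (Univ 0) A B" and ?E = "equiv A B"
  let ?X = "Sig (Pi ?E ?I\<up>1) (Pi ?E\<up>1 (Id ?E\<up>2 (App (idtoeqv 0 A B)\<up>2 (App x1 x0)) x0))"
  have "G |= isequiv ?I ?E (idtoeqv 0 A B)"
    by (rule inhI[of _ "Univalence 0 A B"]) (use univalence A B in \<open>simp add: has_type_def\<close>)
  then have "\<exists>u. G |- u : ?X" unfolding isequiv_eq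
    by (elim inh_SigE) ((rule ty | simp)+, blast)
  then have "G |= ?X" using inhI by blast
  then obtain g where g: "G |- g : Pi ?E ?I\<up>1" 
    and eps: "G |= (Pi ?E\<up>1 (Id ?E\<up>2 (App (idtoeqv 0 A B)\<up>2 (App x1 x0)) x0))\<langle>g\<rangle>"
    by (rule inh_SigE) (rule ty | simp)+
  note [ty] = g g[THEN subst_has_type]
  let ?e = "Pair f h" and ?q = "App g (Pair f h)" and ?L = "\<lambda>e. prj1 (Pi A B\<up>1) e"
  have he: "G |- ?e : ?E" unfolding equiv_def
    by (rule ty | simp)+
  note [ty] = he
  have q: "G |- ?q : ?I" by (rule ty he | simp)+
  have 1: "G |- App (idtoeqv 0 A B) ?q \<sim> ?e : ?E"
    by (rule pathI, rule inh_App[OF eps[simplified], where a="?e"]) (rule he ty | simp)+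
  have 2: "G |- ?L (App (idtoeqv 0 A B) ?q) \<sim> ?L ?e : Pi A B\<up>1"
    by (rule path_ap[OF 1, where t="prj1 (Pi A\<up>1 B\<up>2) x0"]) (rule ty | simp)+
  have 3: "G |- ?L ?e \<sim> f : Pi A B\<up>1"
    by (rule path_eq[OF prj1_Pair_eq[where B="isequiv A\<up>1 B\<up>1 x0"]]) (rule prj1_equiv_typing[OF he] ty | simp)+
  show thesis
    by (rule that[OF q]) (rule path_trans[OF idtoeqv_coe[OF A B q] path_trans[OF 2 3]])
qed

section \<open>Function extensionality\<close>

lemma precomp_coe_refl:
  assumes A: "G |- A : Univ 0" and X: "G |- X type" and w: "G |- w : Pi A X\<up>1"
  shows "G |- Lam A (App w\<up>1 (App (coe A\<up>1 A\<up>1 (Refl A\<up>1)) x0)) \<doteq> w : Pi A X\<up>1"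
proof -
  note [ty] = A A[THEN subst_has_type] El[OF A] El[OF subst_has_type[OF A]] X X[THEN subst_is_type] w w[THEN subst_has_type]
  have "A # G |- App (coe A\<up>1 A\<up>1 (Refl A\<up>1)) x0 \<doteq> App (Lam A\<up>1 x0) x0 : A\<up>1"
    by (rule App_cong_left[OF coe_Refl_eq]) (rule ty | simp)+
  also have "A # G |- App (Lam A\<up>1 x0) x0 \<doteq> x0 : A\<up>1"
    by (rule beta[where B="A\<up>2"]) (rule ty | simp)+
  finally have 1: "A # G |- App (coe A\<up>1 A\<up>1 (Refl A\<up>1)) x0 \<doteq> x0 : A\<up>1" .
  have "A # G |- App w\<up>1 (App (coe A\<up>1 A\<up>1 (Refl A\<up>1)) x0) \<doteq> App w\<up>1 x0 : X\<up>1"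
    by (rule App_cong_right[OF 1, where B="X\<up>2"]) (rule ty | simp)+
  then have "G |- Lam A (App w\<up>1 (App (coe A\<up>1 A\<up>1 (Refl A\<up>1)) x0)) \<doteq> Lam A (App w\<up>1 x0) : Pi A X\<up>1"
    by (rule Lam_cong) (rule ty)
  also have "G |- Lam A (App w\<up>1 x0) \<doteq> w : Pi A X\<up>1"
    by (rule eta[OF w])
  finally show ?thesis .
qed

text \<open>
  Precomposition with coercion along \<open>q\<close> is injective on functions: by path induction on \<open>q\<close>, as
  precomposition with the identity does not change a function, by the \<open>\<eta>\<close>-rule.
\<close>

lemma precomp_coe_inj:
  assumes A: "G |- A : Univ 0" and B: "G |- B : Univ 0" and X: "G |- X type" and q: "G |- q : Id (Univ 0) A B"
    and u: "G |- u : Pi B X\<up>1" and v: "G |- v : Pi B X\<up>1"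
    and uv: "G |- Lam A (App u\<up>1 (App (coe A B q)\<up>1 x0)) \<sim> Lam A (App v\<up>1 (App (coe A B q)\<up>1 x0)) : Pi A X\<up>1"
  shows "G |- u \<sim> v : Pi B X\<up>1"
proof -
  note [ty] = A A[THEN subst_has_type] El[OF A] El[OF subst_has_type[OF A]] X X[THEN subst_is_type] B El[OF B] El[OF subst_has_type[OF B]] q u v
  let ?P = "Pi (Pi x1 X\<up>3) (Pi (Pi x2 X\<up>4) (Pi (Id (Pi A\<up>4 X\<up>5)
     (Lam A\<up>4 (App x2 (App (coe A\<up>5 x4 x3) x0))) (Lam A\<up>4 (App x1 (App (coe A\<up>5 x4 x3) x0))))
     (Id (Pi x4 X\<lbrakk>sh6\<rbrakk>) x2 x1)))"
  let ?F = "\<lambda>w. Lam A\<up>3 (App w\<up>1 (App (coe A\<up>4 A\<up>4 (Refl A\<up>4)) x0))"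
  let ?\<Delta>' = "Pi A\<up>1 X\<up>2 # Pi A X\<up>1 # G"
  let ?\<Delta> = "Id (Pi A\<up>2 X\<up>3) (Lam A\<up>2 (App x2 (App (coe A\<up>3 A\<up>3 (Refl A\<up>3)) x0)))
     (Lam A\<up>2 (App x1 (App (coe A\<up>3 A\<up>3 (Refl A\<up>3)) x0))) # ?\<Delta>'"
  have F: "?\<Delta> |- ?F w \<sim> w : Pi A\<up>3 X\<up>4" if [ty]: "?\<Delta> |- w : Pi A\<up>3 X\<up>4" for w
  proof -
    note [ty] = that[THEN subst_has_type]
    have "?\<Delta> |- Lam A\<up>3 (App w\<up>1 (App (coe A\<up>3\<up>1 A\<up>3\<up>1 (Refl A\<up>3\<up>1)) x0)) \<doteq> w : Pi A\<up>3 X\<up>3\<up>1"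
      by (rule precomp_coe_refl) (rule ty | simp)+
    then have e: "?\<Delta> |- ?F w \<doteq> w : Pi A\<up>3 X\<up>4" by simp
    show ?thesis by (rule path_eq[OF e]) (rule ty | simp)+
  qed
  have r: "?\<Delta> |- ?F x2 \<sim> ?F x1 : Pi A\<up>3 X\<up>4"
    by (rule pathI, rule inhI[of _ x0]) (rule ty | simp)+
  have "?\<Delta> |- x2 \<sim> ?F x2 : Pi A\<up>3 X\<up>4"
    by (rule path_sym, rule F) (rule ty | simp)+
  also note r
  also have "?\<Delta> |- ?F x1 \<sim> x1 : Pi A\<up>3 X\<up>4"
    by (rule F) (rule ty | simp)+
  finally have main: "?\<Delta> |= Id (Pi A\<up>3 X\<up>4) x2 x1" by (rule pathD)
  have P: "G |= ?P\<langle>q, B\<rangle>"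
  proof (rule path_induction_at[where A="Univ 0" and a=A])
    show "G |= ?P\<langle>Refl A, A\<rangle>"
      apply simp
      apply (intro inh_Lam)
         apply (rule main ty | simp)+
      done
  qed (rule ty | simp)+
  obtain r where r: "G |- r : Id (Pi A X\<up>1) (Lam A (App u\<up>1 (App (coe A B q)\<up>1 x0))) (Lam A (App v\<up>1 (App (coe A B q)\<up>1 x0)))"
    using uv inhE unfolding path_def by blast
  have 1: "G |= Pi (Pi B X\<up>1) (Pi (Id (Pi A\<up>1 X\<up>2) (Lam A\<up>1 (App u\<up>2 (App (coe A B q)\<up>2 x0))) (Lam A\<up>1 (App x1 (App (coe A B q)\<up>2 x0)))) (Id (Pi B\<up>2 X\<up>3) u\<up>2 x1))"
    by (rule inh_App[OF P[simplified] u[simplified]]) simp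
  have 2: "G |= Pi (Id (Pi A X\<up>1) (Lam A (App u\<up>1 (App (coe A B q)\<up>1 x0))) (Lam A (App v\<up>1 (App (coe A B q)\<up>1 x0)))) (Id (Pi B\<up>1 X\<up>2) u\<up>1 v\<up>1)"
    by (rule inh_App[OF 1 v]) simp
  have "G |= Id (Pi B X\<up>1) u v"
    by (rule inh_App[OF 2 r]) simp
  then show ?thesis by (intro pathI) (rule ty | simp)+
qed

text \<open>
  The type of all paths in \<open>B\<close>, with both ends free.
\<close>

definition paths :: "tm \<Rightarrow> tm" where "paths B = Sig B (Sig B\<up>1 (Id B\<up>2 x1 x0))"
definition triple :: "tm \<Rightarrow> tm \<Rightarrow> tm \<Rightarrow> tm" where "triple a b r = Pair a (Pair b r)"
definition src :: "tm \<Rightarrow> tm \<Rightarrow> tm" where "src B w = SigInd B\<up>1 x1 w"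
definition tgt :: "tm \<Rightarrow> tm \<Rightarrow> tm" where "tgt B w = SigInd B\<up>1 (SigInd B\<up>3 x1 x0) w"

lemma subst_paths [simp]: "(paths B)\<lbrakk>\<sigma>\<rbrakk> = paths B\<lbrakk>\<sigma>\<rbrakk>" "(triple a b r)\<lbrakk>\<sigma>\<rbrakk> = triple a\<lbrakk>\<sigma>\<rbrakk> b\<lbrakk>\<sigma>\<rbrakk> r\<lbrakk>\<sigma>\<rbrakk>"
  "(src B w)\<lbrakk>\<sigma>\<rbrakk> = src B\<lbrakk>\<sigma>\<rbrakk> w\<lbrakk>\<sigma>\<rbrakk>" "(tgt B w)\<lbrakk>\<sigma>\<rbrakk> = tgt B\<lbrakk>\<sigma>\<rbrakk> w\<lbrakk>\<sigma>\<rbrakk>"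
  by (simp_all add: paths_def triple_def src_def tgt_def)

lemma paths_univ [ty]: assumes B: "G |- B : Univ i" shows "G |- paths B : Univ i"
proof -
  note [ty] = B B[THEN subst_has_type] El[OF B] El[OF subst_has_type[OF B]]
  show ?thesis unfolding paths_def by (rule ty | simp)+
qed
lemmas El_paths [ty] = El[OF paths_univ]

lemma triple_typing [ty]:
  assumes a: "G |- a : B" and b: "G |- b : B" and r: "G |- r : Id B a b" and B: "G |- B type" and T: "T = paths B"
  shows "G |- triple a b r : T"
proof -
  note [ty] = B B[THEN subst_is_type] a b a[THEN subst_has_type] b[THEN subst_has_type] r
  show ?thesis unfolding triple_def T paths_def by (rule ty | simp)+
qed

lemma src_typing [ty]:
  assumes w: "G |- w : paths B" and B: "G |- B type" and T: "T = B"
  shows "G |- src B w : T"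
proof -
  note [ty] = B B[THEN subst_is_type]
  show ?thesis unfolding src_def T by (rule SigInd_typing[OF w[unfolded paths_def]]) (rule ty | simp)+
qed

lemma tgt_typing [ty]:
  assumes w: "G |- w : paths B" and B: "G |- B type" and T: "T = B"
  shows "G |- tgt B w : T"
proof -
  note [ty] = B B[THEN subst_is_type]
  show ?thesis unfolding tgt_def T by (rule SigInd_typing[OF w[unfolded paths_def]]) (rule ty | simp)+
qed

lemma src_triple_eq:
  assumes a: "G |- a : B" and b: "G |- b : B" and r: "G |- r : Id B a b" and B: "G |- B type"
  shows "G |- src B (triple a b r) \<doteq> a : B"
proof -
  note [ty] = B B[THEN subst_is_type] a b a[THEN subst_has_type] b[THEN subst_has_type] r
  show ?thesis unfolding src_def triple_def
    by (rule SigInd_Pair_eq[where A=B and B="Sig B\<up>1 (Id B\<up>2 x1 x0)"]) (rule ty | simp)+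
qed

lemma tgt_triple_eq:
  assumes a: "G |- a : B" and b: "G |- b : B" and r: "G |- r : Id B a b" and B: "G |- B type"
  shows "G |- tgt B (triple a b r) \<doteq> b : B"
proof -
  note [ty] = B B[THEN subst_is_type] a b a[THEN subst_has_type] b[THEN subst_has_type] r
  have "G |- tgt B (triple a b r) \<doteq> SigInd B\<up>1 x1 (Pair b r) : B"
    unfolding tgt_def triple_def
    by (rule SigInd_Pair_eq[where A=B and B="Sig B\<up>1 (Id B\<up>2 x1 x0)"]) (rule ty | simp)+
  also have "G |- SigInd B\<up>1 x1 (Pair b r) \<doteq> b : B"
    by (rule SigInd_Pair_eq[where A=B and B="Id B\<up>1 a\<up>1 x0"]) (rule ty | simp)+
  finally show ?thesis .
qed

text \<open>
  Every element of \<open>paths B\<close> is, by path induction, the constant path at a point.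
\<close>

lemma inh_paths:
  assumes B: "G |- B : Univ i" and C: "paths B # G |- C type" and r: "B # G |= C\<lbrakk>triple x0 x0 (Refl x0) \<cdot> sh1\<rbrakk>"
  shows "paths B # G |= C"
proof -
  note [ty] = El[OF B] El[OF subst_has_type[OF B]] B B[THEN subst_has_type] C C[THEN subst_is_type] C[unfolded paths_def]
  have "Id B\<up>2 x1 x0 # B\<up>1 # B # G |= C\<lbrakk>triple x2 x1 x0 \<cdot> sh3\<rbrakk>"
    by (rule inh_Id_cases) (rule ty | simp add: r)+
  then have 1: "Id B\<up>2 x1 x0 # B\<up>1 # B # G |= C\<lbrakk>Pair x2 (Pair x1 x0) \<cdot> sh3\<rbrakk>"
    by (simp add: triple_def)
  note [ty] = C[unfolded paths_def, THEN subst_is_type]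
  have 2: "Sig B\<up>1 (Id B\<up>2 x1 x0) # B # G |= C\<lbrakk>Pair x1 x0 \<cdot> sh2\<rbrakk>"
    by (rule inh_Sig) (rule ty | simp add: 1)+
  show ?thesis
    unfolding paths_def by (rule inh_Sig[OF _ _ _ 2]) (rule C[unfolded paths_def] ty | simp)+
qed

text \<open>
  The map \<open>B \<rightarrow> paths B\<close> to constant paths is an equivalence, hence up to a
  path it is a coercion, and precomposition with it is injective.  Both end point maps become the identity
  when precomposed with it, so they are equal as functions.  Composing them with
  \<open>x \<mapsto> (f x, g x, h x)\<close>, where \<open>h\<close> is the given homotopy, gives \<open>f = g\<close>.
\<close>

lemma funext:
  assumes A: "G |- A type" and B: "G |- B : Univ 0" and f: "G |- f : Pi A B\<up>1" and g: "G |- g : Pi A B\<up>1"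
    and fg: "A # G |= Id B\<up>1 (App f\<up>1 x0) (App g\<up>1 x0)"
  shows "G |- f \<sim> g : Pi A B\<up>1"
proof -
  note [ty] = A A[THEN subst_is_type] B B[THEN subst_has_type] El[OF B] El[OF subst_has_type[OF B]] f f[THEN subst_has_type] g g[THEN subst_has_type]
  let ?P = "paths B"
  let ?d = "triple x0 x0 (Refl x0)"
  have P1: "B # G |= Id B\<up>1 (src B\<up>1 ?d) x0"
    by (rule eq_inh_Id, rule src_triple_eq) (rule ty | simp)+
  have d: "B # G |= Id (paths B\<up>1) ?d\<lbrakk>src B\<up>1 ?d \<cdot> sh1\<rbrakk> ?d"
    by (rule id_ap[OF P1, where t="?d"]) (rule ty | simp)+
  have eq: "G |= isequiv B ?P (Lam B ?d)"
  proof (rule isequivI[where g="src B\<up>1 x0"])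
    show "B # G |= Id B\<up>1 (src B\<up>1 x0)\<lbrakk>?d \<cdot> sh1\<rbrakk> x0"
      using P1 by simp
    show "?P # G |= Id ?P\<up>1 ?d\<lbrakk>src B\<up>1 x0 \<cdot> sh1\<rbrakk> x0"
      by (rule inh_paths[OF B]) (rule ty | simp add: d[simplified])+
  qed (rule ty | simp)+
  have d_ty: "G |- Lam B ?d : Pi B ?P\<up>1" by (rule ty | simp)+
  obtain q where q: "G |- q : Id (Univ 0) B ?P" and coe_q: "G |- coe B ?P q \<sim> Lam B ?d : Pi B ?P\<up>1"
    by (rule ua[OF B paths_univ[OF B] d_ty eq])
  note [ty] = q q[THEN subst_has_type]
  have key: "G |- Lam B (App (Lam ?P t)\<up>1 (App (coe B ?P q)\<up>1 x0)) \<sim> Lam B x0 : Pi B B\<up>1"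
    if t: "?P # G |- t : B\<up>1" and td: "B # G |- t\<lbrakk>?d \<cdot> sh1\<rbrakk> \<doteq> x0 : B\<up>1" for t
  proof -
    note [ty] = t[THEN typing_eqI] t[THEN subst_has_type]
    have 1: "G |- Lam B (App (Lam ?P t)\<up>1 (App (coe B ?P q)\<up>1 x0)) \<sim> Lam B (App (Lam ?P t)\<up>1 (App (Lam B ?d)\<up>1 x0)) : Pi B B\<up>1"
      by (rule path_ap[OF coe_q, where t="Lam B\<up>1 (App (Lam ?P t)\<up>2 (App x1 x0))"]) (rule ty | simp)+
    have b: "B # G |- App (Lam B ?d)\<up>1 x0 \<doteq> ?d : ?P\<up>1"
      apply simp
      by (rule beta[where B="?P\<up>2"]) (rule ty | simp)+
    have "B # G |- App (Lam ?P t)\<up>1 (App (Lam B ?d)\<up>1 x0) \<doteq> App (Lam ?P t)\<up>1 ?d : B\<up>1"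
      by (rule App_cong_right[OF b, where B="B\<up>2"]) (rule ty | simp)+
    also have "B # G |- App (Lam ?P t)\<up>1 ?d \<doteq> t\<lbrakk>?d \<cdot> sh1\<rbrakk> : B\<up>1"
      apply simp
      by (rule beta[where B="B\<up>2"]) (rule ty | simp)+
    also note td
    finally have "G |- Lam B (App (Lam ?P t)\<up>1 (App (Lam B ?d)\<up>1 x0)) \<doteq> Lam B x0 : Pi B B\<up>1"
      by (rule Lam_cong) (rule ty)
    then have "G |- Lam B (App (Lam ?P t)\<up>1 (App (Lam B ?d)\<up>1 x0)) \<sim> Lam B x0 : Pi B B\<up>1"
      by (rule path_eq) (rule ty | simp)+
    with 1 show ?thesis by (rule path_trans)
  qed
  let ?s = "src B\<up>1 x0" and ?t = "tgt B\<up>1 x0"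
  have ks: "G |- Lam B (App (Lam ?P ?s)\<up>1 (App (coe B ?P q)\<up>1 x0)) \<sim> Lam B x0 : Pi B B\<up>1"
    by (rule key) (rule ty src_triple_eq | simp)+
  have kt: "G |- Lam B (App (Lam ?P ?t)\<up>1 (App (coe B ?P q)\<up>1 x0)) \<sim> Lam B x0 : Pi B B\<up>1"
    by (rule key) (rule ty tgt_triple_eq | simp)+
  have st: "G |- Lam ?P ?s \<sim> Lam ?P ?t : Pi ?P B\<up>1"
    by (rule precomp_coe_inj[OF _ _ _ _ _ _ path_trans[OF ks path_sym[OF kt]]]) (rule ty | simp)+
  obtain h where h: "A # G |- h : Id B\<up>1 (App f\<up>1 x0) (App g\<up>1 x0)" using fg by (rule inhE)
  note [ty] = h[THEN subst_has_type] h[THEN typing_eqI]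
  let ?e = "triple (App f\<up>1 x0) (App g\<up>1 x0) h"
  have ap: "G |- Lam A (App (Lam ?P ?s)\<up>1 ?e) \<sim> Lam A (App (Lam ?P ?t)\<up>1 ?e) : Pi A B\<up>1"
    by (rule path_ap[OF st, where t="Lam A\<up>1 (App x1 ?e\<lbrakk>x0 \<cdot> sh2\<rbrakk>)"]) (rule ty | simp)+
  have fin: "G |- Lam A (App (Lam ?P t)\<up>1 ?e) \<sim> k : Pi A B\<up>1"
    if t: "?P # G |- t : B\<up>1" and te: "A # G |- t\<lbrakk>?e \<cdot> sh1\<rbrakk> \<doteq> App k\<up>1 x0 : B\<up>1" and k: "G |- k : Pi A B\<up>1" for t k
  proof -
    note [ty] = t[THEN typing_eqI] t[THEN subst_has_type]
    have "A # G |- App (Lam ?P t)\<up>1 ?e \<doteq> t\<lbrakk>?e \<cdot> sh1\<rbrakk> : B\<up>1"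
      apply simp
      by (rule beta[where B="B\<up>2"]) (rule ty | simp)+
    also note te
    finally have "G |- Lam A (App (Lam ?P t)\<up>1 ?e) \<doteq> Lam A (App k\<up>1 x0) : Pi A B\<up>1"
      by (rule Lam_cong) (rule ty)
    also note eta[OF k]
    finally show ?thesis by (rule path_eq) (rule ty k | simp)+
  qed
  have fs: "G |- Lam A (App (Lam ?P ?s)\<up>1 ?e) \<sim> f : Pi A B\<up>1"
    by (rule fin) (rule ty src_triple_eq | simp)+
  have gt: "G |- Lam A (App (Lam ?P ?t)\<up>1 ?e) \<sim> g : Pi A B\<up>1"
    by (rule fin) (rule ty tgt_triple_eq | simp)+
  show ?thesis by (rule path_trans[OF path_sym[OF fs] path_trans[OF ap gt]])
qed

section \<open>Recursion from the circle into a universe\<close>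

lemma S1Ind_typing [ty]:
  "S1 # G |- C type \<Longrightarrow> G |- b : C\<langle>Base\<rangle> \<Longrightarrow> G |- l : Id C\<langle>Base\<rangle> (transport C Base Base Loop b) b \<Longrightarrow>
   G |- x : S1 \<Longrightarrow> T = C\<langle>x\<rangle> \<Longrightarrow> G |- S1Ind C b l x : T"
  unfolding has_type_def using S1_elim[of G C _ b l x] base_types(4)[of G] by (auto simp: is_type_def ctx_Cons)
lemma S1Ind_Base_eq:
  "S1 # G |- C type \<Longrightarrow> G |- b : C\<langle>Base\<rangle> \<Longrightarrow> G |- l : Id C\<langle>Base\<rangle> (transport C Base Base Loop b) b \<Longrightarrow>
   T = C\<langle>Base\<rangle> \<Longrightarrow> G |- S1Ind C b l Base \<doteq> b : T"
  unfolding has_type_def eq_term_def using S1_comp_base[of G C _ b l] base_types(4)[of G] by (auto simp: is_type_def ctx_Cons)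
lemma inh_S1Comp:
  "S1 # G |- C type \<Longrightarrow> G |- b : C\<langle>Base\<rangle> \<Longrightarrow> G |- l : Id C\<langle>Base\<rangle> (transport C Base Base Loop b) b \<Longrightarrow>
   G |= Id (Id C\<langle>Base\<rangle> (transport C Base Base Loop b) b)
      (apd C (Lam S1 (S1Ind C\<lbrakk>x0 \<cdot> sh2\<rbrakk> b\<up>1 l\<up>1 x0)) Base Base Loop) l"
  unfolding has_type_def inh_def using S1_comp_loop[of G C _ b l] base_types(4)[of G] by (auto simp: is_type_def ctx_Cons)

lemma apd_sig: "apd C f a b p = IdInd (Id C\<lbrakk>x1 \<cdot> sh3\<rbrakk> (transport C\<lbrakk>x0 \<cdot> sh4\<rbrakk> x2 x1 x0 (App f\<up>3 x2)) (App f\<up>3 x1))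
    (Refl (App f\<up>1 x0)) a b p"
  by (simp add: apd_def)

lemma subst_apd [simp]: "(apd C f a b p)\<lbrakk>\<sigma>\<rbrakk> = apd C\<lbrakk>up \<sigma>\<rbrakk> f\<lbrakk>\<sigma>\<rbrakk> a\<lbrakk>\<sigma>\<rbrakk> b\<lbrakk>\<sigma>\<rbrakk> p\<lbrakk>\<sigma>\<rbrakk>"
  by (simp add: apd_sig)

text \<open>
  The transport along \<open>refl\<close> in the type of \<open>apd\<close> is removed by conversion.
\<close>

lemma apd_branch:
  assumes A: "G |- A type" and C: "A # G |- C type" and f: "G |- f : Pi A C"
  shows "A # G |- Refl (App f\<up>1 x0) : Id C (transport C\<lbrakk>x0 \<cdot> sh2\<rbrakk> x0 x0 (Refl x0) (App f\<up>1 x0)) (App f\<up>1 x0)"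
proof -
  note [ty] = A A[THEN subst_is_type] C C[THEN subst_is_type] f f[THEN subst_has_type]
  have e: "A # G |- transport C\<lbrakk>x0 \<cdot> sh2\<rbrakk> x0 x0 (Refl x0) (App f\<up>1 x0) \<doteq> App f\<up>1 x0 : C"
    by (rule transport_Refl_eq[where A="A\<up>1"]) (rule ty | simp)+
  show ?thesis
    by (rule inst_conv_typing[OF eq_term_sym[OF e], where B="Id C\<up>1 x0 (App f\<up>2 x1)"]) (rule ty | simp)+
qed

lemma apd_typing [ty]:
  assumes p: "G |- p : Id A a b" and f: "G |- f : Pi A C" and A: "G |- A type" and C: "A # G |- C type" 
   and a: "G |- a : A" and b: "G |- b : A" and T: "T = Id C\<langle>b\<rangle> (transport C a b p (App f a)) (App f b)"
  shows "G |- apd C f a b p : T"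
proof -
  note [ty] = A A[THEN subst_is_type] C C[THEN subst_is_type] f f[THEN subst_has_type] a b p
  show ?thesis unfolding apd_sig T
    by (rule IdInd_typing[where A=A]) (rule apd_branch[OF A C f, THEN typing_eqI] ty | simp)+
qed

lemma apd_Refl_eq:
  assumes f: "G |- f : Pi A C" and A: "G |- A type" and C: "A # G |- C type" and a: "G |- a : A" 
  shows "G |- apd C f a a (Refl a) \<doteq> Refl (App f a) : Id C\<langle>a\<rangle> (transport C a a (Refl a) (App f a)) (App f a)"
proof -
  note [ty] = A A[THEN subst_is_type] C C[THEN subst_is_type] f f[THEN subst_has_type] a 
  show ?thesis unfolding apd_sig 
    by (rule IdInd_Refl_eq[where A=A]) (rule apd_branch[OF A C f, THEN typing_eqI] ty | simp)+
qed

text \<open>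
  The path from the transport of \<open>X\<close> in a constant family back to \<open>X\<close>.  It is needed because the
  eliminator of the circle also expects a transport when its family is constant.
\<close>

definition cst :: "tm \<Rightarrow> tm \<Rightarrow> tm \<Rightarrow> tm \<Rightarrow> tm" where
  "cst X a b p = IdInd (Id (Univ 0) (transport (Univ 0) x2 x1 x0 X\<up>3) X\<up>3) (Refl X\<up>1) a b p"

lemma subst_cst [simp]: "(cst X a b p)\<lbrakk>\<sigma>\<rbrakk> = cst X\<lbrakk>\<sigma>\<rbrakk> a\<lbrakk>\<sigma>\<rbrakk> b\<lbrakk>\<sigma>\<rbrakk> p\<lbrakk>\<sigma>\<rbrakk>"
  by (simp add: cst_def)

lemma cst_branch:
  assumes A: "G |- A type" and X: "G |- X : Univ 0"
  shows "A # G |- Refl X\<up>1 : Id (Univ 0) (transport (Univ 0) x0 x0 (Refl x0) X\<up>1) X\<up>1"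
proof -
  note [ty] = A A[THEN subst_is_type] X X[THEN subst_has_type]
  have e: "A # G |- transport (Univ 0) x0 x0 (Refl x0) X\<up>1 \<doteq> X\<up>1 : Univ 0"
    by (rule transport_Refl_eq[where A="A\<up>1"]) (rule ty | simp)+
  show ?thesis
    by (rule inst_conv_typing[OF eq_term_sym[OF e], where B="Id (Univ 0) x0 X\<up>2"]) (rule ty | simp)+
qed

lemma cst_typing [ty]:
  assumes p: "G |- p : Id A a b" and A: "G |- A type" and a: "G |- a : A" and b: "G |- b : A" and X: "G |- X : Univ 0"
   and T: "T = Id (Univ 0) (transport (Univ 0) a b p X) X"
  shows "G |- cst X a b p : T"
proof -
  note [ty] = A A[THEN subst_is_type] X X[THEN subst_has_type] a b p
  show ?thesis unfolding cst_def T
    by (rule IdInd_typing[where A=A]) (rule cst_branch[OF A X, THEN typing_eqI] ty | simp)+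
qed

lemma cst_Refl_eq:
  assumes A: "G |- A type" and a: "G |- a : A" and X: "G |- X : Univ 0"
  shows "G |- cst X a a (Refl a) \<doteq> Refl X : Id (Univ 0) (transport (Univ 0) a a (Refl a) X) X"
proof -
  note [ty] = A A[THEN subst_is_type] X X[THEN subst_has_type] a
  show ?thesis unfolding cst_def
    by (rule IdInd_Refl_eq[where A=A]) (rule cst_branch[OF A X, THEN typing_eqI] ty | simp)+
qed

lemma trans_refl_left:
  assumes Z: "G |- Z : A" and Y: "G |- Y : A" and q: "G |- q : Id A Z Y" and A: "G |- A type"
  shows "G |- transport (Id A\<up>1 Z\<up>1 x0) Z Y q (Refl Z) \<sim> q : Id A Z Y"
proof -
  note [ty] = Z Z[THEN subst_has_type] Y q A A[THEN subst_is_type]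
  let ?P = "Id (Id A\<up>2 Z\<up>2 x1) (transport (Id A\<up>3 Z\<up>3 x0) Z\<up>2 x1 x0 (Refl Z\<up>2)) x0"
  have r: "G |= Id (Id A Z Z) (transport (Id A\<up>1 Z\<up>1 x0) Z Z (Refl Z) (Refl Z)) (Refl Z)"
    by (rule eq_inh_Id, rule transport_Refl_eq[where A=A]) (rule ty | simp)+
  have "G |= ?P\<langle>q, Y\<rangle>"
    by (rule path_induction_at[OF A Z]) (rule ty | simp add: r)+
  then show ?thesis by (intro pathI) (rule ty | simp)+
qed

text \<open>
  If composing \<open>c\<close> with \<open>q\<close> gives \<open>c\<close> again, then \<open>q\<close> is trivial.  By path induction
  on \<open>c\<close>; for \<open>refl\<close> the composite is \<open>q\<close> itself.
\<close>

lemma trans_cancel: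
  assumes A: "G |- A type" and Z: "G |- Z : A" and Y: "G |- Y : A" and c: "G |- c : Id A Z Y" and q: "G |- q : Id A Y Y"
    and r: "G |= Id (Id A Z Y) c (transport (Id A\<up>1 Z\<up>1 x0) Y Y q c)"
  shows "G |- q \<sim> Refl Y : Id A Y Y"
proof -
  note [ty] = Z Z[THEN subst_has_type] Y c q A A[THEN subst_is_type]
  let ?P = "Pi (Id A\<up>2 x1 x1) (Pi (Id (Id A\<up>3 Z\<up>3 x2) x1 (transport (Id A\<up>4 Z\<up>4 x0) x2 x2 x0 x1)) (Id (Id A\<up>4 x3 x3) x1 (Refl x3)))"
  let ?\<Delta> = "Id (Id A\<up>1 Z\<up>1 Z\<up>1) (Refl Z\<up>1) (transport (Id A\<up>2 Z\<up>2 x0) Z\<up>1 Z\<up>1 x0 (Refl Z\<up>1)) # Id A Z Z # G"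
  have 1: "?\<Delta> |- Refl Z\<up>2 \<sim> transport (Id A\<up>3 Z\<up>3 x0) Z\<up>2 Z\<up>2 x1 (Refl Z\<up>2) : Id A\<up>2 Z\<up>2 Z\<up>2"
    by (rule pathI, rule inhI[of _ x0]) (rule ty | simp)+
  have "?\<Delta> |- transport (Id A\<up>2\<up>1 Z\<up>2\<up>1 x0) Z\<up>2 Z\<up>2 x1 (Refl Z\<up>2) \<sim> x1 : Id A\<up>2 Z\<up>2 Z\<up>2"
    by (rule trans_refl_left) (rule ty | simp)+
  then have 2: "?\<Delta> |- transport (Id A\<up>3 Z\<up>3 x0) Z\<up>2 Z\<up>2 x1 (Refl Z\<up>2) \<sim> x1 : Id A\<up>2 Z\<up>2 Z\<up>2"
    by simp
  have 3: "?\<Delta> |= Id (Id A\<up>2 Z\<up>2 Z\<up>2) x1 (Refl Z\<up>2)"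
    by (rule pathD[OF path_sym[OF path_trans[OF 1 2]]])
  have P: "G |= ?P\<langle>c, Y\<rangle>"
  proof (rule path_induction_at[OF A Z])
    show "G |= ?P\<langle>Refl Z, Z\<rangle>"
      apply simp
      apply (rule inh_Lam)
       apply (rule ty)+
      apply (rule inh_Lam)
       apply (rule 3 ty | simp)+
      done
  qed (rule ty | simp)+
  obtain r' where r': "G |- r' : Id (Id A Z Y) c (transport (Id A\<up>1 Z\<up>1 x0) Y Y q c)" using r by (rule inhE)
  have 4: "G |= Pi (Id (Id A Z Y) c (transport (Id A\<up>1 Z\<up>1 x0) Y Y q c)) (Id (Id A\<up>1 Y\<up>1 Y\<up>1) q\<up>1 (Refl Y\<up>1))"
    by (rule inh_App[OF P[simplified] q]) simp
  have "G |= Id (Id A Y Y) q (Refl Y)"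
    by (rule inh_App[OF 4 r']) simp
  then show ?thesis by (intro pathI) (rule ty | simp)+
qed

lemma beta3:
  assumes A: "G |- A type" and B: "A # G |- B type" and D: "B # A # G |- D type" and t: "D # B # A # G |- t : C"
    and a: "G |- a : A" and b: "G |- b : B\<langle>a\<rangle>" and d: "G |- d : D\<langle>b, a\<rangle>"
  shows "G |- App (App (App (Lam A (Lam B (Lam D t))) a) b) d \<doteq> t\<lbrakk>d \<cdot> b \<cdot> a \<cdot> sh0\<rbrakk> : C\<lbrakk>d \<cdot> b \<cdot> a \<cdot> sh0\<rbrakk>"
proof -
  note [ty] = A B D A[THEN subst_is_type] B[THEN subst_is_type] D[THEN subst_is_type] t t[THEN subst_has_type] a b d
    a[THEN subst_has_type] b[THEN subst_has_type]
  have "G |- App (App (Lam A (Lam B (Lam D t))) a) b \<doteq> Lam D\<langle>b, a\<rangle> t\<lbrakk>x0 \<cdot> b\<up>1 \<cdot> a\<up>1 \<cdot> sh1\<rbrakk> : Pi D\<langle>b, a\<rangle> C\<lbrakk>x0 \<cdot> b\<up>1 \<cdot> a\<up>1 \<cdot> sh1\<rbrakk>"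
    by (rule beta2[where C="Pi D C" and B=B]) (rule ty | simp)+
  then have "G |- App (App (App (Lam A (Lam B (Lam D t))) a) b) d \<doteq> App (Lam D\<langle>b, a\<rangle> t\<lbrakk>x0 \<cdot> b\<up>1 \<cdot> a\<up>1 \<cdot> sh1\<rbrakk>) d : C\<lbrakk>d \<cdot> b \<cdot> a \<cdot> sh0\<rbrakk>"
    by (rule App_cong_left) (rule d | simp)+
  also have "G |- App (Lam D\<langle>b, a\<rangle> t\<lbrakk>x0 \<cdot> b\<up>1 \<cdot> a\<up>1 \<cdot> sh1\<rbrakk>) d \<doteq> t\<lbrakk>d \<cdot> b \<cdot> a \<cdot> sh0\<rbrakk> : C\<lbrakk>d \<cdot> b \<cdot> a \<cdot> sh0\<rbrakk>"
    by (rule beta[where B="C\<lbrakk>x0 \<cdot> b\<up>1 \<cdot> a\<up>1 \<cdot> sh1\<rbrakk>"]) (rule ty | simp)+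
  finally show ?thesis .
qed

text \<open>
  Replacing \<open>a\<close> by an equal term while \<open>b\<close> and \<open>d\<close>, whose types depend on \<open>a\<close>, stay fixed.  The one-variable
  rule does not apply, since \<open>b\<close> need not be typable over a variable in place of \<open>a\<close>; abstraction over all
  three variables is used instead.
\<close>

lemma inh_subst_eq3:
  assumes A: "G |- A type" and B: "A # G |- B type" and D: "B # A # G |- D type" and C: "D # B # A # G |- C type"
    and a: "G |- a : A" and a': "G |- a' : A" and e: "G |- a \<doteq> a' : A"
    and b: "G |- b : B\<langle>a\<rangle>" "G |- b : B\<langle>a'\<rangle>" and d: "G |- d : D\<langle>b, a\<rangle>" "G |- d : D\<langle>b, a'\<rangle>"
    and i: "G |= C\<lbrakk>d \<cdot> b \<cdot> a \<cdot> sh0\<rbrakk>"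
  shows "G |= C\<lbrakk>d \<cdot> b \<cdot> a' \<cdot> sh0\<rbrakk>"
proof (cases "\<turnstile> G ctx")
  case True
  then have "\<turnstile> D # B # A # G ctx" using A B D is_type_ctx by blast
  then obtain i where C': "D # B # A # G |- C : Univ i" using C by (auto simp: guarded_defs)
  let ?K = "Lam A (Lam B (Lam D C))"
  have "G |- C\<lbrakk>d \<cdot> b \<cdot> a \<cdot> sh0\<rbrakk> \<doteq> App (App (App ?K a) b) d : Univ i"
    using eq_term_sym[OF beta3[OF A B D C' a b(1) d(1)]] by simp
  also have "G |- App ?K a \<doteq> App ?K a' : Pi B\<langle>a\<rangle> (Pi D\<lbrakk>x0 \<cdot> a\<up>1 \<cdot> sh1\<rbrakk> (Univ i))"
    by (rule App_cong_right[OF e, where B="Pi B (Pi D (Univ i))"]) (rule Lam_typing A B D C' | simp)+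
  then have "G |- App (App ?K a) b \<doteq> App (App ?K a') b : Pi D\<langle>b, a\<rangle> (Univ i)"
    by (rule App_cong_left) (rule b | simp)+
  then have "G |- App (App (App ?K a) b) d \<doteq> App (App (App ?K a') b) d : Univ i"
    by (rule App_cong_left) (rule d | simp)+
  also have "G |- App (App (App ?K a') b) d \<doteq> C\<lbrakk>d \<cdot> b \<cdot> a' \<cdot> sh0\<rbrakk> : Univ i"
    using beta3[OF A B D C' a' b(2) d(2)] by simp
  finally show ?thesis using inh_conv[OF i eq_type_El] by blast
qed (simp add: guarded_defs)

text \<open>
  For \<open>refl\<close>, both \<open>apd\<close> and \<open>cst\<close> are judgmentally \<open>refl\<close>, so the hypothesis says that composing \<open>cst\<close> with
  \<open>q\<close> gives \<open>cst\<close> again.  By cancellation \<open>q\<close> is trivial, and both sides are \<open>u\<close>.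
\<close>

lemma transport_family_refl:
  assumes F: "G |- F : Pi S1 (Univ 0)" 
    and q: "G |- q : Id (Univ 0) (App F Base) (App F Base)" and u: "G |- u : App F Base"
    and r: "G |= Id (Id (Univ 0) (transport (Univ 0) Base Base (Refl Base) (App F Base)) (App F Base)) (apd (Univ 0) F Base Base (Refl Base))
       (transport (Id (Univ 0) (transport (Univ 0) Base Base (Refl Base) (App F Base))\<up>1 x0) (App F Base) (App F Base) q (cst (App F Base) Base Base (Refl Base)))"
  shows "G |= Id (App F Base) (transport (App F\<up>1 x0) Base Base (Refl Base) u) (App (coe (App F Base) (App F Base) q) u)"
proof -
  note [ty] = F F[THEN subst_has_type] q u u[THEN subst_has_type]
  let ?FB = "App F Base"
  let ?T = "transport (Univ 0) Base Base (Refl Base) ?FB"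
  let ?I = "Id (Univ 0) ?T ?FB" and ?a = "apd (Univ 0) F Base Base (Refl Base)" and ?c = "cst ?FB Base Base (Refl Base)"
  have "G |- ?a \<doteq> Refl ?FB : Id (Univ 0)\<langle>Base\<rangle> ?T ?FB"
    by (rule apd_Refl_eq[where A=S1]) (rule ty | simp)+
  then have "G |- ?a \<doteq> Refl ?FB : ?I" by simp
  also have "G |- Refl ?FB \<doteq> ?c : ?I"
    by (rule eq_term_sym, rule cst_Refl_eq[where A=S1]) (rule ty | simp)+
  finally have "G |- ?a \<sim> ?c : ?I" by (rule path_eq) (rule ty | simp)+
  from path_sym[OF this] have 1: "G |- ?c \<sim> ?a : ?I" .
  have 2: "G |- ?a \<sim> transport (Id (Univ 0) ?T\<up>1 x0) ?FB ?FB q ?c : ?I"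
    by (rule pathI[OF r]) (rule ty | simp)+
  have 3: "G |- q \<sim> Refl ?FB : Id (Univ 0) ?FB ?FB"
    by (rule trans_cancel[where Z="?T" and c="?c"]) (rule ty | simp add: pathD[OF path_trans[OF 1 2], simplified])+
  have 4: "G |- App (coe ?FB ?FB q) u \<sim> App (coe ?FB ?FB (Refl ?FB)) u : ?FB"
    by (rule path_ap[OF 3, where t="App (coe (App F\<up>1 Base) (App F\<up>1 Base) x0) u\<up>1"]) (rule ty | simp)+
  have "G |- App (coe ?FB ?FB (Refl ?FB)) u \<doteq> App (Lam ?FB x0) u : ?FB"
    by (rule App_cong_left[OF coe_Refl_eq]) (rule ty | simp)+
  also have "G |- App (Lam ?FB x0) u \<doteq> u : ?FB"
    by (rule beta[where B="?FB\<up>1"]) (rule ty | simp)+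
  also have "G |- u \<doteq> transport (App F\<up>1 x0) Base Base (Refl Base) u : ?FB"
    by (rule eq_term_sym, rule transport_Refl_eq[where A=S1]) (rule ty | simp)+
  finally have 5: "G |- App (coe ?FB ?FB (Refl ?FB)) u \<sim> transport (App F\<up>1 x0) Base Base (Refl Base) u : ?FB"
    by (rule path_eq) (rule ty | simp)+
  show ?thesis by (rule pathD[OF path_sym[OF path_trans[OF 4 5]]])
qed

text \<open>
  If the action of \<open>F\<close> on \<open>p\<close> is the path \<open>q\<close> between types, then transport in the family \<open>F\<close> along \<open>p\<close> is
  coercion along \<open>q\<close>.  The action is given by \<open>apd\<close>, as it appears in the computation rule
  for the circle, and \<open>cst\<close> accounts for the transport in its type.  The proof is by path induction on \<open>p\<close>, for
  all \<open>q\<close> and all \<open>u\<close> at once.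
\<close>

lemma transport_family:
  assumes F: "G |- F : Pi S1 (Univ 0)" and p: "G |- p : Id S1 Base Base"
    and q: "G |- q : Id (Univ 0) (App F Base) (App F Base)"
    and r: "G |= Id (Id (Univ 0) (transport (Univ 0) Base Base p (App F Base)) (App F Base)) (apd (Univ 0) F Base Base p)
       (transport (Id (Univ 0) (transport (Univ 0) Base Base p (App F Base))\<up>1 x0) (App F Base) (App F Base) q (cst (App F Base) Base Base p))"
  shows "App F Base # G |= Id (App F\<up>1 Base) (transport (App F\<up>2 x0) Base Base p\<up>1 x0) (App (coe (App F\<up>1 Base) (App F\<up>1 Base) q\<up>1) x0)"
proof -
  note [ty] = F F[THEN subst_has_type] p q
  let ?P = "Pi (Id (Univ 0) (App F\<up>2 Base) (App F\<up>2 x1))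
    (Pi (Id (Id (Univ 0) (transport (Univ 0) Base x2 x1 (App F\<up>3 Base)) (App F\<up>3 x2)) (apd (Univ 0) F\<up>3 Base x2 x1)
        (transport (Id (Univ 0) (transport (Univ 0) Base x3 x2 (App F\<up>4 Base)) x0) (App F\<up>3 Base) (App F\<up>3 x2) x0 (cst (App F\<up>3 Base) Base x2 x1)))
      (Pi (App F\<up>4 Base) (Id (App F\<up>5 x4) (transport (App F\<lbrakk>sh6\<rbrakk> x0) Base x4 x3 x0) (App (coe (App F\<up>5 Base) (App F\<up>5 x4) x2) x0))))"
  have "G |= ?P\<langle>p, Base\<rangle>"
  proof (rule path_induction_at[where A=S1 and a=Base])
    let ?R = "Id (Id (Univ 0) (transport (Univ 0) Base Base (Refl Base) (App F\<up>1 Base)) (App F\<up>1 Base)) (apd (Univ 0) F\<up>1 Base Base (Refl Base))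
        (transport (Id (Univ 0) (transport (Univ 0) Base Base (Refl Base) (App F\<up>2 Base)) x0) (App F\<up>1 Base) (App F\<up>1 Base) x0 (cst (App F\<up>1 Base) Base Base (Refl Base)))"
    let ?\<Delta> = "App F\<up>2 Base # ?R # Id (Univ 0) (App F Base) (App F Base) # G"
    have r: "?\<Delta> |= ?R\<up>2"
      by (rule inhI[of _ x1]) (rule ty | simp)+
    have "?\<Delta> |= Id (App F\<up>3 Base) (transport (App F\<up>3\<up>1 x0) Base Base (Refl Base) x0) (App (coe (App F\<up>3 Base) (App F\<up>3 Base) x2) x0)"
      by (rule transport_family_refl) (rule ty | simp add: r[simplified])+
    then have main: "?\<Delta> |= Id (App F\<up>3 Base) (transport (App F\<up>4 x0) Base Base (Refl Base) x0) (App (coe (App F\<up>3 Base) (App F\<up>3 Base) x2) x0)"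
      by simp
    show "G |= ?P\<langle>Refl Base, Base\<rangle>"
      apply simp
      apply (intro inh_Lam)
         apply (rule main ty | simp)+
      done
  qed (rule ty | simp)+
  obtain r' where r': "G |- r' : Id (Id (Univ 0) (transport (Univ 0) Base Base p (App F Base)) (App F Base)) (apd (Univ 0) F Base Base p)
       (transport (Id (Univ 0) (transport (Univ 0) Base Base p (App F Base))\<up>1 x0) (App F Base) (App F Base) q (cst (App F Base) Base Base p))" using r by (rule inhE)
  have 1: "G |= Pi (Id (Id (Univ 0) (transport (Univ 0) Base Base p (App F Base)) (App F Base)) (apd (Univ 0) F Base Base p)
       (transport (Id (Univ 0) (transport (Univ 0) Base Base p (App F Base))\<up>1 x0) (App F Base) (App F Base) q (cst (App F Base) Base Base p)))
      (Pi (App F\<up>1 Base) (Id (App F\<up>2 Base) (transport (App F\<up>3 x0) Base Base p\<up>2 x0) (App (coe (App F\<up>2 Base) (App F\<up>2 Base) q\<up>2) x0)))"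
    by (rule inh_App[OF \<open>G |= ?P\<langle>p, Base\<rangle>\<close>[simplified] q]) simp
  have "G |= Pi (App F Base) (Id (App F\<up>1 Base) (transport (App F\<up>2 x0) Base Base p\<up>1 x0) (App (coe (App F\<up>1 Base) (App F\<up>1 Base) q\<up>1) x0))"
    by (rule inh_App[OF 1 r']) simp
  then show ?thesis by (rule inh_unLam)
qed

text \<open>
  A type \<open>X\<close> with a path \<open>q : X = X\<close> defines a family over the circle.  \<open>F Base\<close> is judgmentally but not
  syntactically \<open>X\<close>, so the facts obtained over \<open>F Base\<close> are moved to \<open>X\<close> at the end.
\<close>

lemma S1_rec_type:
  assumes X: "G |- X : Univ 0" and q: "G |- q : Id (Univ 0) X X"
  obtains F where "G |- F : Pi S1 (Univ 0)" "G |- App F Base \<doteq> X : Univ 0"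
    "X # G |= Id X\<up>1 (transport (App F\<up>2 x0) Base Base Loop x0) (App (coe X X q)\<up>1 x0)"
proof -
  note [ty] = X X[THEN subst_has_type] El[OF X] El[OF subst_has_type[OF X]] q q[THEN subst_has_type]
  let ?T = "transport (Univ 0) Base Base Loop X"
  \<comment> \<open>the eliminator asks for a path from the transport of \<open>X\<close> to \<open>X\<close>: \<open>cst\<close> followed by \<open>q\<close>\<close>
  define l where "l = transport (Id (Univ 0) ?T\<up>1 x0) X X q (cst X Base Base Loop)"
  have l: "G |- l : Id (Univ 0) ?T X" unfolding l_def by (rule ty | simp)+
  note [ty] = l[THEN typing_eqI] l[THEN subst_has_type]
  define F where "F = Lam S1 (S1Ind (Univ 0) X\<up>1 l\<up>1 x0)"
  have F: "G |- F : Pi S1 (Univ 0)" unfolding F_def by (rule ty | simp)+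
  note [ty] = F F[THEN subst_has_type]
  let ?FB = "App F Base" and ?a = "apd (Univ 0) F Base Base Loop"
  have "G |- ?FB \<doteq> S1Ind (Univ 0) X l Base : Univ 0"
    unfolding F_def by (rule beta[where B="Univ 0"]) (rule ty | simp)+
  also have "G |- S1Ind (Univ 0) X l Base \<doteq> X : Univ 0"
    by (rule S1Ind_Base_eq) (rule ty | simp)+
  finally have FB: "G |- ?FB \<doteq> X : Univ 0" .
  have q': "G |- q : Id (Univ 0) ?FB ?FB"
    by (rule inst_conv_typing[OF eq_term_sym[OF FB], where B="Id (Univ 0) x0 x0"]) (rule ty | simp)+
  have a': "G |- ?a : Id (Univ 0) ?T X"
    by (rule inst_conv_typing[OF FB, where B="Id (Univ 0) (transport (Univ 0) Base Base Loop x0) x0"]) (rule ty | simp)+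
  have comp: "G |= Id (Id (Univ 0) ?T X) ?a l"
    using inh_S1Comp[of G "Univ 0" X l] l X by (simp add: Univ_type F_def)
  let ?R = "Id (Id (Univ 0) (transport (Univ 0) Base Base Loop x2) x2) x0 
     (transport (Id (Univ 0) (transport (Univ 0) Base Base Loop x3) x0) x2 x2 x1 (cst x2 Base Base Loop))"
  let ?B = "Id (Univ 0) x0 x0" and ?D = "Id (Univ 0) (transport (Univ 0) Base Base Loop x1) x1"
  have qB: "G |- q : ?B\<langle>X\<rangle>" "G |- q : ?B\<langle>?FB\<rangle>" using q q' by simp_all
  have aD: "G |- ?a : ?D\<langle>q, X\<rangle>" "G |- ?a : ?D\<langle>q, ?FB\<rangle>"
    using a' apply simp
    by (rule ty | simp)+
  have "G |= ?R\<lbrakk>?a \<cdot> q \<cdot> ?FB \<cdot> sh0\<rbrakk>"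
    by (rule inh_subst_eq3[OF _ _ _ _ _ _ eq_term_sym[OF FB] qB aD])
       (rule ty | simp add: comp[unfolded l_def, simplified])+
  then have tf: "?FB # G |= Id (App F\<up>1 Base) (transport (App F\<up>2 x0) Base Base Loop\<up>1 x0) (App (coe (App F\<up>1 Base) (App F\<up>1 Base) q\<up>1) x0)"
    by (intro transport_family[OF F _ q']) (simp_all add: ty)
  \<comment> \<open>the transport function as a closed abstraction can be retyped from \<open>F Base\<close> to \<open>X\<close> as a whole\<close>
  define t where "t = Lam ?FB (transport (App F\<up>2 x0) Base Base Loop x0)"
  have t: "G |- t : Pi ?FB ?FB\<up>1" unfolding t_def by (rule ty | simp)+
  have t': "G |- t : Pi X X\<up>1"
    by (rule inst_conv_typing[OF FB, where B="Pi x0 x1"]) (rule t[THEN typing_eqI] ty | simp)+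
  note [ty] = t'[THEN subst_has_type] t[THEN subst_has_type]
  have tb: "?FB # G |- App t\<up>1 x0 \<sim> transport (App F\<up>2 x0) Base Base Loop x0 : App F\<up>1 Base"
  proof (rule path_eq)
    show "?FB # G |- App t\<up>1 x0 \<doteq> transport (App F\<up>2 x0) Base Base Loop x0 : App F\<up>1 Base"
      unfolding t_def apply simp
      by (rule beta[where B="App F\<up>2 Base"]) (rule ty | simp)+
  qed (rule ty | simp)+
  have qF: "?FB # G |- q\<up>1 : Id (Univ 0) (App F\<up>1 Base) (App F\<up>1 Base)"
    by (rule subst_has_type[OF q']) (rule ty | simp)+
  have "?FB # G |- transport (App F\<up>2 x0) Base Base Loop x0 \<sim> App (coe (App F\<up>1 Base) (App F\<up>1 Base) q\<up>1) x0 : App F\<up>1 Base"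
    by (rule pathI) (rule qF ty | simp add: tf[simplified])+
  note tq = pathD[OF path_trans[OF tb this]]
  let ?D2 = "Pi x1 x2" and ?R2 = "Pi x2 (Id x3 (App x1 x0) (App (coe x3 x3 x2) x0))"
  have tD: "G |- t : ?D2\<langle>q, ?FB\<rangle>" "G |- t : ?D2\<langle>q, X\<rangle>" using t t' by simp_all
  have r2: "G |= ?R2\<lbrakk>t \<cdot> q \<cdot> ?FB \<cdot> sh0\<rbrakk>"
    apply simp
    by (rule inh_Lam) (rule ty tq | simp)+
  have "G |= ?R2\<lbrakk>t \<cdot> q \<cdot> X \<cdot> sh0\<rbrakk>"
    by (rule inh_subst_eq3[OF _ _ _ _ _ _ FB qB(2,1) tD r2]) (rule ty | simp)+
  then have "G |= Pi X (Id X\<up>1 (App t\<up>1 x0) (App (coe X X q)\<up>1 x0))" by simp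
  note tX = inh_unLam[OF this]
  have "X # G |- ?FB\<up>1 \<doteq> X\<up>1 : Univ 0"
    by (rule subst_eq_term[OF FB]) (rule ty | simp)+
  then have eX: "X # G |- App F\<up>1 Base \<doteq> X\<up>1 type" by (simp add: eq_type_El)
  have x0: "X # G |- x0 : App F\<up>1 Base"
    by (rule conv_typing[OF _ eq_type_sym[OF eX]]) (rule ty | simp)+
  then have x0': "X # G |- x0 : (App F\<up>2 x0)\<langle>Base\<rangle>" by simp
  have tr: "X # G |- transport (App F\<up>2 x0) Base Base Loop x0 : X\<up>1"
    by (rule conv_typing[OF _ eX]) (rule x0 x0' ty | simp)+
  have "X # G |- App t\<up>1 x0 \<doteq> transport (App F\<up>2 x0) Base Base Loop x0 : App F\<up>1 Base"
    unfolding t_def apply simp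
    by (rule beta[where B="App F\<up>2 Base"]) (rule x0 x0' ty | simp)+
  from eq_term_conv[OF this eX] have "X # G |- App t\<up>1 x0 \<sim> transport (App F\<up>2 x0) Base Base Loop x0 : X\<up>1"
    by (rule path_eq) (rule tr ty | simp)+
  moreover have "X # G |- App t\<up>1 x0 \<sim> App (coe X X q)\<up>1 x0 : X\<up>1"
    by (rule pathI[OF tX]) (rule ty | simp)+
  ultimately have "X # G |= Id X\<up>1 (transport (App F\<up>2 x0) Base Base Loop x0) (App (coe X X q)\<up>1 x0)"
    using path_trans path_sym pathD by blast
  with F FB show thesis by (rule that)
qed

section \<open>The universal cover of the circle\<close>

definition succZ :: "tm \<Rightarrow> tm" where
  "succZ z = SumInd IntT (Inl (SucN x0)) (NatInd IntT (Inl ZeroN) (Inr x1) x0) z"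
definition predZ :: "tm \<Rightarrow> tm" where
  "predZ z = SumInd IntT (NatInd IntT (Inr ZeroN) (Inl x1) x0) (Inr (SucN x0)) z"

lemma subst_succZ [simp]: "(succZ z)\<lbrakk>\<sigma>\<rbrakk> = succZ z\<lbrakk>\<sigma>\<rbrakk>" "(predZ z)\<lbrakk>\<sigma>\<rbrakk> = predZ z\<lbrakk>\<sigma>\<rbrakk>"
  by (simp_all add: succZ_def predZ_def)

lemma succZ_typing [ty]: "G |- z : IntT \<Longrightarrow> T = IntT \<Longrightarrow> G |- succZ z : T"
  unfolding succZ_def by (rule SumInd_Int_typing ty | assumption | simp)+
lemma predZ_typing [ty]: "G |- z : IntT \<Longrightarrow> T = IntT \<Longrightarrow> G |- predZ z : T"
  unfolding predZ_def by (rule SumInd_Int_typing ty | assumption | simp)+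

lemma succZ_Inl: assumes n[ty]: "G |- n : NatT" shows "G |- succZ (Inl n) \<sim> Inl (SucN n) : IntT"
  by (rule path_eq, unfold succZ_def, rule SumInd_Int_eq) (rule SumInd_Int_typing ty | simp)+
lemma predZ_Inr: assumes n[ty]: "G |- n : NatT" shows "G |- predZ (Inr n) \<sim> Inr (SucN n) : IntT"
  by (rule path_eq, unfold predZ_def, rule SumInd_Int_eq) (rule SumInd_Int_typing ty | simp)+
lemma succZ_Inr0: "G |- succZ (Inr ZeroN) \<sim> Inl ZeroN : IntT"
proof -
  have "G |- succZ (Inr ZeroN) \<sim> NatInd IntT (Inl ZeroN) (Inr x1) ZeroN : IntT"
    by (rule path_eq, unfold succZ_def, rule SumInd_Int_eq) (rule SumInd_Int_typing ty | simp)+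
  also have "G |- NatInd IntT (Inl ZeroN) (Inr x1) ZeroN \<sim> Inl ZeroN : IntT"
    by (rule path_eq, rule NatInd_zero_eq) (rule ty | simp)+
  finally show ?thesis .
qed
lemma succZ_InrS: assumes n[ty]: "G |- n : NatT" shows "G |- succZ (Inr (SucN n)) \<sim> Inr n : IntT"
proof -
  have "G |- succZ (Inr (SucN n)) \<sim> NatInd IntT (Inl ZeroN) (Inr x1) (SucN n) : IntT"
    by (rule path_eq, unfold succZ_def, rule SumInd_Int_eq) (rule SumInd_Int_typing ty | simp)+
  also have "G |- NatInd IntT (Inl ZeroN) (Inr x1) (SucN n) \<sim> Inr n : IntT"
    by (rule path_eq, rule NatInd_suc_eq) (rule ty | simp)+
  finally show ?thesis .
qed
lemma predZ_Inl0: "G |- predZ (Inl ZeroN) \<sim> Inr ZeroN : IntT"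
proof -
  have "G |- predZ (Inl ZeroN) \<sim> NatInd IntT (Inr ZeroN) (Inl x1) ZeroN : IntT"
    by (rule path_eq, unfold predZ_def, rule SumInd_Int_eq) (rule SumInd_Int_typing ty | simp)+
  also have "G |- NatInd IntT (Inr ZeroN) (Inl x1) ZeroN \<sim> Inr ZeroN : IntT"
    by (rule path_eq, rule NatInd_zero_eq) (rule ty | simp)+
  finally show ?thesis .
qed
lemma predZ_InlS: assumes n[ty]: "G |- n : NatT" shows "G |- predZ (Inl (SucN n)) \<sim> Inl n : IntT"
proof -
  have "G |- predZ (Inl (SucN n)) \<sim> NatInd IntT (Inr ZeroN) (Inl x1) (SucN n) : IntT"
    by (rule path_eq, unfold predZ_def, rule SumInd_Int_eq) (rule SumInd_Int_typing ty | simp)+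
  also have "G |- NatInd IntT (Inr ZeroN) (Inl x1) (SucN n) \<sim> Inl n : IntT"
    by (rule path_eq, rule NatInd_suc_eq) (rule ty | simp)+
  finally show ?thesis .
qed

lemma path_succZ: "G |- y \<sim> z : IntT \<Longrightarrow> G |- succZ y \<sim> succZ z : IntT"
  by (erule path_ap[where t="succZ x0"]) (rule ty | simp)+
lemma path_predZ: "G |- y \<sim> z : IntT \<Longrightarrow> G |- predZ y \<sim> predZ z : IntT"
  by (erule path_ap[where t="predZ x0"]) (rule ty | simp)+

lemma succ_pred: "IntT # G |= Id IntT (succZ (predZ x0)) x0"
proof (rule inh_Int)
  have n [ty]: "NatT # G |- x0 : NatT" by (rule ty | simp)+
  have 0: "G |- succZ (predZ (Inl ZeroN)) \<sim> Inl ZeroN : IntT"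
    by (rule path_trans[OF path_succZ[OF predZ_Inl0] succZ_Inr0])
  have S: "NatT # G |- succZ (predZ (Inl (SucN x0))) \<sim> Inl (SucN x0) : IntT"
    by (rule path_trans[OF path_succZ[OF predZ_InlS] succZ_Inl]) (rule ty)+
  have "NatT # G |= Id IntT (succZ (predZ (Inl x0))) (Inl x0)"
    by (rule inh_Nat_cases) (rule ty | simp add: pathD[OF 0] pathD[OF S])+
  then show "NatT # G |= (Id IntT (succZ (predZ x0)) x0)\<lbrakk>Inl x0 \<cdot> sh1\<rbrakk>" by simp
  have "NatT # G |- succZ (predZ (Inr x0)) \<sim> Inr x0 : IntT"
    by (rule path_trans[OF path_succZ[OF predZ_Inr] succZ_InrS]) (rule ty)+
  from pathD[OF this] show "NatT # G |= (Id IntT (succZ (predZ x0)) x0)\<lbrakk>Inr x0 \<cdot> sh1\<rbrakk>" by simp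
qed (rule ty | simp)+

lemma pred_succ: "IntT # G |= Id IntT (predZ (succZ x0)) x0"
proof (rule inh_Int)
  have n [ty]: "NatT # G |- x0 : NatT" by (rule ty | simp)+
  have 0: "G |- predZ (succZ (Inr ZeroN)) \<sim> Inr ZeroN : IntT"
    by (rule path_trans[OF path_predZ[OF succZ_Inr0] predZ_Inl0])
  have S: "NatT # G |- predZ (succZ (Inr (SucN x0))) \<sim> Inr (SucN x0) : IntT"
    by (rule path_trans[OF path_predZ[OF succZ_InrS] predZ_Inr]) (rule ty)+
  have "NatT # G |= Id IntT (predZ (succZ (Inr x0))) (Inr x0)"
    by (rule inh_Nat_cases) (rule ty | simp add: pathD[OF 0] pathD[OF S])+
  then show "NatT # G |= (Id IntT (predZ (succZ x0)) x0)\<lbrakk>Inr x0 \<cdot> sh1\<rbrakk>" by simp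
  have "NatT # G |- predZ (succZ (Inl x0)) \<sim> Inl x0 : IntT"
    by (rule path_trans[OF path_predZ[OF succZ_Inl] predZ_InlS]) (rule ty)+
  from pathD[OF this] show "NatT # G |= (Id IntT (predZ (succZ x0)) x0)\<lbrakk>Inl x0 \<cdot> sh1\<rbrakk>" by simp
qed (rule ty | simp)+

text \<open>
  The successor is an equivalence with inverse \<open>predZ\<close>, so univalence makes it the path \<open>q\<close> of \<open>S1_rec_type\<close>.
\<close>

lemma universal_cover:
  obtains F where "G |- F : Pi S1 (Univ 0)" "G |- App F Base \<doteq> IntT : Univ 0"
    "IntT # G |= Id IntT (transport (App F\<up>2 x0) Base Base Loop x0) (succZ x0)"
proof -
  have e: "G |= isequiv IntT IntT (Lam IntT (succZ x0))"
    by (rule isequivI[where g="predZ x0"]) (rule ty | simp add: succ_pred pred_succ)+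
  obtain q where q: "G |- q : Id (Univ 0) IntT IntT" and c: "G |- coe IntT IntT q \<sim> Lam IntT (succZ x0) : Pi IntT IntT"
    by (rule ua[OF _ _ _ e]) (rule ty | simp)+
  note [ty] = q q[THEN subst_has_type]
  obtain F where F: "G |- F : Pi S1 (Univ 0)" "G |- App F Base \<doteq> IntT : Univ 0"
    "IntT # G |= Id IntT\<up>1 (transport (App F\<up>2 x0) Base Base Loop x0) (App (coe IntT IntT q)\<up>1 x0)"
    by (rule S1_rec_type[OF _ q]) (rule ty)
  note [ty] = F(1)[THEN subst_has_type]
  have fb: "IntT # G |- App F\<up>1 Base \<doteq> IntT : Univ 0"
    using subst_eq_term[OF F(2), of "IntT # G" sh1] by (simp add: ty)
  have x0: "IntT # G |- x0 : (App F\<up>2 x0)\<langle>Base\<rangle>"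
    apply simp
    by (rule conv_typing[OF _ eq_type_sym[OF eq_type_El[OF fb]]]) (rule ty | simp)+
  have tr: "IntT # G |- transport (App F\<up>2 x0) Base Base Loop x0 : IntT"
    by (rule conv_typing[OF _ eq_type_El[OF fb]]) (rule x0 ty | simp)+
  have 1: "IntT # G |- transport (App F\<up>2 x0) Base Base Loop x0 \<sim> App (coe IntT IntT q\<up>1) x0 : IntT"
    by (rule pathI) (rule tr ty | simp add: F(3)[simplified])+
  have c1: "IntT # G |- coe IntT IntT q\<up>1 \<sim> Lam IntT (succZ x0) : Pi IntT IntT"
    by (rule pathI) (rule ty inh_subst[OF pathD[OF c], of _ sh1] | simp)+
  have 2: "IntT # G |- App (coe IntT IntT q\<up>1) x0 \<sim> App (Lam IntT (succZ x0)) x0 : IntT"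
    by (rule path_ap[OF c1, where t="App x0 x1"]) (rule ty | simp)+
  have 3: "IntT # G |- App (Lam IntT (succZ x0)) x0 \<sim> succZ x0 : IntT"
    by (rule path_eq, rule beta[where B=IntT]) (rule ty | simp)+
  show thesis
    by (rule that[OF F(1,2) pathD[OF path_trans[OF 1 path_trans[OF 2 3]]]])
qed

section \<open>Powers of the loop\<close>

text \<open>
  Transport along a composite, where \<open>q\<close> followed by \<open>p\<close> is the transport of \<open>q\<close> along \<open>p\<close> in the family of paths
  from \<open>Base\<close>.
\<close>

lemma transport_concat:
  assumes F: "G |- F : Pi S1 (Univ 0)" and p: "G |- p : Id S1 Base Base" and q: "G |- q : Id S1 Base Base" and z: "G |- z : App F Base"
  shows "G |- transport (App F\<up>1 x0) Base Base (transport (Id S1 Base x0) Base Base p q) z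
     \<sim> transport (App F\<up>1 x0) Base Base p (transport (App F\<up>1 x0) Base Base q z) : App F Base"
proof -
  note [ty] = F F[THEN subst_has_type] p q z
  let ?P = "Pi (Id S1 Base Base) (Pi (App F\<up>3 Base) (Id (App F\<up>4 x3)
    (transport (App F\<up>5 x0) Base x3 (transport (Id S1 Base x0) Base x3 x2 x1) x0)
    (transport (App F\<up>5 x0) Base x3 x2 (transport (App F\<up>5 x0) Base Base x1 x0))))"
  let ?\<Delta> = "App F\<up>1 Base # Id S1 Base Base # G"
  have 0: "?\<Delta> |- transport (Id S1 Base x0) Base Base (Refl Base) x1 \<sim> x1 : Id S1 Base Base"
    by (rule path_eq, rule transport_Refl_eq[where A=S1]) (rule ty | simp)+
  have 1: "?\<Delta> |- transport (App F\<up>3 x0) Base Base (transport (Id S1 Base x0) Base Base (Refl Base) x1) x0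
       \<sim> transport (App F\<up>3 x0) Base Base x1 x0 : App F\<up>2 Base"
    by (rule path_ap[OF 0, where t="transport (App F\<up>4 x0) Base Base x0 x1"]) (rule ty | simp)+
  have 2: "?\<Delta> |- transport (App F\<up>3 x0) Base Base (Refl Base) (transport (App F\<up>3 x0) Base Base x1 x0)
       \<sim> transport (App F\<up>3 x0) Base Base x1 x0 : App F\<up>2 Base"
    by (rule path_eq, rule transport_Refl_eq[where A=S1]) (rule ty | simp)+
  note 3 = pathD[OF path_trans[OF 1 path_sym[OF 2]]]
  have P: "G |= ?P\<langle>p, Base\<rangle>"
  proof (rule path_induction_at[where A=S1 and a=Base])
    show "G |= ?P\<langle>Refl Base, Base\<rangle>"
      apply simp
      apply (intro inh_Lam)
        apply (rule 3 ty | simp)+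
      done
  qed (rule ty | simp)+
  have 4: "G |= Pi (App F Base) (Id (App F\<up>1 Base)
    (transport (App F\<up>2 x0) Base Base (transport (Id S1 Base x0) Base Base p\<up>1 q\<up>1) x0)
    (transport (App F\<up>2 x0) Base Base p\<up>1 (transport (App F\<up>2 x0) Base Base q\<up>1 x0)))"
    by (rule inh_App[OF P[simplified] q]) simp
  show ?thesis
    by (rule pathI, rule inh_App[OF 4 z]) (rule ty | simp)+
qed

text \<open>
  Composition with \<open>p\<close> has a right inverse.  With the other end of \<open>p\<close> free it suffices to
  treat \<open>refl\<close>, so no inverse paths have to be formed.
\<close>

lemma concat_surj:
  assumes p: "G |- p : Id S1 Base Base" and q: "G |- q : Id S1 Base Base"
  shows "G |= Sig (Id S1 Base Base) (Id (Id S1 Base Base) (transport (Id S1 Base x0) Base Base p\<up>1 x0) q\<up>1)"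
proof -
  note [ty] = p q
  let ?P = "Pi (Id S1 Base x1) (Sig (Id S1 Base Base) (Id (Id S1 Base x3) (transport (Id S1 Base x0) Base x3 x2 x0) x1))"
  have r: "Id S1 Base Base # G |= Id (Id S1 Base Base) (transport (Id S1 Base x0) Base Base (Refl Base) x0) x0"
    by (rule eq_inh_Id, rule transport_Refl_eq[where A=S1]) (rule ty | simp)+
  have P: "G |= ?P\<langle>p, Base\<rangle>"
  proof (rule path_induction_at[where A=S1 and a=Base])
    show "G |= ?P\<langle>Refl Base, Base\<rangle>"
      apply simp
      apply (rule inh_Lam)
       apply (rule ty)+
      apply (rule inh_Pair[where a=x0])
         apply (rule ty | simp add: r)+
      done
  qed (rule ty | simp)+
  show ?thesis
    by (rule inh_App[OF P[simplified] q]) simp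
qed

abbreviation LoopS1 :: tm where "LoopS1 \<equiv> Id S1 Base Base"

text \<open>
  Composition with the loop.
\<close>

definition step :: "tm \<Rightarrow> tm" where "step q = transport (Id S1 Base x0) Base Base Loop q"

lemma subst_step [simp]: "(step q)\<lbrakk>\<sigma>\<rbrakk> = step q\<lbrakk>\<sigma>\<rbrakk>" by (simp add: step_def)
lemma step_typing [ty]: assumes [ty]: "G |- q : LoopS1" and T: "T = LoopS1" shows "G |- step q : T"
  unfolding step_def T by (rule transport_typing[where A=S1]) (rule ty | simp)+
lemma path_step: "G |- p \<sim> q : LoopS1 \<Longrightarrow> G |- step p \<sim> step q : LoopS1"
  by (erule path_ap[where t="step x0"]) (rule ty | simp)+

text \<open>
  Induction over the integers in steps of \<open>succZ\<close>.  With it the arguments about powers of the loop need not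
  distinguish the two kinds of integers.
\<close>

lemma inh_Int_induct:
  assumes C: "IntT # G |- C type" and z: "G |= C\<langle>Inl ZeroN\<rangle>"
    and up: "C # IntT # G |= C\<lbrakk>succZ x1 \<cdot> sh2\<rbrakk>"
    and down: "C\<lbrakk>succZ x0 \<cdot> sh1\<rbrakk> # IntT # G |= C\<up>1"
  shows "IntT # G |= C"
proof (rule inh_Int)
  note [ty] = C C[THEN subst_is_type]
  show "NatT # G |= C\<lbrakk>Inl x0 \<cdot> sh1\<rbrakk>"
  proof (rule inh_Nat)
    show "G |= C\<lbrakk>Inl x0 \<cdot> sh1\<rbrakk>\<langle>ZeroN\<rangle>" using z by simp
    let ?\<Delta> = "C\<lbrakk>Inl x0 \<cdot> sh1\<rbrakk> # NatT # G"
    have n: "?\<Delta> |- x1 : NatT" by (rule ty | simp)+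
    have u: "?\<Delta> |= C\<lbrakk>succZ (Inl x1) \<cdot> sh2\<rbrakk>"
      by (rule inh_subst[OF up, of _ "x0 \<cdot> Inl x1 \<cdot> sh2"]) (rule ty | simp)+
    have "?\<Delta> |= C\<lbrakk>x0 \<cdot> sh3\<rbrakk>\<langle>Inl (SucN x1)\<rangle>"
      by (rule leibniz[OF _ _ _ _ pathD[OF succZ_Inl[OF n]]]) (rule ty | simp add: u)+
    then show "?\<Delta> |= C\<lbrakk>Inl x0 \<cdot> sh1\<rbrakk>\<lbrakk>SucN x1 \<cdot> sh2\<rbrakk>" by simp
  qed (rule ty | simp)+
  show "NatT # G |= C\<lbrakk>Inr x0 \<cdot> sh1\<rbrakk>"
  proof (rule inh_Nat)
    have "G |= C\<langle>succZ (Inr ZeroN)\<rangle>"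
      by (rule leibniz[OF _ _ _ _ pathD[OF path_sym[OF succZ_Inr0]]]) (rule ty | simp add: z)+
    then obtain c where c: "G |- c : C\<langle>succZ (Inr ZeroN)\<rangle>" by (rule inhE)
    show "G |= C\<lbrakk>Inr x0 \<cdot> sh1\<rbrakk>\<langle>ZeroN\<rangle>"
      by (rule inh_subst[OF down, of _ "c \<cdot> Inr ZeroN \<cdot> sh0"]) (rule c[THEN typing_eqI] ty | simp)+
    let ?\<Delta> = "C\<lbrakk>Inr x0 \<cdot> sh1\<rbrakk> # NatT # G"
    have n: "?\<Delta> |- x1 : NatT" by (rule ty | simp)+
    have u: "?\<Delta> |= C\<lbrakk>Inr x1 \<cdot> sh2\<rbrakk>"
      by (rule inhI[of _ x0]) (rule ty | simp)+
    have "?\<Delta> |= C\<lbrakk>x0 \<cdot> sh3\<rbrakk>\<langle>succZ (Inr (SucN x1))\<rangle>"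
      by (rule leibniz[OF _ _ _ _ pathD[OF path_sym[OF succZ_InrS[OF n]]]]) (rule ty | simp add: u)+
    then obtain c where c: "?\<Delta> |- c : C\<lbrakk>x0 \<cdot> sh3\<rbrakk>\<langle>succZ (Inr (SucN x1))\<rangle>" by (rule inhE)
    show "?\<Delta> |= C\<lbrakk>Inr x0 \<cdot> sh1\<rbrakk>\<lbrakk>SucN x1 \<cdot> sh2\<rbrakk>"
      by (rule inh_subst[OF down, of _ "c \<cdot> Inr (SucN x1) \<cdot> sh2"]) (rule c[simplified, THEN typing_eqI] ty | simp)+
  qed (rule ty | simp)+
qed (rule C ty)+

text \<open>
  The map \<open>z \<mapsto> loop\<^sup>z\<close>, of which only the value at \<open>0\<close> and the successor law are exported.  The
  non-negative powers iterate \<open>step\<close>, and the negative ones iterate a right inverse \<open>a\<close> of \<open>step\<close>.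
\<close>

lemma loop_powers:
  obtains pw where "IntT # G |- pw : LoopS1" "G |= Id LoopS1 pw\<langle>Inl ZeroN\<rangle> (Refl Base)"
    "IntT # G |= Id LoopS1 pw\<lbrakk>succZ x0 \<cdot> sh1\<rbrakk> (step pw)"
proof -
  have "LoopS1 # G |= Sig LoopS1 (Id LoopS1 (step x0) x1)"
    using concat_surj[of "LoopS1 # G" Loop x0] by (simp add: ty step_def)
  then obtain a where a: "LoopS1 # G |- a : LoopS1" and "LoopS1 # G |= (Id LoopS1 (step x0) x1)\<langle>a\<rangle>"
    by (rule inh_SigE) (rule ty | simp)+
  then have sa: "LoopS1 # G |= Id LoopS1 (step a) x0" by simp
  note [ty] = a[THEN subst_has_type]
  have sa': "\<Delta> |- step a\<lbrakk>q \<cdot> shift k\<rbrakk> \<sim> q : LoopS1" if "\<Delta> |- q : LoopS1" "drop k \<Delta> = G" "k \<le> length \<Delta>" for \<Delta> q k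
    by (rule pathI, rule inh_subst[OF sa, of _ "q \<cdot> shift k"]) (rule that(1) ty | simp add: that)+
  \<comment> \<open>\<open>M\<close> and \<open>P\<close> contain the parameter \<open>a\<close> and therefore depend on the number \<open>k\<close> of variables added to \<open>G\<close>\<close>
  define N where "N = NatInd LoopS1 (Refl Base) (step x0)"
  define M where "M k = NatInd LoopS1 a\<lbrakk>Refl Base \<cdot> shift k\<rbrakk> a\<lbrakk>x0 \<cdot> shift (Suc (Suc k))\<rbrakk>" for k
  define P where "P k = SumInd LoopS1 (N x0) (M (Suc k) x0)" for k
  have [simp]: "(N n)\<lbrakk>\<sigma>\<rbrakk> = N n\<lbrakk>\<sigma>\<rbrakk>" for n \<sigma> by (simp add: N_def)
  have [simp]: "(P (Suc 0) z)\<lbrakk>t \<cdot> shift k\<rbrakk> = P k z\<lbrakk>t \<cdot> shift k\<rbrakk>" for z t k by (simp add: P_def M_def)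
  have [simp]: "(P (Suc k) z)\<lbrakk>t \<cdot> sh0\<rbrakk> = P k z\<lbrakk>t \<cdot> sh0\<rbrakk>" for z t k by (simp add: P_def M_def)
  have [ty]: "\<Delta> |- N n : LoopS1" if [ty]: "\<Delta> |- n : NatT" for \<Delta> n
    unfolding N_def by (rule ty | simp)+
  have hM: "\<Delta> |- M k n : LoopS1" if "\<Delta> |- n : NatT" "drop k \<Delta> = G" "k \<le> length \<Delta>" for \<Delta> n k
    unfolding M_def by (rule that(1) ty | simp add: that)+
  have hP: "\<Delta> |- P k z : LoopS1" if "\<Delta> |- z : IntT" "drop k \<Delta> = G" "k \<le> length \<Delta>" for \<Delta> z k
    unfolding P_def by (rule SumInd_Int_typing[OF that(1)]) (rule hM ty | simp add: that)+
  have N0: "\<Delta> |- N ZeroN \<sim> Refl Base : LoopS1" for \<Delta>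
    by (rule path_eq, unfold N_def, rule NatInd_zero_eq) (rule ty | simp)+
  have NS: "\<Delta> |- N (SucN n) \<sim> step (N n) : LoopS1" if [ty]: "\<Delta> |- n : NatT" for \<Delta> n
    by (rule path_eq, unfold N_def, rule NatInd_suc_eq) (rule ty | simp)+
  have M0: "\<Delta> |- step (M k ZeroN) \<sim> Refl Base : LoopS1" if "drop k \<Delta> = G" "k \<le> length \<Delta>" for \<Delta> k
  proof -
    have "\<Delta> |- M k ZeroN \<sim> a\<lbrakk>Refl Base \<cdot> shift k\<rbrakk> : LoopS1"
      by (rule path_eq, unfold M_def, rule NatInd_zero_eq) (rule ty | simp add: that)+
    from path_step[OF this] show ?thesis
      by (rule path_trans[OF _ sa']) (rule ty that | simp)+
  qed
  have MS: "\<Delta> |- step (M k (SucN n)) \<sim> M k n : LoopS1" if n[ty]: "\<Delta> |- n : NatT" and k: "drop k \<Delta> = G" "k \<le> length \<Delta>" for \<Delta> n k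
  proof -
    have "\<Delta> |- M k (SucN n) \<doteq> a\<lbrakk>M k n \<cdot> shift k\<rbrakk> : LoopS1"
      by (unfold M_def, rule NatInd_suc_eq) (rule ty | simp add: k)+
    then have "\<Delta> |- M k (SucN n) \<sim> a\<lbrakk>M k n \<cdot> shift k\<rbrakk> : LoopS1"
      by (rule path_eq) (rule hM ty | simp add: k)+
    with hM[OF n k] show ?thesis using path_trans[OF path_step sa'] k by blast
  qed
  have Pl: "\<Delta> |- P k (Inl n) \<sim> N n : LoopS1" if n[ty]: "\<Delta> |- n : NatT" and k: "drop k \<Delta> = G" "k \<le> length \<Delta>" for \<Delta> n k
  proof -
    have "\<Delta> |- P k (Inl n) \<doteq> N n : LoopS1"
      by (unfold P_def, rule SumInd_Int_eq) (rule hM ty | simp add: k)+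
    then show ?thesis by (rule path_eq) (rule hP ty | simp add: k)+
  qed
  have Pr: "\<Delta> |- P k (Inr n) \<sim> M k n : LoopS1" if n[ty]: "\<Delta> |- n : NatT" and k: "drop k \<Delta> = G" "k \<le> length \<Delta>" for \<Delta> n k
  proof -
    have "\<Delta> |- P k (Inr n) \<doteq> M k n : LoopS1"
      by (unfold P_def, rule SumInd_Int_eq) (rule hM ty | simp add: k M_def)+
    then show ?thesis by (rule path_eq) (rule hM hP ty | simp add: k)+
  qed
  have Pap: "\<Delta> |- P k y \<sim> P k z : LoopS1" if yz: "\<Delta> |- y \<sim> z : IntT" and k: "drop k \<Delta> = G" "k \<le> length \<Delta>" for \<Delta> y z k
    by (rule path_ap[OF yz, where t="P (Suc k) x0"]) (rule hP ty | simp add: k)+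
  have x0: "NatT # G |- x0 : NatT" by (rule ty | simp)+
  show thesis
  proof (rule that[of "P (Suc 0) x0"])
    show "IntT # G |- P (Suc 0) x0 : LoopS1" by (rule hP) (rule ty | simp)+
    show "G |= Id LoopS1 (P (Suc 0) x0)\<langle>Inl ZeroN\<rangle> (Refl Base)"
      using pathD[OF path_trans[OF Pl N0], of G 0] by (simp add: ty)
    show "IntT # G |= Id LoopS1 (P (Suc 0) x0)\<lbrakk>succZ x0 \<cdot> sh1\<rbrakk> (step (P (Suc 0) x0))"
    proof (rule inh_Int)
      have "NatT # G |- P (Suc 0) (succZ (Inl x0)) \<sim> P (Suc 0) (Inl (SucN x0)) : LoopS1"
        by (rule Pap, rule succZ_Inl) (rule ty | simp)+
      also have "NatT # G |- P (Suc 0) (Inl (SucN x0)) \<sim> N (SucN x0) : LoopS1"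
        by (rule Pl) (rule ty | simp)+
      also have "NatT # G |- N (SucN x0) \<sim> step (N x0) : LoopS1" by (rule NS[OF x0])
      also have "NatT # G |- step (N x0) \<sim> step (P (Suc 0) (Inl x0)) : LoopS1"
        by (rule path_step, rule path_sym, rule Pl) (rule ty | simp)+
      finally show "NatT # G |= (Id LoopS1 (P (Suc 0) x0)\<lbrakk>succZ x0 \<cdot> sh1\<rbrakk> (step (P (Suc 0) x0)))\<lbrakk>Inl x0 \<cdot> sh1\<rbrakk>"
        by (simp add: pathD)
      let ?C = "Id LoopS1 (P (Suc 0) (succZ (Inr x0))) (step (P (Suc 0) (Inr x0)))"
      have "NatT # G |= ?C"
      proof (rule inh_Nat_cases)
        have "G |- P 0 (succZ (Inr ZeroN)) \<sim> P 0 (Inl ZeroN) : LoopS1"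
          by (rule Pap, rule succZ_Inr0) simp_all
        also have "G |- P 0 (Inl ZeroN) \<sim> N ZeroN : LoopS1" by (rule Pl) (rule ty | simp)+
        also note N0
        also have "G |- Refl Base \<sim> step (M 0 ZeroN) : LoopS1" by (rule path_sym, rule M0) simp_all
        also have "G |- step (M 0 ZeroN) \<sim> step (P 0 (Inr ZeroN)) : LoopS1"
          by (rule path_step, rule path_sym, rule Pr) (rule ty | simp)+
        finally show "G |= ?C\<langle>ZeroN\<rangle>" by (simp add: pathD)
        have "NatT # G |- P (Suc 0) (succZ (Inr (SucN x0))) \<sim> P (Suc 0) (Inr x0) : LoopS1"
          by (rule Pap, rule succZ_InrS[OF x0]) simp_all
        also have "NatT # G |- P (Suc 0) (Inr x0) \<sim> M (Suc 0) x0 : LoopS1" by (rule Pr) (rule ty | simp)+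
        also have "NatT # G |- M (Suc 0) x0 \<sim> step (M (Suc 0) (SucN x0)) : LoopS1" by (rule path_sym, rule MS[OF x0]) simp_all
        also have "NatT # G |- step (M (Suc 0) (SucN x0)) \<sim> step (P (Suc 0) (Inr (SucN x0))) : LoopS1"
          by (rule path_step, rule path_sym, rule Pr) (rule ty | simp)+
        finally show "NatT # G |= ?C\<lbrakk>SucN x0 \<cdot> sh1\<rbrakk>" by (simp add: pathD)
      qed (rule hP ty | simp)+
      then show "NatT # G |= (Id LoopS1 (P (Suc 0) x0)\<lbrakk>succZ x0 \<cdot> sh1\<rbrakk> (step (P (Suc 0) x0)))\<lbrakk>Inr x0 \<cdot> sh1\<rbrakk>" by simp
    qed (rule hP ty | simp)+
  qed
qed

section \<open>The loop space of the circle\<close>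

lemma path_conv:
  assumes p: "G |- a \<sim> b : A" and e: "G |- A \<doteq> B type" and B: "G |- B type"
  shows "G |- a \<sim> b : B"
proof -
  have a: "G |- a : A" and b: "G |- b : A" and i: "G |= Id A a b" using p by (simp_all add: path_def)
  have "G |- Id A a b \<doteq> Id B a b type"
    using a b e unfolding guarded_defs by (meson Id_form_cong eq_refl)
  from inh_conv[OF i this] show ?thesis
    by (rule pathI) (rule B conv_typing[OF a e] conv_typing[OF b e])+
qed

text \<open>
  A function between the fibres over \<open>Base\<close> that commutes with transport along \<open>p\<close> is fixed by
  transport in the family of function types.  With the end of \<open>p\<close> free, the claim is stated for a second function \<open>g\<close>
  over this end; for \<open>refl\<close> the hypothesis is then a homotopy between \<open>f\<close> and \<open>g\<close>, which function
  extensionality turns into a path.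
\<close>

lemma arrow_transport:
  assumes F: "G |- F : Pi S1 (Univ 0)" and f: "G |- f : Pi (App F Base) LoopS1" and p: "G |- p : LoopS1"
    and H: "App F Base # G |= Id LoopS1 (transport (Id S1 Base x0) Base Base p\<up>1 (App f\<up>1 x0)) (App f\<up>1 (transport (App F\<up>2 x0) Base Base p\<up>1 x0))"
  shows "G |= Id (Pi (App F Base) LoopS1) (transport (Pi (App F\<up>1 x0) (Id S1 Base x1)) Base Base p f) f"
proof -
  note [ty] = F F[THEN subst_has_type] f f[THEN subst_has_type] p p[THEN subst_has_type]
  let ?P = "Pi (Pi (App F\<up>2 x1) (Id S1 Base x2)) (Pi (Pi (App F\<up>3 Base) (Id (Id S1 Base x3) (transport (Id S1 Base x0) Base x3 x2 (App f\<up>4 x0))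
      (App x1 (transport (App F\<up>5 x0) Base x3 x2 x0))))
    (Id (Pi (App F\<up>4 x3) (Id S1 Base x4)) (transport (Pi (App F\<up>5 x0) (Id S1 Base x1)) Base x3 x2 f\<up>4) x1))"
  let ?H = "Pi (App F\<up>1 Base) (Id LoopS1 (transport (Id S1 Base x0) Base Base (Refl Base) (App f\<up>2 x0))
      (App x1 (transport (App F\<up>3 x0) Base Base (Refl Base) x0)))"
  let ?\<Delta> = "?H # Pi (App F Base) LoopS1 # G"
  have "App F\<up>2 Base # ?\<Delta> |- App f\<up>3 x0 \<sim> transport (Id S1 Base x0) Base Base (Refl Base) (App f\<up>3 x0) : LoopS1"
    by (rule path_eq, rule eq_term_sym, rule transport_Refl_eq[where A=S1]) (rule ty | simp)+
  also have "App F\<up>2 Base # ?\<Delta> |- transport (Id S1 Base x0) Base Base (Refl Base) (App f\<up>3 x0) \<sim> App x2 (transport (App F\<up>4 x0) Base Base (Refl Base) x0) : LoopS1"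
    by (rule pathI, rule inhI[of _ "App x1 x0"]) (rule ty | simp)+
  also have "App F\<up>2 Base # ?\<Delta> |- App x2 (transport (App F\<up>4 x0) Base Base (Refl Base) x0) \<sim> App x2 x0 : LoopS1"
    by (rule path_eq, rule App_cong_right, rule transport_Refl_eq[where A=S1]) (rule ty | simp)+
  finally have "App F\<up>2 Base # ?\<Delta> |= Id LoopS1\<up>1 (App f\<up>2\<up>1 x0) (App x1\<up>1 x0)"
    by (simp add: pathD)
  then have fg: "?\<Delta> |- f\<up>2 \<sim> x1 : Pi (App F\<up>2 Base) LoopS1\<up>1"
    by (rule funext[rotated -1]) (rule ty | simp)+
  have "?\<Delta> |- transport (Pi (App F\<up>3 x0) (Id S1 Base x1)) Base Base (Refl Base) f\<up>2 \<sim> f\<up>2 : Pi (App F\<up>2 Base) LoopS1"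
    by (rule path_eq, rule transport_Refl_eq[where A=S1]) (rule ty | simp)+
  also have "?\<Delta> |- f\<up>2 \<sim> x1 : Pi (App F\<up>2 Base) LoopS1" using fg by simp
  finally have 1: "?\<Delta> |= Id (Pi (App F\<up>2 Base) LoopS1) (transport (Pi (App F\<up>3 x0) (Id S1 Base x1)) Base Base (Refl Base) f\<up>2) x1"
    by (rule pathD)
  have P: "G |= ?P\<langle>p, Base\<rangle>"
  proof (rule path_induction_at[where A=S1 and a=Base])
    show "G |= ?P\<langle>Refl Base, Base\<rangle>"
      apply simp
      apply (rule inh_Lam)
       apply (rule ty | simp)+
      apply (rule inh_Lam)
       apply (rule 1 ty | simp)+
      done
  qed (rule ty | simp)+
  have "G |= Pi (App F Base) (Id LoopS1 (transport (Id S1 Base x0) Base Base p\<up>1 (App f\<up>1 x0)) (App f\<up>1 (transport (App F\<up>2 x0) Base Base p\<up>1 x0)))"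
    by (rule inh_Lam[OF _ H]) (rule ty | simp)+
  then obtain h where h: "G |- h : Pi (App F Base) (Id LoopS1 (transport (Id S1 Base x0) Base Base p\<up>1 (App f\<up>1 x0)) (App f\<up>1 (transport (App F\<up>2 x0) Base Base p\<up>1 x0)))"
    by (rule inhE)
  have 2: "G |= Pi (Pi (App F Base) (Id LoopS1 (transport (Id S1 Base x0) Base Base p\<up>1 (App f\<up>1 x0)) (App f\<up>1 (transport (App F\<up>2 x0) Base Base p\<up>1 x0))))
    (Id (Pi (App F\<up>1 Base) LoopS1) (transport (Pi (App F\<up>2 x0) (Id S1 Base x1)) Base Base p\<up>1 f\<up>1) f\<up>1)"
    by (rule inh_App[OF P[simplified] f]) simp
  show ?thesis
    by (rule inh_App[OF 2 h]) simp
qed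

text \<open>
  For a loop \<open>q\<close>, the value at \<open>z = 0\<close> is the winding number of \<open>q\<close>.
\<close>

definition wind :: "tm \<Rightarrow> tm \<Rightarrow> tm \<Rightarrow> tm" where "wind F q z = transport (App F\<up>1 x0) Base Base q z"
lemma subst_wind [simp]: "(wind F q z)\<lbrakk>\<sigma>\<rbrakk> = wind F\<lbrakk>\<sigma>\<rbrakk> q\<lbrakk>\<sigma>\<rbrakk> z\<lbrakk>\<sigma>\<rbrakk>" by (simp add: wind_def)

text \<open>
  Encode and decode.  The winding number of a loop is the result of transporting \<open>0\<close> along it in the
  universal cover, and decoding is \<open>z \<mapsto> loop\<^sup>z\<close>.  The winding number of \<open>loop\<^sup>z\<close> is \<open>z\<close> by induction over the
  integers, since the loop acts on the cover as the successor.  For the converse, decoding is extended to a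
  map from the cover over any \<open>x\<close> to paths from \<open>Base\<close> to \<open>x\<close>, by induction on the circle; the
  extension exists because decoding commutes with the loop.  Then decoding the code of a path
  \<open>p : Base = x\<close> gives \<open>p\<close> by path induction.
\<close>

lemma loop_equiv:
  obtains enc pw where "LoopS1 # G |- enc : IntT" "IntT # G |- pw : LoopS1"
    "IntT # G |= Id IntT enc\<lbrakk>pw \<cdot> sh1\<rbrakk> x0" "LoopS1 # G |= Id LoopS1 pw\<lbrakk>enc \<cdot> sh1\<rbrakk> x0"
proof -
  obtain F where F: "G |- F : Pi S1 (Univ 0)" and FB: "G |- App F Base \<doteq> IntT : Univ 0"
    and tl: "IntT # G |= Id IntT (transport (App F\<up>2 x0) Base Base Loop x0) (succZ x0)"
    by (rule universal_cover)
  obtain pw where pw: "IntT # G |- pw : LoopS1" and pw0: "G |= Id LoopS1 pw\<langle>Inl ZeroN\<rangle> (Refl Base)"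
    and pwS: "IntT # G |= Id LoopS1 pw\<lbrakk>succZ x0 \<cdot> sh1\<rbrakk> (step pw)"
    by (rule loop_powers)
  note [ty] = F[THEN subst_has_type] F[THEN typing_eqI] pw[THEN subst_has_type] pw[THEN typing_eqI]
  have Feq: "\<Delta> |- App F\<lbrakk>shift k\<rbrakk> Base \<doteq> IntT type" if "drop k \<Delta> = G" "k \<le> length \<Delta>" for \<Delta> k
    using subst_eq_type[OF eq_type_El[OF FB], of \<Delta> "shift k"] that by (simp add: sub_shift)
  have toF: "\<Delta> |- z : App F\<lbrakk>shift k\<rbrakk> Base" if "\<Delta> |- z : IntT" "drop k \<Delta> = G" "k \<le> length \<Delta>" for \<Delta> k z
    by (rule conv_typing[OF that(1) eq_type_sym[OF Feq[OF that(2,3)]]])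
  have hF: "\<Delta> |- wind F\<lbrakk>shift k\<rbrakk> q z : App F\<lbrakk>shift k\<rbrakk> Base" if "\<Delta> |- q : LoopS1" "\<Delta> |- z : IntT" "drop k \<Delta> = G" "k \<le> length \<Delta>" for \<Delta> k q z
    unfolding wind_def by (rule toF that(1,2) ty | simp add: that)+
  have hW: "\<Delta> |- wind F\<lbrakk>shift k\<rbrakk> q z : IntT" if "\<Delta> |- q : LoopS1" "\<Delta> |- z : IntT" "drop k \<Delta> = G" "k \<le> length \<Delta>" for \<Delta> k q z
    by (rule conv_typing[OF hF[OF that] Feq[OF that(3,4)]])
  have W0: "\<Delta> |- wind F\<lbrakk>shift k\<rbrakk> (Refl Base) z \<sim> z : IntT" if z: "\<Delta> |- z : IntT" and k: "drop k \<Delta> = G" "k \<le> length \<Delta>" for \<Delta> k z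
  proof (rule path_conv[OF _ Feq[OF k]])
    show "\<Delta> |- wind F\<lbrakk>shift k\<rbrakk> (Refl Base) z \<sim> z : App F\<lbrakk>shift k\<rbrakk> Base"
    proof (rule path_eq)
      show "\<Delta> |- wind F\<lbrakk>shift k\<rbrakk> (Refl Base) z \<doteq> z : App F\<lbrakk>shift k\<rbrakk> Base"
        unfolding wind_def by (rule transport_Refl_eq[where A=S1]) (rule toF z ty | simp add: k)+
    qed (rule hF toF z k ty | simp add: k)+
  qed (rule ty)
  have WL: "\<Delta> |- wind F\<lbrakk>shift k\<rbrakk> Loop z \<sim> succZ z : IntT" if z: "\<Delta> |- z : IntT" and k: "drop k \<Delta> = G" "k \<le> length \<Delta>" for \<Delta> k z
    by (rule pathI, rule inh_subst[OF tl, of _ "z \<cdot> shift k"]) (rule hW z ty | simp add: k wind_def)+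
  have WS: "\<Delta> |- wind F\<lbrakk>shift k\<rbrakk> (step q) z \<sim> succZ (wind F\<lbrakk>shift k\<rbrakk> q z) : IntT"
    if q: "\<Delta> |- q : LoopS1" and z: "\<Delta> |- z : IntT" and k: "drop k \<Delta> = G" "k \<le> length \<Delta>" for \<Delta> k q z
  proof -
    have "\<Delta> |- F\<lbrakk>shift k\<rbrakk> : Pi S1 (Univ 0)" by (rule ty | simp add: k)+
    from transport_concat[OF this const_typing(4) q toF[OF z k]]
    have "\<Delta> |- wind F\<lbrakk>shift k\<rbrakk> (step q) z \<sim> wind F\<lbrakk>shift k\<rbrakk> Loop (wind F\<lbrakk>shift k\<rbrakk> q z) : App F\<lbrakk>shift k\<rbrakk> Base"
      by (simp add: wind_def step_def)
    from path_conv[OF this Feq[OF k] IntT_typing(1)] WL[OF hW[OF q z k] k]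
    show ?thesis by (rule path_trans)
  qed
  have Wap: "\<Delta> |- wind F\<lbrakk>shift k\<rbrakk> p z \<sim> wind F\<lbrakk>shift k\<rbrakk> q z : IntT"
    if pq: "\<Delta> |- p \<sim> q : LoopS1" and z: "\<Delta> |- z : IntT" and k: "drop k \<Delta> = G" "k \<le> length \<Delta>" for \<Delta> k p q z
    by (rule path_ap[OF pq, where t="wind F\<lbrakk>shift (Suc k)\<rbrakk> x0 z\<up>1"]) (rule hW z[THEN subst_has_type] ty | simp add: k)+
  have pwS': "\<Delta> |- pw\<lbrakk>succZ z \<cdot> shift k\<rbrakk> \<sim> step pw\<lbrakk>z \<cdot> shift k\<rbrakk> : LoopS1" if z: "\<Delta> |- z : IntT" and k: "drop k \<Delta> = G" "k \<le> length \<Delta>" for \<Delta> k z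
    by (rule pathI, rule inh_subst[OF pwS, of _ "z \<cdot> shift k"]) (rule z ty | simp add: k)+
  have pw0': "G |- pw\<langle>Inl ZeroN\<rangle> \<sim> Refl Base : LoopS1"
    by (rule pathI[OF pw0]) (rule ty | simp)+
  have z0: "\<Delta> |- Inl ZeroN : IntT" for \<Delta> by (rule ty)+
  let ?C = "Id IntT (wind F\<up>1 pw (Inl ZeroN)) x0"
  let ?D1 = "?C # IntT # G" and ?D2 = "Id IntT (wind F\<up>1 pw\<lbrakk>succZ x0 \<cdot> sh1\<rbrakk> (Inl ZeroN)) (succZ x0) # IntT # G"
  have enc_pw: "IntT # G |= ?C"
  proof (rule inh_Int_induct)
    show "IntT # G |- ?C type" by (rule hW ty | simp)+
    have "G |- wind F\<lbrakk>sh0\<rbrakk> pw\<langle>Inl ZeroN\<rangle> (Inl ZeroN) \<sim> wind F\<lbrakk>sh0\<rbrakk> (Refl Base) (Inl ZeroN) : IntT"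
      by (rule Wap[OF pw0' z0]) simp_all
    also have "G |- wind F\<lbrakk>sh0\<rbrakk> (Refl Base) (Inl ZeroN) \<sim> Inl ZeroN : IntT"
      by (rule W0[OF z0]) simp_all
    finally show "G |= ?C\<langle>Inl ZeroN\<rangle>" by (simp add: pathD)
    have x1: "?D1 |- x1 : IntT" "?D2 |- x1 : IntT" by (rule ty | simp)+
    have "?D1 |- wind F\<up>2 pw\<lbrakk>succZ x1 \<cdot> sh2\<rbrakk> (Inl ZeroN) \<sim> wind F\<up>2 (step pw\<lbrakk>x1 \<cdot> sh2\<rbrakk>) (Inl ZeroN) : IntT"
      by (rule Wap[OF pwS'[OF x1(1)] z0]) simp_all
    also have "?D1 |- wind F\<up>2 (step pw\<lbrakk>x1 \<cdot> sh2\<rbrakk>) (Inl ZeroN) \<sim> succZ (wind F\<up>2 pw\<lbrakk>x1 \<cdot> sh2\<rbrakk> (Inl ZeroN)) : IntT"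
      by (rule WS) (rule ty | simp)+
    also have "?D1 |- succZ (wind F\<up>2 pw\<lbrakk>x1 \<cdot> sh2\<rbrakk> (Inl ZeroN)) \<sim> succZ x1 : IntT"
      by (rule path_succZ, rule pathI, rule inhI[of _ x0]) (rule hW ty | simp)+
    finally show "?D1 |= ?C\<lbrakk>succZ x1 \<cdot> sh2\<rbrakk>" by (simp add: pathD)
    have ps: "?D2 |- predZ (succZ z) \<sim> z : IntT" if z: "?D2 |- z : IntT" for z
      by (rule pathI, rule inh_subst[OF pred_succ[of G], of _ "z \<cdot> sh2"]) (rule z ty | simp)+
    let ?w = "wind F\<up>2 pw\<lbrakk>x1 \<cdot> sh2\<rbrakk> (Inl ZeroN)"
    have w: "?D2 |- ?w : IntT" by (rule hW ty | simp)+
    have "?D2 |- succZ ?w \<sim> wind F\<up>2 (step pw\<lbrakk>x1 \<cdot> sh2\<rbrakk>) (Inl ZeroN) : IntT"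
      by (rule path_sym, rule WS) (rule ty | simp)+
    also have "?D2 |- wind F\<up>2 (step pw\<lbrakk>x1 \<cdot> sh2\<rbrakk>) (Inl ZeroN) \<sim> wind F\<up>2 pw\<lbrakk>succZ x1 \<cdot> sh2\<rbrakk> (Inl ZeroN) : IntT"
      by (rule Wap[OF path_sym[OF pwS'[OF x1(2)]] z0]) simp_all
    also have "?D2 |- wind F\<up>2 pw\<lbrakk>succZ x1 \<cdot> sh2\<rbrakk> (Inl ZeroN) \<sim> succZ x1 : IntT"
      by (rule pathI, rule inhI[of _ x0]) (rule hW ty | simp)+
    finally have "?D2 |- succZ ?w \<sim> succZ x1 : IntT" .
    from path_trans[OF path_sym[OF ps[OF w]] path_trans[OF path_predZ[OF this] ps[OF x1(2)]]]
    show "?C\<lbrakk>succZ x0 \<cdot> sh1\<rbrakk> # IntT # G |= ?C\<up>1" by (simp add: pathD)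
  qed
  \<comment> \<open>decoding over \<open>Base\<close>, typed both over \<open>IntT\<close> and over the fibre \<open>F Base\<close>\<close>
  define f where "f = Lam IntT pw"
  have f: "G |- f : Pi IntT LoopS1" unfolding f_def by (rule ty | simp)+
  have fF: "G |- f : Pi (App F Base) LoopS1"
    by (rule inst_conv_typing[OF eq_term_sym[OF FB], where B="Pi x0 LoopS1"]) (rule f[THEN typing_eqI] ty | simp)+
  have fb: "\<Delta> |- App f\<lbrakk>shift k\<rbrakk> z \<sim> pw\<lbrakk>z \<cdot> shift k\<rbrakk> : LoopS1" if z: "\<Delta> |- z : IntT" and k: "drop k \<Delta> = G" "k \<le> length \<Delta>" for \<Delta> k z
  proof (rule path_eq)
    show "\<Delta> |- App f\<lbrakk>shift k\<rbrakk> z \<doteq> pw\<lbrakk>z \<cdot> shift k\<rbrakk> : LoopS1"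
      unfolding f_def apply simp
      by (rule beta[where B=LoopS1]) (rule z ty | simp add: k)+
    show "\<Delta> |- App f\<lbrakk>shift k\<rbrakk> z : LoopS1" by (rule f[THEN subst_has_type] z ty | simp add: k)+
  qed (rule z ty | simp add: k)+
  have i0: "IntT # G |- x0 : IntT" by (rule ty | simp)+
  have "IntT # G |- step (App f\<up>1 x0) \<sim> step pw\<lbrakk>x0 \<cdot> sh1\<rbrakk> : LoopS1"
    by (rule path_step, rule fb[OF i0]) simp_all
  also have "IntT # G |- step pw\<lbrakk>x0 \<cdot> sh1\<rbrakk> \<sim> pw\<lbrakk>succZ x0 \<cdot> sh1\<rbrakk> : LoopS1"
    by (rule path_sym, rule pwS'[OF i0]) simp_all
  also have "IntT # G |- pw\<lbrakk>succZ x0 \<cdot> sh1\<rbrakk> \<sim> App f\<up>1 (succZ x0) : LoopS1"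
    by (rule path_sym, rule fb) (rule ty | simp)+
  also have "IntT # G |- App f\<up>1 (succZ x0) \<sim> App f\<up>1 (wind F\<up>1 Loop x0) : LoopS1"
    by (rule path_ap[OF path_sym[OF WL[where k="Suc 0", OF i0]], where t="App f\<up>2 x0"]) (rule f[THEN subst_has_type] ty | simp)+
  finally have H': "IntT # G |= Id LoopS1 (step (App f\<up>1 x0)) (App f\<up>1 (wind F\<up>1 Loop x0))"
    by (rule pathD)
  have xF: "App F Base # G |- x0 : IntT"
    by (rule conv_typing[OF _ Feq[where k="Suc 0"]]) (rule ty | simp)+
  have H: "App F Base # G |= Id LoopS1 (step (App f\<up>1 x0)) (App f\<up>1 (wind F\<up>1 Loop x0))"
    by (rule inh_subst[OF H', of _ "x0 \<cdot> sh1"]) (rule xF[THEN typing_eqI] ty | simp)+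
  obtain l where l: "G |- l : Id (Pi (App F Base) LoopS1) (transport (Pi (App F\<up>1 x0) (Id S1 Base x1)) Base Base Loop f) f"
    using arrow_transport[OF F fF const_typing(4)] H by (auto simp: wind_def step_def elim: inhE)
  note [ty] = l[THEN subst_has_type] l[THEN typing_eqI] fF[THEN subst_has_type] fF[THEN typing_eqI]
  let ?dec = "S1Ind (Pi (App F\<up>1 x0) (Id S1 Base x1)) f l"
  let ?P = "Id (Id S1 Base x1) (App (S1Ind (Pi (App F\<up>3 x0) (Id S1 Base x1)) f\<up>2 l\<up>2 x1) (transport (App F\<up>3 x0) Base x1 x0 (Inl ZeroN))) x0"
  have decB: "\<Delta> |- App (S1Ind (Pi (App F\<lbrakk>shift (Suc k)\<rbrakk> x0) (Id S1 Base x1)) f\<lbrakk>shift k\<rbrakk> l\<lbrakk>shift k\<rbrakk> Base) w \<sim> App f\<lbrakk>shift k\<rbrakk> w : LoopS1"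
    if w: "\<Delta> |- w : App F\<lbrakk>shift k\<rbrakk> Base" and k: "drop k \<Delta> = G" "k \<le> length \<Delta>" for \<Delta> k w
    by (rule path_eq, rule App_cong_left[where A="App F\<lbrakk>shift k\<rbrakk> Base" and B=LoopS1], rule S1Ind_Base_eq) (rule w ty | simp add: k)+
  have dec: "Id S1 Base x0 # S1 # G |= ?P"
  proof (rule path_induction[where A=S1 and a=Base, simplified])
    let ?w = "wind F\<lbrakk>sh0\<rbrakk> (Refl Base) (Inl ZeroN)"
    have "G |- App (S1Ind (Pi (App F\<up>1 x0) (Id S1 Base x1)) f\<lbrakk>sh0\<rbrakk> l\<lbrakk>sh0\<rbrakk> Base) ?w \<sim> App f\<lbrakk>sh0\<rbrakk> ?w : LoopS1"
      by (rule decB, rule hF[OF Refl_typing z0]) (rule ty | simp)+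
    also have "G |- App f\<lbrakk>sh0\<rbrakk> ?w \<sim> App f\<lbrakk>sh0\<rbrakk> (Inl ZeroN) : LoopS1"
      by (rule path_ap[OF W0[where k=0, OF z0], where t="App f\<up>1 x0"]) (rule f[THEN subst_has_type] ty | simp)+
    also have "G |- App f\<lbrakk>sh0\<rbrakk> (Inl ZeroN) \<sim> pw\<lbrakk>Inl ZeroN \<cdot> sh0\<rbrakk> : LoopS1"
      by (rule fb[OF z0]) simp_all
    also note pw0'
    finally show "G |= ?P\<langle>Refl Base, Base\<rangle>" by (simp add: pathD wind_def)
    show "Id S1 Base x0 # S1 # G |- ?P type" by (rule toF[OF z0] ty | simp)+
  qed (rule ty | simp)+
  show thesis
  proof (rule that[of "wind F\<up>1 x0 (Inl ZeroN)" pw])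
    let ?e = "wind F\<up>1 x0 (Inl ZeroN)" and ?\<Delta> = "LoopS1 # G"
    show e: "?\<Delta> |- ?e : IntT" by (rule hW ty | simp)+
    have eF: "?\<Delta> |- ?e : App F\<up>1 Base" by (rule hF ty | simp)+
    show "IntT # G |= Id IntT ?e\<lbrakk>pw \<cdot> sh1\<rbrakk> x0" using enc_pw by simp
    have "?\<Delta> |- pw\<lbrakk>?e \<cdot> sh1\<rbrakk> \<sim> App f\<up>1 ?e : LoopS1"
      by (rule path_sym, rule fb[OF e]) simp_all
    also have "?\<Delta> |- App f\<up>1 ?e \<sim> App (S1Ind (Pi (App F\<up>2 x0) (Id S1 Base x1)) f\<up>1 l\<up>1 Base) ?e : LoopS1"
      by (rule path_sym, rule decB[OF eF]) simp_all
    finally have 1: "?\<Delta> |- pw\<lbrakk>?e \<cdot> sh1\<rbrakk> \<sim> App (S1Ind (Pi (App F\<up>2 x0) (Id S1 Base x1)) f\<up>1 l\<up>1 Base) ?e : LoopS1" .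
    have 2: "?\<Delta> |= Id LoopS1 (App (S1Ind (Pi (App F\<up>2 x0) (Id S1 Base x1)) f\<up>1 l\<up>1 Base) ?e) x0"
      by (rule inh_subst[OF dec, of _ "x0 \<cdot> Base \<cdot> sh1"]) (rule ty | simp add: wind_def)+
    have "?\<Delta> |- x0 : LoopS1" by (rule ty | simp)+
    with 1 2 show "?\<Delta> |= Id LoopS1 pw\<lbrakk>?e \<cdot> sh1\<rbrakk> x0"
      unfolding path_def using id_trans by blast
  qed (rule pw)
qed

section \<open>Set truncation\<close>

lemma TrInd_typing [ty]:
  "G |- t : Trunc A \<Longrightarrow> G |- A type \<Longrightarrow> Trunc A # G |- C type \<Longrightarrow> Trunc A # G |- s : isset C \<Longrightarrow>
   A # G |- g : C\<lbrakk>TrIn x0 \<cdot> sh1\<rbrakk> \<Longrightarrow> T = C\<langle>t\<rangle> \<Longrightarrow> G |- TrInd C s g t : T"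
  unfolding has_type_def using Trunc_elim[of A G C _ s g t] Trunc_type[of G A]
  by (auto simp: is_type_def ctx_Cons)
lemma TrInd_TrIn_eq:
  "G |- A type \<Longrightarrow> Trunc A # G |- C type \<Longrightarrow> Trunc A # G |- s : isset C \<Longrightarrow>
   A # G |- g : C\<lbrakk>TrIn x0 \<cdot> sh1\<rbrakk> \<Longrightarrow> G |- a : A \<Longrightarrow> r = g\<langle>a\<rangle> \<Longrightarrow> T = C\<langle>TrIn a\<rangle> \<Longrightarrow> G |- TrInd C s g (TrIn a) \<doteq> r : T"
  unfolding has_type_def eq_term_def using Trunc_comp[of A G C _ s g a] Trunc_type[of G A]
  by (auto simp: is_type_def ctx_Cons)
lemma TrPath_typing:
  "G |- A type \<Longrightarrow> G |- x : Trunc A \<Longrightarrow> G |- y : Trunc A \<Longrightarrow> G |- p : Id (Trunc A) x y \<Longrightarrow> G |- q : Id (Trunc A) x y \<Longrightarrow>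
   G |- TrPath x y p q : Id (Id (Trunc A) x y) p q"
  unfolding has_type_def is_type_def by (auto intro: Trunc_path)

lemma inh_Trunc:
  assumes A: "G |- A type" and C: "Trunc A # G |- C type" and s: "Trunc A # G |= isset C" and g: "A # G |= C\<lbrakk>TrIn x0 \<cdot> sh1\<rbrakk>"
  shows "Trunc A # G |= C"
proof -
  obtain s' where s': "Trunc A # G |- s' : isset C" using s by (rule inhE)
  obtain g' where g': "A # G |- g' : C\<lbrakk>TrIn x0 \<cdot> sh1\<rbrakk>" using g by (rule inhE)
  note [ty] = A A[THEN subst_is_type] C C[THEN subst_is_type] s'[THEN subst_has_type] g'[THEN subst_has_type]
  have "Trunc A # G |- TrInd C\<lbrakk>x0 \<cdot> sh2\<rbrakk> s'\<lbrakk>x0 \<cdot> sh2\<rbrakk> g'\<lbrakk>x0 \<cdot> sh2\<rbrakk> x0 : C"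
    by (rule TrInd_typing[where A="A\<up>1"]) (rule ty | simp)+
  then show ?thesis by (rule inhI)
qed

lemma isset_Trunc:
  assumes A: "G |- A type" shows "G |= isset (Trunc A)"
proof -
  note [ty] = A A[THEN subst_is_type]
  have "G |- Lam (Trunc A) (Lam (Trunc A\<up>1) (Lam (Id (Trunc A\<up>2) x1 x0) (Lam (Id (Trunc A\<up>3) x2 x1) (TrPath x3 x2 x1 x0)))) : isset (Trunc A)"
    unfolding isset_def by (rule TrPath_typing[where A="A\<up>4"] ty | simp)+
  then show ?thesis by (rule inhI)
qed

text \<open>
  A map into a set extends to the truncation of its domain, and so does a homotopy between maps into
  the truncation.
\<close>

lemma equiv_Trunc:
  assumes A: "G |- A type" and B: "G |- B type" and e: "A # G |- e : B\<up>1" and d: "B # G |- d : A\<up>1"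
    and ed: "B # G |= Id B\<up>1 e\<lbrakk>d \<cdot> sh1\<rbrakk> x0" and de: "A # G |= Id A\<up>1 d\<lbrakk>e \<cdot> sh1\<rbrakk> x0" and s: "G |= isset B"
  shows "G |= equiv (Trunc A) B"
proof -
  obtain s' where s': "G |- s' : isset B" using s by (rule inhE)
  note [ty] = A A[THEN subst_is_type] B B[THEN subst_is_type] e[THEN subst_has_type] d[THEN subst_has_type] e[THEN typing_eqI] d[THEN typing_eqI] s'[THEN subst_has_type]
  let ?f = "\<lambda>t. TrInd B\<up>2 s'\<up>2 e\<lbrakk>x0 \<cdot> sh2\<rbrakk> t"
  have f: "C # G |- ?f t : B\<up>1" if "C # G |- t : Trunc A\<up>1" for C t
    by (rule TrInd_typing[OF that]) (rule ty | simp)+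
  have fe: "C # G |- ?f (TrIn a) \<sim> e\<lbrakk>a \<cdot> sh1\<rbrakk> : B\<up>1" if a: "C # G |- a : A\<up>1" for C a
    by (rule path_eq, rule TrInd_TrIn_eq[where A="A\<up>1"]) (rule f a ty | simp)+
  show ?thesis
  proof (rule inh_equivI[where f="?f x0" and g="TrIn d"])
    have "B # G |- ?f (TrIn d) \<sim> e\<lbrakk>d \<cdot> sh1\<rbrakk> : B\<up>1" by (rule fe[OF d])
    also have "B # G |- e\<lbrakk>d \<cdot> sh1\<rbrakk> \<sim> x0 : B\<up>1" by (rule pathI[OF ed]) (rule ty | simp)+
    finally show "B # G |= Id B\<up>1 (TrInd B\<up>2 s'\<up>2 e\<lbrakk>x0 \<cdot> sh2\<rbrakk> x0)\<lbrakk>TrIn d \<cdot> sh1\<rbrakk> x0" by (simp add: pathD)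
    show "Trunc A # G |- TrInd B\<up>2 s'\<up>2 e\<lbrakk>x0 \<cdot> sh2\<rbrakk> x0 : B\<up>1" by (rule f) (rule ty | simp)+
    have x: "A # G |- x0 : A\<up>1" by (rule ty | simp)+
    have "A # G |- d\<lbrakk>?f (TrIn x0) \<cdot> sh1\<rbrakk> \<sim> d\<lbrakk>e \<cdot> sh1\<rbrakk> : A\<up>1"
      by (rule path_ap[OF fe[OF x, simplified], where t="d\<lbrakk>x0 \<cdot> sh2\<rbrakk>"]) (rule ty | simp)+
    also have "A # G |- d\<lbrakk>e \<cdot> sh1\<rbrakk> \<sim> x0 : A\<up>1" by (rule pathI[OF de]) (rule ty | simp)+
    finally have 1: "A # G |- d\<lbrakk>?f (TrIn x0) \<cdot> sh1\<rbrakk> \<sim> x0 : A\<up>1" .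
    have 2: "A # G |- TrIn d\<lbrakk>?f (TrIn x0) \<cdot> sh1\<rbrakk> \<sim> TrIn x0 : Trunc A\<up>1"
      by (rule path_ap[OF 1, where t="TrIn x0"]) (rule ty | simp)+
    have x': "Trunc A # G |- x0 : Trunc A\<up>1" by (rule ty | simp)+
    have 3: "Trunc A # G |- TrIn d\<lbrakk>?f x0 \<cdot> sh1\<rbrakk> : Trunc A\<up>1" by (rule f[OF x'] ty | simp)+
    have "Trunc A # G |= Id (Trunc A\<up>1) (TrIn d\<lbrakk>?f x0 \<cdot> sh1\<rbrakk>) x0"
    proof (rule inh_Trunc[OF A])
      show "Trunc A # G |= isset (Id (Trunc A\<up>1) (TrIn d\<lbrakk>?f x0 \<cdot> sh1\<rbrakk>) x0)"
        by (rule isset_Id_isset[OF isset_Trunc]) (rule 3 ty | simp)+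
      show "A # G |= (Id (Trunc A\<up>1) (TrIn d\<lbrakk>?f x0 \<cdot> sh1\<rbrakk>) x0)\<lbrakk>TrIn x0 \<cdot> sh1\<rbrakk>"
        using pathD[OF 2] by simp
    qed (rule 3 ty | simp)+
    then show "Trunc A # G |= Id (Trunc A)\<up>1 (TrIn d)\<lbrakk>?f x0 \<cdot> sh1\<rbrakk> x0" by simp
  qed (rule ty | simp)+
qed

text \<open>
  An inhabited proposition is contractible, so it can be exchanged for \<open>Unit\<close> before truncating.
\<close>

lemma equiv_Trunc_isprop:
  assumes A: "G |- A type" and a: "G |- a : A" and pr: "G |= isprop A"
  shows "G |= equiv (Trunc A) Unit"
proof -
  note [ty] = A A[THEN subst_is_type] a[THEN subst_has_type]
  have pA: "G |= Pi A (Id A\<up>1 a\<up>1 x0)"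
    by (rule inh_App[OF pr[unfolded isprop_def] a]) simp
  have "G |= Pi Unit (Id Unit Star x0)"
    by (rule inh_App[OF isprop_Unit[unfolded isprop_def] const_typing(1)]) simp
  note pU = inh_unLam[OF this]
  show ?thesis
    by (rule equiv_Trunc[where e=Star and d="a\<up>1"]) (rule isprop_imp_isset isprop_Unit ty | simp add: inh_unLam[OF pA] pU)+
qed

lemma isset_loops: "G |= isset LoopS1"
proof -
  obtain enc pw where "LoopS1 # G |- enc : IntT" "IntT # G |- pw : LoopS1" "LoopS1 # G |= Id LoopS1 pw\<lbrakk>enc \<cdot> sh1\<rbrakk> x0"
    by (rule loop_equiv)
  then show ?thesis
    by (intro isset_retract[OF _ _ _ _ _ isset_Int]) (simp_all add: Id_type base_types const_typing IntT_typing)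
qed

lemma Trunc_loops_equiv: "G |= equiv (Trunc LoopS1) IntT"
proof -
  obtain enc pw where "LoopS1 # G |- enc : IntT" "IntT # G |- pw : LoopS1"
    "IntT # G |= Id IntT enc\<lbrakk>pw \<cdot> sh1\<rbrakk> x0" "LoopS1 # G |= Id LoopS1 pw\<lbrakk>enc \<cdot> sh1\<rbrakk> x0"
    by (rule loop_equiv)
  then show ?thesis
    by (intro equiv_Trunc[OF _ _ _ _ _ _ isset_Int]) (simp_all add: Id_type base_types const_typing IntT_typing)
qed

section \<open>Homotopy groups of the circle\<close>

lemma subst_pointed [simp]:
  "(PtType i)\<lbrakk>\<sigma>\<rbrakk> = PtType i" "(carrier i X)\<lbrakk>\<sigma>\<rbrakk> = carrier i X\<lbrakk>\<sigma>\<rbrakk>" "(point i X)\<lbrakk>\<sigma>\<rbrakk> = point i X\<lbrakk>\<sigma>\<rbrakk>" "(Omega i X)\<lbrakk>\<sigma>\<rbrakk> = Omega i X\<lbrakk>\<sigma>\<rbrakk>"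
  "(OmegaN i n X)\<lbrakk>\<sigma>\<rbrakk> = OmegaN i n\<lbrakk>\<sigma>\<rbrakk> X\<lbrakk>\<sigma>\<rbrakk>" "(homotopy_group i n X)\<lbrakk>\<sigma>\<rbrakk> = homotopy_group i n\<lbrakk>\<sigma>\<rbrakk> X\<lbrakk>\<sigma>\<rbrakk>" "S1pt\<lbrakk>\<sigma>\<rbrakk> = S1pt" "(num k)\<lbrakk>\<sigma>\<rbrakk> = num k" "(addN m n)\<lbrakk>\<sigma>\<rbrakk> = addN m\<lbrakk>\<sigma>\<rbrakk> n\<lbrakk>\<sigma>\<rbrakk>"
  apply (simp_all add: PtType_def carrier_def point_def Omega_def OmegaN_def homotopy_group_def S1pt_def addN_def)
  by (induction k) simp_all

lemma PtType_type [ty]: "G |- PtType 0 type"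
  unfolding PtType_def by (rule ty | simp)+
lemma carrier_typing [ty]: "G |- X : PtType 0 \<Longrightarrow> G |- carrier 0 X : Univ 0"
  unfolding PtType_def carrier_def by (erule SigInd_typing) (rule ty | simp)+
lemmas El_carrier [ty] = El[OF carrier_typing]
lemma S1pt_typing [ty]: "G |- S1pt : PtType 0"
  unfolding S1pt_def PtType_def by (rule ty | simp)+
lemma pointed_Pair_typing: "G |- A : Univ 0 \<Longrightarrow> G |- a : A \<Longrightarrow> G |- Pair A a : PtType 0"
  unfolding PtType_def by (rule ty | assumption | simp)+

lemma carrier_Pair_eq:
  assumes A: "G |- A : Univ 0" and a: "G |- a : A"
  shows "G |- carrier 0 (Pair A a) \<doteq> A : Univ 0"
  unfolding carrier_def by (rule SigInd_Pair_eq[OF _ _ _ _ A, where B=x0]) (rule a ty | simp)+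

text \<open>
  The projection \<open>point\<close> is typed over the projection \<open>carrier\<close>, which computes on the pair in the branch.
\<close>

lemma point_branch: "x0 # Univ 0 # G |- x0 : (carrier 0 x0)\<lbrakk>Pair x1 x0 \<cdot> sh2\<rbrakk>"
proof (rule conv_typing)
  show "x0 # Univ 0 # G |- x0 : x1" by (rule ty | simp)+
  have "x0 # Univ 0 # G |- x1 \<doteq> carrier 0 (Pair x1 x0) type"
    by (rule eq_type_sym, rule eq_type_El, rule carrier_Pair_eq) (rule ty | simp)+
  then show "x0 # Univ 0 # G |- x1 \<doteq> (carrier 0 x0)\<lbrakk>Pair x1 x0 \<cdot> sh2\<rbrakk> type" by simp
qed

lemma point_typing [ty]:
  assumes X: "G |- X : PtType 0" and T: "T = carrier 0 X"
  shows "G |- point 0 X : T"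
  unfolding T point_def
  by (rule SigInd_typing[OF X[unfolded PtType_def]]) (rule point_branch El_carrier[unfolded PtType_def] ty | simp)+

lemma point_Pair_eq:
  assumes A: "G |- A : Univ 0" and a: "G |- a : A"
  shows "G |- point 0 (Pair A a) \<doteq> a : carrier 0 (Pair A a)"
  unfolding point_def by (rule SigInd_Pair_eq[OF _ _ _ _ A, where B=x0]) (rule a point_branch El_carrier[unfolded PtType_def] ty | simp)+

lemma Omega_typing [ty]: assumes X [ty]: "G |- X : PtType 0" and T: "T = PtType 0" shows "G |- Omega 0 X : T"
  unfolding Omega_def T by (rule pointed_Pair_typing) (rule ty | simp)+

lemma OmegaN_typing [ty]:
  assumes n [ty]: "G |- n : NatT" and X: "G |- X : PtType 0" and T: "T = PtType 0"
  shows "G |- OmegaN 0 n X : T"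
  unfolding OmegaN_def T by (rule NatInd_typing) (rule ty X | simp)+

lemma carrier_OmegaN_suc_eq:
  assumes n [ty]: "G |- n : NatT" and X [ty]: "G |- X : PtType 0"
  shows "G |- carrier 0 (OmegaN 0 (SucN n) X) \<doteq> Id (carrier 0 (OmegaN 0 n X)) (point 0 (OmegaN 0 n X)) (point 0 (OmegaN 0 n X)) : Univ 0"
proof -
  have 1: "G |- OmegaN 0 (SucN n) X \<doteq> Omega 0 (OmegaN 0 n X) : PtType 0"
    unfolding OmegaN_def by (rule NatInd_suc_eq) (rule ty | simp)+
  have "G |- (carrier 0 x0)\<langle>OmegaN 0 (SucN n) X\<rangle> \<doteq> (carrier 0 x0)\<langle>Omega 0 (OmegaN 0 n X)\<rangle> : Univ 0"
    by (rule eq_subst_term[OF _ _ _ _ 1, where B="Univ 0"]) (rule eq_type_refl ty | simp)+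
  then have "G |- carrier 0 (OmegaN 0 (SucN n) X) \<doteq> carrier 0 (Omega 0 (OmegaN 0 n X)) : Univ 0" by simp
  also have "G |- carrier 0 (Omega 0 (OmegaN 0 n X)) \<doteq> Id (carrier 0 (OmegaN 0 n X)) (point 0 (OmegaN 0 n X)) (point 0 (OmegaN 0 n X)) : Univ 0"
    unfolding Omega_def by (rule carrier_Pair_eq) (rule ty | simp)+
  finally show ?thesis .
qed

lemma Id_cong: "G |- A \<doteq> A' : Univ i \<Longrightarrow> G |- a \<doteq> a' : A \<Longrightarrow> G |- b \<doteq> b' : A \<Longrightarrow> G |- Id A a b \<doteq> Id A' a' b' : Univ i"
  unfolding guarded_defs by (meson Id_form_cong)

lemma carrier_OmegaN_one_eq: "G |- carrier 0 (OmegaN 0 (SucN ZeroN) S1pt) \<doteq> LoopS1 : Univ 0"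
proof -
  let ?Z = "OmegaN 0 ZeroN S1pt" and ?I = "Id (carrier 0 x0) (point 0 x0) (point 0 x0)"
  have "G |- carrier 0 (OmegaN 0 (SucN ZeroN) S1pt) \<doteq> ?I\<langle>?Z\<rangle> : Univ 0"
    using carrier_OmegaN_suc_eq[of G ZeroN S1pt] by (simp add: const_typing S1pt_typing)
  also have 1: "G |- ?Z \<doteq> S1pt : PtType 0"
    unfolding OmegaN_def by (rule NatInd_zero_eq) (rule ty | simp)+
  have "G |- ?I\<langle>?Z\<rangle> \<doteq> ?I\<langle>S1pt\<rangle> : Univ 0"
    by (rule eq_subst_term[OF _ _ _ _ 1, where B="Univ 0"]) (rule eq_type_refl ty | simp)+
  also have "G |- ?I\<langle>S1pt\<rangle> \<doteq> LoopS1 : Univ 0"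
    unfolding S1pt_def apply simp
    by (rule Id_cong carrier_Pair_eq point_Pair_eq ty)+
  finally show ?thesis .
qed

text \<open>
  The loop space of the circle is a set since it is equivalent to the integers, and path spaces of sets are sets.
\<close>

lemma isset_OmegaN: "NatT # G |= isset (carrier 0 (OmegaN 0 (SucN x0) S1pt))"
proof (rule inh_Nat)
  show "NatT # G |- isset (carrier 0 (OmegaN 0 (SucN x0) S1pt)) type" by (rule ty | simp)+
  show "G |= (isset (carrier 0 (OmegaN 0 (SucN x0) S1pt)))\<langle>ZeroN\<rangle>"
    by (rule inh_subst_eq[OF carrier_OmegaN_one_eq, where P="isset x0"]) (rule ty | simp add: isset_loops)+
  let ?C = "isset (carrier 0 (OmegaN 0 (SucN x0) S1pt))"
  let ?\<Delta> = "?C # NatT # G"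
  have n [ty]: "?\<Delta> |- x1 : NatT" by (rule ty | simp)+
  have IH: "?\<Delta> |= isset (carrier 0 (OmegaN 0 (SucN x1) S1pt))"
    by (rule inhI[of _ x0]) (rule ty | simp)+
  have s: "?\<Delta> |= isset (Id (carrier 0 (OmegaN 0 (SucN x1) S1pt)) (point 0 (OmegaN 0 (SucN x1) S1pt)) (point 0 (OmegaN 0 (SucN x1) S1pt)))"
    by (rule isset_Id_isset[OF IH]) (rule ty | simp)+
  show "?\<Delta> |= ?C\<lbrakk>SucN x1 \<cdot> sh2\<rbrakk>"
    by (rule inh_subst_eq[OF carrier_OmegaN_suc_eq[OF SucN_typing[OF n] S1pt_typing], where P="isset x0"]) (rule ty | simp add: s)+
qed

text \<open>
  The loop space of index \<open>k + 2\<close> is a path space in the set of index \<open>k + 1\<close>, hence a proposition, inhabited by \<open>refl\<close>.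
\<close>

lemma homotopy_group_trivial:
  assumes k [ty]: "G |- k : NatT"
  shows "G |= equiv (homotopy_group 0 (SucN (SucN k)) S1pt) Unit"
proof -
  let ?Z = "OmegaN 0 (SucN k) S1pt"
  have s: "G |= isset (carrier 0 ?Z)"
    by (rule inh_subst[OF isset_OmegaN[of G], of _ "k \<cdot> sh0"]) (rule ty | simp)+
  have e: "G |= equiv (Trunc (Id (carrier 0 ?Z) (point 0 ?Z) (point 0 ?Z))) Unit"
    by (rule equiv_Trunc_isprop[where a="Refl (point 0 ?Z)"]) (rule isset_Id[OF s] ty | simp)+
  show ?thesis unfolding homotopy_group_def
    by (rule inh_subst_eq[OF carrier_OmegaN_suc_eq[OF SucN_typing[OF k] S1pt_typing], where P="equiv (Trunc x0) Unit"]) (rule ty | simp add: e)+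
qed

lemma addN_typing [ty]: "G |- m : NatT \<Longrightarrow> G |- n : NatT \<Longrightarrow> G |- addN m n : NatT"
  unfolding addN_def by (rule ty | assumption | simp)+

lemma addN_zero: assumes [ty]: "G |- n : NatT" shows "G |- addN ZeroN n \<sim> n : NatT"
  by (rule path_eq, unfold addN_def, rule NatInd_zero_eq) (rule ty | simp)+

lemma addN_suc:
  assumes [ty]: "G |- m : NatT" "G |- n : NatT" shows "G |- addN (SucN m) n \<sim> SucN (addN m n) : NatT"
  by (rule path_eq, unfold addN_def, rule NatInd_suc_eq) (rule ty | simp)+

lemma path_SucN: "G |- m \<sim> n : NatT \<Longrightarrow> G |- SucN m \<sim> SucN n : NatT"
  by (erule path_ap[where t="SucN x0"]) (rule ty | simp)+

lemma homotopy_group_type [ty]: "G |- n : NatT \<Longrightarrow> G |- homotopy_group 0 n S1pt type"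
  unfolding homotopy_group_def by (rule ty | assumption | simp)+

theorem corollary4p21:
  shows "inhabited (equiv (homotopy_group 0 (num 1) S1pt) IntT) \<and>
    inhabited (Pi NatT (arrow (leN (num 2) (Var 0))
                              (equiv (homotopy_group 0 (Var 0) S1pt) Unit)))"
proof
  have inhabited: "inhabited A" if "[] |= A" for A
    using that by (auto simp: inhabited_def inh_def intro: ctx_empty)
  show "inhabited (equiv (homotopy_group 0 (num 1) S1pt) IntT)"
  proof (rule inhabited)
    have "[] |= equiv (homotopy_group 0 (SucN ZeroN) S1pt) IntT"
      unfolding homotopy_group_def
      by (rule inh_subst_eq[OF carrier_OmegaN_one_eq, where P="equiv (Trunc x0) IntT"]) (rule ty | simp add: Trunc_loops_equiv)+
    then show "[] |= equiv (homotopy_group 0 (num 1) S1pt) IntT" by simp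
  qed
  let ?two = "SucN (SucN ZeroN)"
  let ?E = "\<lambda>n. equiv (homotopy_group 0 n S1pt) Unit"
  let ?\<Delta> = "Id NatT (addN ?two x0) x1 # NatT # NatT # []"
  have k [ty]: "?\<Delta> |- x1 : NatT" by (rule ty | simp)+
  have "?\<Delta> |- SucN (SucN x1) \<sim> SucN (SucN (addN ZeroN x1)) : NatT"
    by (rule path_SucN path_sym[OF addN_zero] k)+
  also have "?\<Delta> |- SucN (SucN (addN ZeroN x1)) \<sim> SucN (addN (SucN ZeroN) x1) : NatT"
    by (rule path_SucN path_sym[OF addN_suc] ty)+
  also have "?\<Delta> |- SucN (addN (SucN ZeroN) x1) \<sim> addN ?two x1 : NatT"
    by (rule path_sym[OF addN_suc] ty)+
  also have "?\<Delta> |- addN ?two x1 \<sim> x2 : NatT"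
    by (rule pathI, rule inhI[of _ x0]) (rule ty | simp)+
  finally have e: "?\<Delta> |= Id NatT (SucN (SucN x1)) x2" by (rule pathD)
  have "?\<Delta> |= (?E x0)\<langle>x2\<rangle>"
    by (rule leibniz[OF _ _ _ _ e]) (rule ty | simp add: homotopy_group_trivial[OF k])+
  then have main: "?\<Delta> |= ?E x2" by simp
  have "[] |= Pi NatT (arrow (leN (num 2) (Var 0)) (?E (Var 0)))"
    apply (rule inh_Lam)
     apply (rule ty)
    apply (simp add: leN_def)
    apply (rule inh_Lam)
     apply (rule ty | simp)+
    apply (rule inh_Sig)
       apply (rule main ty | simp)+
    done
  then show "inhabited (Pi NatT (arrow (leN (num 2) (Var 0)) (?E (Var 0))))"
    by (rule inhabited)
qed

end
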